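(* Let $G_0$ be a locally compact group with an action $g\mapsto g^r$ ($r\in\mathbb R^*_+$) of $\mathbb R^*_+$ on $G_0$ by automorphisms, let $G=\mathbb R^*_+\rightthreetimes G_0$ be the semidirect product, and let $T$ be a summable unitary representation of $G_0$ in a Hilbert space $K$ with respect to $dm(r)=e^{-u(r)/2}d^*r$. Let $\widetilde T$ be the special unitary representation of $G_0$ in $\mathcal K=\int_0^\infty K_r\,d^*r$, $K_r=K$, given by $(\widetilde T(g)f)(r)=T(g^r)f(r)$. Then $\widetilde T$ extends to a unitary representation of $G$ (also denoted $\widetilde T$) in which the operators corresponding to elements $r_0$ of the subgroup $\mathbb R^*_+$ have the form $$(\widetilde T(r_0)f)(r)=f(rr_0).$$ Moreover, for every almost invariant vector $h\in K$, the map $\beta:G\to\mathcal K$, $$\beta(g,r)=(\widetilde T(g)f)(r)-f(r),\qquad\text{where } f(r)=e^{-u(r)/2}h,$$ is a nontrivial 1-cocycle of the representation $\widetilde T$ of $G$.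
   Context: $\mathbb R^*_+$ is the multiplicative group of positive reals and $d^*r=r^{-1}dr$ is its Haar measure. The function $u$ is smooth on $[0,\infty)$, positive on $(0,\infty)$, with $\int_\epsilon^\infty e^{-u(r)/2}d^*r<\infty$ for every $\epsilon>0$. The action of $\mathbb R^*_+$ is continuous and satisfies $(g^{r_1})^{r_2}=g^{r_1r_2}$. The group $G=\mathbb R^*_+\rightthreetimes G_0$ is the set of pairs $(r,g)\in\mathbb R^*_+\times G_0$ with multiplication $(r_1,g_1)(r_2,g_2)=(r_1r_2,\,g_1^{r_2^{-1}}g_2)$; $r$ is identified with $(r,e)$ and $g$ with $(1,g)$, so that $r g r^{-1}=g^r$. Put $T_r(g)=T(g^r)$. The representation $T$ is summable if $K$ contains no nonzero vector invariant under the operators of $T$ and there exists a nonzero $h\in K$ with $$\int_0^\infty\|T_r(g)h-h\|\,e^{-u(r)/2}\,d^*r<\infty\quad\text{for every } g\in G_0 .$$ Any such nonzero $h$ is called an almost invariant vector. $\mathcal K$ is the space of measurable functions $f:\mathbb R^*_+\to K$ with $\|f\|^2=\int_0^\infty\|f(r)\|^2d^*r<\infty$. The function $f(r)=e^{-u(r)/2}h$ in the formula for $\beta$ need not lie in $\mathcal K$; $\widetilde T(g)$ acts on it by the same formulas. A 1-cocycle of a unitary representation $S$ of a group $G$ in $H$ is a continuous map $\beta:G\to H$ with $\beta(g_1g_2)=S(g_1)\beta(g_2)+\beta(g_1)$; it is nontrivial if it is not of the form $g\mapsto S(g)\xi-\xi$, $\xi\in H$. A representation is special if it has a nontrivial 1-cocycle.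 *)

theory Defs
  imports "HOL-Analysis.Analysis" "HOL-Algebra.Group"
begin

section \<open>Complex Hilbert spaces\<close>

class complex_hilbert = banach +
  fixes scaleC :: "complex \<Rightarrow> 'a \<Rightarrow> 'a"
    and cinner :: "'a \<Rightarrow> 'a \<Rightarrow> complex"
  assumes scaleC_add_right: "scaleC c (x + y) = scaleC c x + scaleC c y"
    and scaleC_add_left: "scaleC (c + d) x = scaleC c x + scaleC d x"
    and scaleC_scaleC: "scaleC c (scaleC d x) = scaleC (c * d) x"
    and scaleC_of_real: "scaleC (complex_of_real a) x = a *\<^sub>R x"
    and cinner_commute: "cinner x y = cnj (cinner y x)"
    and cinner_add_left: "cinner (x + y) z = cinner x z + cinner y z"
    and cinner_scaleC_left: "cinner (scaleC c x) y = c * cinner x y"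
    and cinner_self: "cinner x x = complex_of_real ((norm x)\<^sup>2)"

lemma scaleR_eq_scaleC: "a *\<^sub>R x = scaleC (complex_of_real a) (x::'a::complex_hilbert)"
  by (simp add: scaleC_of_real)

lemma cinner_add_right: "cinner x (y + z) = cinner x y + cinner x (z::'a::complex_hilbert)"
  by (metis cinner_add_left cinner_commute complex_cnj_add)

lemma cinner_scaleC_right: "cinner x (scaleC c y) = cnj c * cinner x (y::'a::complex_hilbert)"
  by (metis cinner_scaleC_left cinner_commute complex_cnj_mult)

lemma cinner_scaleR_left: "cinner (a *\<^sub>R x) y = of_real a * cinner x (y::'a::complex_hilbert)"
  by (simp add: scaleR_eq_scaleC cinner_scaleC_left)

lemma cinner_scaleR_right: "cinner x (a *\<^sub>R y) = of_real a * cinner x (y::'a::complex_hilbert)"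
  by (simp add: scaleR_eq_scaleC cinner_scaleC_right)

lemma norm_scaleC: "norm (scaleC c x) = cmod c * norm (x::'a::complex_hilbert)"
proof -
  have "complex_of_real ((norm (scaleC c x))\<^sup>2) = complex_of_real ((cmod c * norm x)\<^sup>2)"
    unfolding cinner_self[symmetric] cinner_scaleC_left cinner_scaleC_right
    by (simp add: cinner_self power_mult_distrib mult.assoc[symmetric] complex_norm_square del: of_real_power)
  then have "(norm (scaleC c x))\<^sup>2 = (cmod c * norm x)\<^sup>2"
    by (simp only: of_real_eq_iff)
  then show ?thesis
    by (simp add: power2_eq_iff_nonneg)
qed

lemma norm_plus_sq: "(norm (x + y))\<^sup>2 = (norm x)\<^sup>2 + (norm y)\<^sup>2 + 2 * Re (cinner x (y::'a::complex_hilbert))"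
proof -
  have "complex_of_real ((norm (x + y))\<^sup>2) = cinner (x + y) (x + y)"
    by (simp only: cinner_self)
  also have "\<dots> = cinner x x + cinner y y + (cinner x y + cnj (cinner x y))"
    by (simp add: cinner_add_left cinner_add_right cinner_commute[of y x])
  also have "\<dots> = complex_of_real ((norm x)\<^sup>2 + (norm y)\<^sup>2 + 2 * Re (cinner x y))"
    by (simp add: cinner_self complex_add_cnj)
  finally show ?thesis
    by (simp only: of_real_eq_iff)
qed

lemma cmod_cinner_le: "cmod (cinner x y) \<le> norm x * norm (y::'a::complex_hilbert)"
proof -
  have *: "\<bar>Re (cinner x y)\<bar> \<le> norm x * norm y" for x y :: 'a
  proof -
    have "(norm (x + y))\<^sup>2 \<le> (norm x + norm y)\<^sup>2"
      by (intro power_mono norm_triangle_ineq) auto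
    moreover have "(norm x - norm y)\<^sup>2 \<le> (norm (x + y))\<^sup>2"
    proof -
      have "\<bar>norm x - norm y\<bar> \<le> norm (x + y)"
        by (metis norm_triangle_ineq3 diff_minus_eq_add norm_minus_cancel)
      then show ?thesis
        by (metis abs_le_square_iff abs_norm_cancel)
    qed
    ultimately show ?thesis
      unfolding norm_plus_sq by (auto simp: power2_eq_square algebra_simps abs_le_iff)
  qed
  show ?thesis
  proof (cases "cinner x y = 0")
    case False
    define c where "c = cnj (sgn (cinner x y))"
    have c: "cmod c = 1"
      using False by (simp add: c_def norm_sgn)
    have "cinner (scaleC c x) y = cinner x y * cnj (cinner x y) / complex_of_real (cmod (cinner x y))"
      by (simp add: c_def cinner_scaleC_left sgn_eq)
    also have "\<dots> = complex_of_real (cmod (cinner x y))"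
      unfolding complex_norm_square[symmetric] using False by (simp add: power2_eq_square)
    finally have "cinner (scaleC c x) y = complex_of_real (cmod (cinner x y))" .
    then have "cmod (cinner x y) = Re (cinner (scaleC c x) y)"
      by simp
    also have "\<dots> \<le> norm x * norm y"
      using *[of "scaleC c x" y] c by (simp add: norm_scaleC)
    finally show ?thesis .
  qed simp
qed

lemma tendsto_cinner:
  fixes l m :: "'a::complex_hilbert"
  assumes f: "(f \<longlongrightarrow> l) F" and g: "(g \<longlongrightarrow> m) F"
  shows "((\<lambda>x. cinner (f x) (g x)) \<longlongrightarrow> cinner l m) F"
proof -
  have "cmod (cinner l m - cinner (f x) (g x)) \<le> norm (f x - l) * norm (g x) + norm l * norm (g x - m)" for x
  proof -
    have f1: "cinner (f x - l) (g x) + cinner l (g x) = cinner (f x) (g x)"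
      by (metis cinner_add_left diff_add_cancel)
    have f2: "cinner l (g x - m) + cinner l m = cinner l (g x)"
      by (metis cinner_add_right diff_add_cancel)
    have "cinner l m - cinner (f x) (g x) = - (cinner (f x - l) (g x) + cinner l (g x - m))"
      unfolding f1[symmetric] f2[symmetric] by simp
    then have "cmod (cinner l m - cinner (f x) (g x)) = cmod (cinner (f x - l) (g x) + cinner l (g x - m))"
      by (metis norm_minus_cancel)
    also have "\<dots> \<le> norm (f x - l) * norm (g x) + norm l * norm (g x - m)"
      by (intro norm_triangle_mono cmod_cinner_le)
    finally show ?thesis .
  qed
  note bound = this
  have lim: "((\<lambda>x. norm (f x - l) * norm (g x) + norm l * norm (g x - m)) \<longlongrightarrow>
      norm (l - l) * norm m + norm l * norm (m - m)) F"
    by (intro tendsto_intros f g)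
  have "((\<lambda>x. cinner l m - cinner (f x) (g x)) \<longlongrightarrow> 0) F"
    by (rule Lim_null_comparison[OF always_eventually[OF allI[OF bound]]]) (use lim in simp)
  then show ?thesis
    by (rule Lim_transform2[OF tendsto_const])
qed

section \<open>Square integrable vector-valued functions\<close>

text \<open>Pointwise limits of simple functions. For second countable ranges this is Borel
  measurability; the target is not assumed separable.\<close>

definition strongly_measurable :: "'a measure \<Rightarrow> ('a \<Rightarrow> 'b::real_normed_vector) \<Rightarrow> bool" where
  "strongly_measurable M f \<longleftrightarrow>
     (\<exists>s. (\<forall>i::nat. simple_function M (s i)) \<and> (\<forall>x\<in>space M. (\<lambda>i. s i x) \<longlonglongrightarrow> f x))"

definition square_integrable :: "'a measure \<Rightarrow> ('a \<Rightarrow> 'b::real_normed_vector) \<Rightarrow> bool" where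
  "square_integrable M f \<longleftrightarrow> strongly_measurable M f \<and> integrable M (\<lambda>x. (norm (f x))\<^sup>2)"

lemma strongly_measurable_borel:
  assumes "strongly_measurable M f" shows "f \<in> borel_measurable M"
  using assms borel_measurable_simple_function
  unfolding strongly_measurable_def by (blast intro: borel_measurable_LIMSEQ_metric)

lemma strongly_measurable_comp2:
  assumes "strongly_measurable M f" "strongly_measurable M g"
    and h: "\<And>a b x y. a \<longlonglongrightarrow> x \<Longrightarrow> b \<longlonglongrightarrow> y \<Longrightarrow> (\<lambda>i::nat. h (a i) (b i)) \<longlonglongrightarrow> h x y"
  shows "strongly_measurable M (\<lambda>x. h (f x) (g x))"
proof -
  obtain s t where "\<forall>i::nat. simple_function M (s i)" "\<forall>i::nat. simple_function M (t i)"
    "\<forall>x\<in>space M. (\<lambda>i. s i x) \<longlonglongrightarrow> f x" "\<forall>x\<in>space M. (\<lambda>i. t i x) \<longlonglongrightarrow> g x"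
    using assms(1,2) unfolding strongly_measurable_def by blast
  then show ?thesis
    unfolding strongly_measurable_def
    by (intro exI[of _ "\<lambda>i x. h (s i x) (t i x)"]) (simp add: simple_function_compose2 h)
qed

lemma strongly_measurable_const: "strongly_measurable M (\<lambda>_. c)"
  unfolding strongly_measurable_def by (rule exI[of _ "\<lambda>_ _. c"]) auto

lemma strongly_measurable_add:
  "strongly_measurable M f \<Longrightarrow> strongly_measurable M g \<Longrightarrow> strongly_measurable M (\<lambda>x. f x + g x)"
  by (rule strongly_measurable_comp2[where h = "(+)"]) (assumption, assumption, erule (1) tendsto_add)

lemma strongly_measurable_scaleR:
  "strongly_measurable M f \<Longrightarrow> strongly_measurable M (\<lambda>x. c *\<^sub>R f x)"
  by (rule strongly_measurable_comp2[where h = "\<lambda>x _. c *\<^sub>R x"]) (assumption, assumption, rule tendsto_scaleR[OF tendsto_const], assumption)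

lemma strongly_measurable_scaleC:
  fixes f :: "_ \<Rightarrow> 'b::complex_hilbert"
  assumes "strongly_measurable M f" shows "strongly_measurable M (\<lambda>x. scaleC c (f x))"
proof -
  have lin: "bounded_linear (\<lambda>x::'b. scaleC c x)"
    by (rule bounded_linear_intro[where K = "cmod c"])
      (simp_all add: scaleC_add_right scaleR_eq_scaleC scaleC_scaleC norm_scaleC mult.commute)
  show ?thesis
    by (rule strongly_measurable_comp2[OF assms assms, where h = "\<lambda>x _. scaleC c x"])
      (rule bounded_linear.tendsto[OF lin])
qed

lemma strongly_measurable_diff:
  "strongly_measurable M f \<Longrightarrow> strongly_measurable M g \<Longrightarrow> strongly_measurable M (\<lambda>x. f x - g x)"
  by (rule strongly_measurable_comp2[where h = "(-)"]) (assumption, assumption, erule (1) tendsto_diff)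

lemma strongly_measurable_minus:
  "strongly_measurable M f \<Longrightarrow> strongly_measurable M (\<lambda>x. - f x)"
  by (rule strongly_measurable_comp2[where h = "\<lambda>x _. - x"]) (assumption, assumption, erule tendsto_minus)

lemma borel_measurable_cinner:
  fixes f g :: "_ \<Rightarrow> 'b::complex_hilbert"
  assumes "strongly_measurable M f" "strongly_measurable M g"
  shows "(\<lambda>x. cinner (f x) (g x)) \<in> borel_measurable M"
  by (rule strongly_measurable_borel, rule strongly_measurable_comp2[OF assms]) (rule tendsto_cinner)

lemma strongly_measurable_borel_measurable_norm:
  assumes "strongly_measurable M f"
  shows "(\<lambda>x. norm (f x)) \<in> borel_measurable M"
  using strongly_measurable_borel[OF assms] by measurable

lemma strongly_measurableI:
  fixes f :: "'a \<Rightarrow> 'b::real_normed_vector" and d :: "nat \<Rightarrow> 'b"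
  assumes f: "f \<in> borel_measurable M" and d: "\<And>x. x \<in> space M \<Longrightarrow> f x \<in> closure (range d)"
  shows "strongly_measurable M f"
proof -
  define P where "P n x i \<longleftrightarrow> i \<le> n \<and> (\<forall>j\<le>n. dist (f x) (d i) \<le> dist (f x) (d j))" for n x i
  define k where "k n x = (LEAST i. P n x i)" for n x
  have ex: "\<exists>i. P n x i" for n x
  proof -
    have "finite ((\<lambda>i. dist (f x) (d i)) ` {..n})" "(\<lambda>i. dist (f x) (d i)) ` {..n} \<noteq> {}"
      by auto
    from Min_in[OF this] obtain i
      where i: "i \<le> n" "Min ((\<lambda>i. dist (f x) (d i)) ` {..n}) = dist (f x) (d i)"
      by (elim imageE) (rule that, simp_all only: atMost_iff)
    have "P n x i"
      unfolding P_def i(2)[symmetric] using i(1) by simp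
    then show ?thesis ..
  qed
  have Pk: "P n x (k n x)" for n x
    unfolding k_def using ex by (rule LeastI_ex)
  have simple: "simple_function M (\<lambda>x. d (k n x))" for n
  proof (rule simple_function_compose1[where f = "k n" and g = d])
    have [measurable]: "(\<lambda>x. dist (f x) (d i)) \<in> borel_measurable M" for i
      by (rule measurable_compose[OF f]) (intro borel_measurable_continuous_onI continuous_intros)
    have [measurable]: "Measurable.pred M (\<lambda>x. P n x i)" for i
      unfolding P_def by measurable
    have "k n \<in> measurable M (count_space UNIV)"
      unfolding k_def by measurable
    moreover have "finite (k n ` space M)"
      by (rule finite_subset[of _ "{..n}"]) (use Pk in \<open>auto simp: P_def\<close>)
    ultimately show "simple_function M (k n)"
      by (simp add: simple_function_eq_measurable)
  qed
  have lim: "(\<lambda>n. d (k n x)) \<longlonglongrightarrow> f x" if x: "x \<in> space M" for x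
  proof (rule metric_LIMSEQ_I)
    fix e :: real assume "e > 0"
    then obtain i where i: "dist (d i) (f x) < e"
      using d[OF x] unfolding closure_approachable by auto
    have "dist (d (k n x)) (f x) < e" if "n \<ge> i" for n
      using Pk[of n x] that i unfolding P_def by (metis dist_commute le_less_trans)
    then show "\<exists>N. \<forall>n\<ge>N. dist (d (k n x)) (f x) < e"
      by blast
  qed
  show ?thesis
    unfolding strongly_measurable_def
    by (intro exI[of _ "\<lambda>n x. d (k n x)"] conjI allI ballI simple lim)
qed

lemma strongly_measurable_lim:
  fixes f :: "'a \<Rightarrow> 'b::real_normed_vector"
  assumes u: "\<And>i::nat. strongly_measurable M (u i)"
    and lim: "\<And>x. x \<in> space M \<Longrightarrow> (\<lambda>i. u i x) \<longlonglongrightarrow> f x"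
  shows "strongly_measurable M f"
proof -
  obtain s where s: "\<And>i j::nat. simple_function M (s i j)"
    "\<And>i x. x \<in> space M \<Longrightarrow> (\<lambda>j. s i j x) \<longlonglongrightarrow> u i x"
    using u unfolding strongly_measurable_def by metis
  define D where "D = insert 0 (\<Union>i. \<Union>j. s i j ` space M)"
  have "countable (s i j ` space M)" for i j
    by (rule countable_finite, rule simple_functionD(1)[OF s(1)])
  then have D: "countable D" "D \<noteq> {}"
    unfolding D_def by auto
  have "u i x \<in> closure D" if "x \<in> space M" for i x
    unfolding closure_sequential
    by (rule exI[of _ "\<lambda>j. s i j x"]) (use s(2)[OF that] that in \<open>auto simp: D_def\<close>)
  then have "f x \<in> closure (range (from_nat_into D))" if "x \<in> space M" for x
    using closed_sequentially[OF closed_closure, of "\<lambda>i. u i x" D "f x"] lim[OF that] that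
    by (simp add: range_from_nat_into[OF D(2,1)])
  moreover have "f \<in> borel_measurable M"
    using strongly_measurable_borel[OF u] lim by (rule borel_measurable_LIMSEQ_metric)
  ultimately show ?thesis
    by (intro strongly_measurableI)
qed

lemma square_integrableI:
  assumes f: "strongly_measurable M f" and "integrable M g"
    and "\<And>x. x \<in> space M \<Longrightarrow> (norm (f x))\<^sup>2 \<le> g x"
  shows "square_integrable M f"
  unfolding square_integrable_def
proof
  have [measurable]: "f \<in> borel_measurable M"
    using f by (rule strongly_measurable_borel)
  show "integrable M (\<lambda>x. (norm (f x))\<^sup>2)"
  proof (rule Bochner_Integration.integrable_bound[OF assms(2)])
    show "(\<lambda>x. (norm (f x))\<^sup>2) \<in> borel_measurable M"
      by measurable
    show "AE x in M. norm ((norm (f x))\<^sup>2) \<le> norm (g x)"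
      using assms(3) by (intro AE_I2) (force simp: abs_if intro: order_trans)
  qed
qed fact

lemma norm_add_sq_le: "(norm (x + y))\<^sup>2 \<le> 2 * (norm x)\<^sup>2 + 2 * (norm (y::'a::real_normed_vector))\<^sup>2"
proof -
  have "(norm (x + y))\<^sup>2 \<le> (norm x + norm y)\<^sup>2"
    by (intro power_mono norm_triangle_ineq) auto
  also have "\<dots> \<le> 2 * (norm x)\<^sup>2 + 2 * (norm y)\<^sup>2"
    using sum_squares_bound[of "norm x" "norm y"] by (simp add: power2_sum)
  finally show ?thesis .
qed

lemma square_integrable_add:
  assumes "square_integrable M f" "square_integrable M g"
  shows "square_integrable M (\<lambda>x. f x + g x)"
proof (rule square_integrableI[where g = "\<lambda>x. 2 * (norm (f x))\<^sup>2 + 2 * (norm (g x))\<^sup>2"])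
qed (use assms in \<open>auto simp: square_integrable_def strongly_measurable_add norm_add_sq_le\<close>)

lemma square_integrable_scaleR:
  "square_integrable M f \<Longrightarrow> square_integrable M (\<lambda>x. c *\<^sub>R f x)"
  by (auto simp: square_integrable_def strongly_measurable_scaleR power_mult_distrib)

lemma square_integrable_scaleC:
  fixes f :: "_ \<Rightarrow> 'b::complex_hilbert"
  shows "square_integrable M f \<Longrightarrow> square_integrable M (\<lambda>x. scaleC c (f x))"
  by (auto simp: square_integrable_def strongly_measurable_scaleC power_mult_distrib norm_scaleC)

lemma square_integrable_minus:
  "square_integrable M f \<Longrightarrow> square_integrable M (\<lambda>x. - f x)"
  by (auto simp: square_integrable_def strongly_measurable_minus)

lemma square_integrable_diff:
  "square_integrable M f \<Longrightarrow> square_integrable M g \<Longrightarrow> square_integrable M (\<lambda>x. f x - g x)"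
  using square_integrable_add[of M f "\<lambda>x. - g x"] square_integrable_minus[of M g] by simp

lemma square_integrable_zero: "square_integrable M (\<lambda>_. 0)"
  by (simp add: square_integrable_def strongly_measurable_const)

lemma integrable_norm_mult:
  assumes "square_integrable M f" "square_integrable M g"
  shows "integrable M (\<lambda>x. norm (f x) * norm (g x))"
proof (rule Bochner_Integration.integrable_bound[where f = "\<lambda>x. (norm (f x))\<^sup>2 + (norm (g x))\<^sup>2"])
  have [measurable]: "(\<lambda>x. norm (f x)) \<in> borel_measurable M" "(\<lambda>x. norm (g x)) \<in> borel_measurable M"
    using assms by (auto simp: square_integrable_def intro: strongly_measurable_borel_measurable_norm)
  show "(\<lambda>x. norm (f x) * norm (g x)) \<in> borel_measurable M"
    by measurable
  have "norm a * norm b \<le> (norm a)\<^sup>2 + (norm b)\<^sup>2" for a :: 'b and b :: 'c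
  proof -
    have "2 * (norm a * norm b) \<le> (norm a)\<^sup>2 + (norm b)\<^sup>2"
      using sum_squares_bound[of "norm a" "norm b"] by (simp only: mult.assoc)
    moreover have "0 \<le> norm a * norm b"
      by simp
    ultimately show ?thesis
      by linarith
  qed
  then show "AE x in M. norm (norm (f x) * norm (g x)) \<le> norm ((norm (f x))\<^sup>2 + (norm (g x))\<^sup>2)"
    by (auto simp: abs_mult)
qed (use assms in \<open>auto simp: square_integrable_def\<close>)

lemma integrable_cinner:
  fixes f g :: "_ \<Rightarrow> 'b::complex_hilbert"
  assumes "square_integrable M f" "square_integrable M g"
  shows "integrable M (\<lambda>x. cinner (f x) (g x))"
  by (rule Bochner_Integration.integrable_bound[OF integrable_norm_mult[OF assms]])
    (use assms in \<open>auto simp: square_integrable_def cmod_cinner_le intro!: borel_measurable_cinner\<close>)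

lemma integral_norm_mult_le:
  assumes f: "square_integrable M f" and g: "square_integrable M g"
  shows "(\<integral>x. norm (f x) * norm (g x) \<partial>M) \<le> sqrt (\<integral>x. (norm (f x))\<^sup>2 \<partial>M) * sqrt (\<integral>x. (norm (g x))\<^sup>2 \<partial>M)"
proof -
  define A B C where "A = (\<integral>x. (norm (f x))\<^sup>2 \<partial>M)" and "B = (\<integral>x. (norm (g x))\<^sup>2 \<partial>M)"
    and "C = (\<integral>x. norm (f x) * norm (g x) \<partial>M)"
  have int: "integrable M (\<lambda>x. (norm (f x))\<^sup>2)" "integrable M (\<lambda>x. (norm (g x))\<^sup>2)"
    "integrable M (\<lambda>x. norm (f x) * norm (g x))"
    using f g integrable_norm_mult[OF f g] by (auto simp: square_integrable_def)
  have nn: "A \<ge> 0" "B \<ge> 0" "C \<ge> 0"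
    by (auto simp: A_def B_def C_def)
  have quad: "0 \<le> s\<^sup>2 * A - 2 * s * t * C + t\<^sup>2 * B" for s t
  proof -
    have "0 \<le> (\<integral>x. (s * norm (f x) - t * norm (g x))\<^sup>2 \<partial>M)"
      by simp
    also have "(\<lambda>x. (s * norm (f x) - t * norm (g x))\<^sup>2) =
        (\<lambda>x. s\<^sup>2 * (norm (f x))\<^sup>2 - 2 * s * t * (norm (f x) * norm (g x)) + t\<^sup>2 * (norm (g x))\<^sup>2)"
      by (auto simp: power2_eq_square algebra_simps)
    also have "(\<integral>x. s\<^sup>2 * (norm (f x))\<^sup>2 - 2 * s * t * (norm (f x) * norm (g x)) + t\<^sup>2 * (norm (g x))\<^sup>2 \<partial>M)
        = s\<^sup>2 * A - 2 * s * t * C + t\<^sup>2 * B"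
      using int unfolding A_def B_def C_def by simp
    finally show ?thesis .
  qed
  have "C\<^sup>2 \<le> A * B"
  proof (cases "A = 0")
    case True
    have "C = 0"
    proof (rule ccontr)
      assume "C \<noteq> 0"
      with nn have "C > 0" by simp
      then show False
        using quad[of "(B + 1) / (2 * C)" 1] True by (simp add: field_simps)
    qed
    then show ?thesis
      using nn by simp
  next
    case False
    then have "A > 0" using nn by simp
    have "0 \<le> C\<^sup>2 * A - 2 * C * A * C + A\<^sup>2 * B"
      by (rule quad)
    also have "\<dots> = A * (A * B - C\<^sup>2)"
      by (simp add: power2_eq_square algebra_simps)
    finally show ?thesis
      using \<open>A > 0\<close> by (simp add: zero_le_mult_iff)
  qed
  then have "C \<le> sqrt (A * B)"
    by (rule real_le_rsqrt)
  then show ?thesis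
    by (simp add: A_def B_def C_def real_sqrt_mult)
qed

lemma L2_triangle:
  assumes f: "square_integrable M f" and g: "square_integrable M g"
  shows "sqrt (\<integral>x. (norm (f x + g x))\<^sup>2 \<partial>M) \<le> sqrt (\<integral>x. (norm (f x))\<^sup>2 \<partial>M) + sqrt (\<integral>x. (norm (g x))\<^sup>2 \<partial>M)"
proof (rule real_le_lsqrt)
  have int: "integrable M (\<lambda>x. (norm (f x))\<^sup>2)" "integrable M (\<lambda>x. (norm (g x))\<^sup>2)"
    "integrable M (\<lambda>x. norm (f x) * norm (g x))" "integrable M (\<lambda>x. (norm (f x + g x))\<^sup>2)"
    using f g integrable_norm_mult[OF f g] square_integrable_add[OF f g] by (auto simp: square_integrable_def)
  have "(\<integral>x. (norm (f x + g x))\<^sup>2 \<partial>M) \<le>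
      (\<integral>x. (norm (f x))\<^sup>2 + 2 * (norm (f x) * norm (g x)) + (norm (g x))\<^sup>2 \<partial>M)"
  proof (rule integral_mono)
    fix x
    have "(norm (f x + g x))\<^sup>2 \<le> (norm (f x) + norm (g x))\<^sup>2"
      by (intro power_mono norm_triangle_ineq) auto
    then show "(norm (f x + g x))\<^sup>2 \<le> (norm (f x))\<^sup>2 + 2 * (norm (f x) * norm (g x)) + (norm (g x))\<^sup>2"
      by (simp add: power2_sum)
  qed (use int in auto)
  also have "\<dots> = (\<integral>x. (norm (f x))\<^sup>2 \<partial>M) + 2 * (\<integral>x. norm (f x) * norm (g x) \<partial>M) + (\<integral>x. (norm (g x))\<^sup>2 \<partial>M)"
    using int by simp
  also have "\<dots> \<le> (sqrt (\<integral>x. (norm (f x))\<^sup>2 \<partial>M) + sqrt (\<integral>x. (norm (g x))\<^sup>2 \<partial>M))\<^sup>2"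
    using integral_norm_mult_le[OF f g] by (simp add: power2_sum)
  finally show "(\<integral>x. (norm (f x + g x))\<^sup>2 \<partial>M) \<le> \<dots>" .
qed simp

text \<open>Riesz--Fischer.\<close>

lemma square_integrable_complete:
  fixes g :: "nat \<Rightarrow> 'a \<Rightarrow> 'b::banach"
  assumes g: "\<And>n. square_integrable M (g n)"
    and fast: "\<And>m n. m \<le> n \<Longrightarrow> (\<integral>x. (norm (g n x - g m x))\<^sup>2 \<partial>M) \<le> (1/4) ^ m"
  obtains f where "square_integrable M f" "\<And>m. (\<integral>x. (norm (f x - g m x))\<^sup>2 \<partial>M) \<le> (1/4) ^ m"
proof -
  have sm: "strongly_measurable M (g n)" for n
    using g by (simp add: square_integrable_def)
  have [measurable]: "g n \<in> borel_measurable M" for n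
    using sm by (rule strongly_measurable_borel)
  have [measurable]: "(\<lambda>x. norm (g n x - g m x)) \<in> borel_measurable M" for n m
    by (intro strongly_measurable_borel_measurable_norm strongly_measurable_diff sm)
  have nn: "(\<integral>\<^sup>+x. ennreal ((norm (g n x - g m x))\<^sup>2) \<partial>M) \<le> ennreal ((1/4) ^ m)" if "m \<le> n" for m n
  proof -
    have "integrable M (\<lambda>x. (norm (g n x - g m x))\<^sup>2)"
      using square_integrable_diff[OF g g] by (simp add: square_integrable_def)
    then show ?thesis
      using fast[OF that] by (subst nn_integral_eq_integral) (auto intro: ennreal_leI)
  qed
  have "AE x in M. convergent (\<lambda>n. g n x)"
  proof -
    define h where "h n x = 2 ^ n * (norm (g (Suc n) x - g n x))\<^sup>2" for n x
    have [measurable]: "(\<lambda>x. h n x) \<in> borel_measurable M" for n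
      unfolding h_def by measurable
    have "(\<integral>\<^sup>+x. (\<Sum>n. ennreal (h n x)) \<partial>M) = (\<Sum>n. \<integral>\<^sup>+x. ennreal (h n x) \<partial>M)"
      by (rule nn_integral_suminf) measurable
    also have "\<dots> \<le> (\<Sum>n. ennreal ((1/2) ^ n))"
    proof (rule suminf_le)
      fix n
      have "(\<integral>\<^sup>+x. ennreal (h n x) \<partial>M) = ennreal (2 ^ n) * (\<integral>\<^sup>+x. ennreal ((norm (g (Suc n) x - g n x))\<^sup>2) \<partial>M)"
        unfolding h_def by (subst nn_integral_cmult[symmetric]) (auto simp: ennreal_mult)
      also have "\<dots> \<le> ennreal (2 ^ n) * ennreal ((1/4) ^ n)"
        by (intro mult_left_mono nn) auto
      also have "\<dots> = ennreal ((2 * (1/4)) ^ n)"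
        by (simp add: ennreal_mult[symmetric] power_mult_distrib[symmetric] del: ennreal_power)
      finally show "(\<integral>\<^sup>+x. ennreal (h n x) \<partial>M) \<le> ennreal ((1/2) ^ n)"
        by simp
    qed auto
    also have "\<dots> = ennreal (\<Sum>n. (1/2) ^ n)"
      by (intro suminf_ennreal2) auto
    also have "\<dots> < \<infinity>"
      by simp
    finally have "(\<integral>\<^sup>+x. (\<Sum>n. ennreal (h n x)) \<partial>M) \<noteq> \<infinity>"
      by simp
    then have "AE x in M. (\<Sum>n. ennreal (h n x)) \<noteq> \<infinity>"
      by (intro nn_integral_noteq_infinite) measurable
    then show ?thesis
    proof eventually_elim
      case (elim x)
      have h0: "h n x \<ge> 0" for n
        by (simp add: h_def)
      have "summable (\<lambda>n. h n x)"
        using elim h0 by (intro summable_suminf_not_top) auto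
      then have "(\<lambda>n. h n x) \<longlonglongrightarrow> 0"
        by (rule summable_LIMSEQ_zero)
      then have "Bseq (\<lambda>n. h n x)"
        by (intro convergent_imp_Bseq) (auto simp: convergent_def)
      then obtain K where K: "K > 0" "\<And>n. h n x \<le> K"
        using h0 by (auto simp: Bseq_def)
      define q where "q = sqrt (1/2)"
      have q: "0 < q" "q < 1" "q\<^sup>2 = 1/2"
        by (auto simp: q_def)
      have "norm (g (Suc n) x - g n x) \<le> sqrt K * q ^ n" for n
      proof (rule power2_le_imp_le)
        have "(norm (g (Suc n) x - g n x))\<^sup>2 = h n x * (1/2) ^ n"
          by (simp add: h_def power_one_over)
        also have "\<dots> \<le> K * (1/2) ^ n"
          by (intro mult_right_mono K) auto
        also have "\<dots> = (sqrt K * q ^ n)\<^sup>2"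
          using K by (simp add: power_mult_distrib power_mult[symmetric] mult.commute[of n]) (simp add: power_mult q)
        finally show "(norm (g (Suc n) x - g n x))\<^sup>2 \<le> (sqrt K * q ^ n)\<^sup>2" .
        show "0 \<le> sqrt K * q ^ n"
          using K q by simp
      qed
      moreover have "summable (\<lambda>n. sqrt K * q ^ n)"
        using q by (intro summable_mult summable_geometric) auto
      ultimately have "summable (\<lambda>n. g (Suc n) x - g n x)"
        by - (rule summable_comparison_test'[where N = 0], assumption, blast)
      then have "convergent (\<lambda>n. \<Sum>k<n. g (Suc k) x - g k x)"
        by (simp add: summable_iff_convergent)
      then have "convergent (\<lambda>n. g n x - g 0 x)"
        by (simp only: sum_lessThan_telescope[where f = "\<lambda>n. g n x"])
      from convergent_add[OF this convergent_const[of "g 0 x"]] show "convergent (\<lambda>n. g n x)"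
        by simp
    qed
  qed
  then obtain N where N: "N \<in> null_sets M" "{x\<in>space M. \<not> convergent (\<lambda>n. g n x)} \<subseteq> N"
    by (auto elim: AE_E simp: null_sets_def)
  define f where "f x = (if x \<in> N then 0 else lim (\<lambda>n. g n x))" for x
  have sf: "strongly_measurable M f"
  proof (rule strongly_measurable_lim)
    fix n
    have "strongly_measurable M (\<lambda>x. indicat_real (- N) x)"
      unfolding strongly_measurable_def
    proof (intro exI conjI allI ballI)
      show "simple_function M (indicat_real (- N))" for i :: nat
      proof (rule simple_function_borel_measurable)
        have [measurable]: "N \<in> sets M"
          using N(1) by auto
        have "(\<lambda>x. 1 - indicat_real N x) \<in> borel_measurable M"
          by measurable
        also have "(\<lambda>x. 1 - indicat_real N x) = indicat_real (- N)"
          by (auto simp: indicator_def)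
        finally show "indicat_real (- N) \<in> borel_measurable M" .
        show "finite (indicat_real (- N) ` space M)"
          by (rule finite_subset[of _ "{0, 1}"]) (auto simp: indicator_def)
      qed
    qed auto
    then show "strongly_measurable M (\<lambda>x. indicat_real (- N) x *\<^sub>R g n x)"
      by (rule strongly_measurable_comp2[OF _ sm, where h = scaleR]) (rule tendsto_scaleR)
  next
    fix x assume "x \<in> space M"
    then show "(\<lambda>i. indicat_real (- N) x *\<^sub>R g i x) \<longlonglongrightarrow> f x"
      using N(2) by (auto simp: f_def convergent_LIMSEQ_iff)
  qed
  have fg: "(\<integral>\<^sup>+x. ennreal ((norm (f x - g m x))\<^sup>2) \<partial>M) \<le> ennreal ((1/4) ^ m)" for m
  proof -
    have "(\<integral>\<^sup>+x. ennreal ((norm (f x - g m x))\<^sup>2) \<partial>M)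
        = (\<integral>\<^sup>+x. liminf (\<lambda>n. ennreal ((norm (g n x - g m x))\<^sup>2)) \<partial>M)"
    proof (rule nn_integral_cong_AE)
      have "AE x in M. x \<notin> N"
        using N(1) by (rule AE_not_in)
      then show "AE x in M. ennreal ((norm (f x - g m x))\<^sup>2) = liminf (\<lambda>n. ennreal ((norm (g n x - g m x))\<^sup>2))"
        using AE_space
      proof eventually_elim
        case (elim x)
        then have "(\<lambda>n. g n x) \<longlonglongrightarrow> f x"
          using N(2) by (auto simp: f_def convergent_LIMSEQ_iff)
        then have "(\<lambda>n. ennreal ((norm (g n x - g m x))\<^sup>2)) \<longlonglongrightarrow> ennreal ((norm (f x - g m x))\<^sup>2)"
          by (intro tendsto_ennrealI tendsto_intros)
        then show ?case
          by (intro lim_imp_Liminf[symmetric]) auto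
      qed
    qed
    also have "\<dots> \<le> liminf (\<lambda>n. \<integral>\<^sup>+x. ennreal ((norm (g n x - g m x))\<^sup>2) \<partial>M)"
      by (rule nn_integral_liminf) measurable
    also have "\<dots> \<le> liminf (\<lambda>n. ennreal ((1/4) ^ m))"
      by (rule Liminf_mono) (use nn in \<open>auto simp: eventually_sequentially\<close>)
    also have "\<dots> = ennreal ((1/4) ^ m)"
      by (simp add: Liminf_const)
    finally show ?thesis .
  qed
  have sq: "square_integrable M (\<lambda>x. f x - g m x)" for m
    unfolding square_integrable_def
  proof
    show *: "strongly_measurable M (\<lambda>x. f x - g m x)"
      by (intro strongly_measurable_diff sf sm)
    have [measurable]: "(\<lambda>x. norm (f x - g m x)) \<in> borel_measurable M"
      using * by (rule strongly_measurable_borel_measurable_norm)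
    show "integrable M (\<lambda>x. (norm (f x - g m x))\<^sup>2)"
      using fg[of m] by (intro integrableI_bounded) (auto intro: le_less_trans)
  qed
  show ?thesis
  proof
    show "square_integrable M f"
      using square_integrable_add[OF sq[of 0] g[of 0]] by simp
    fix m
    have "ennreal (\<integral>x. (norm (f x - g m x))\<^sup>2 \<partial>M) = (\<integral>\<^sup>+x. ennreal ((norm (f x - g m x))\<^sup>2) \<partial>M)"
      using sq[of m] by (intro nn_integral_eq_integral[symmetric]) (auto simp: square_integrable_def)
    also note fg
    finally show "(\<integral>x. (norm (f x - g m x))\<^sup>2 \<partial>M) \<le> (1/4) ^ m"
      by simp
  qed
qed

section \<open>The Hilbert space of square integrable functions on the positive half-line\<close>

definition haar :: "real measure" where
  "haar = density (restrict_space lborel {0<..}) (\<lambda>r. ennreal (1 / r))"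

definition L2_rel :: "(real \<Rightarrow> 'k::banach) \<Rightarrow> (real \<Rightarrow> 'k) \<Rightarrow> bool" where
  "L2_rel f g \<longleftrightarrow> square_integrable haar f \<and> square_integrable haar g \<and> (AE r in haar. f r = g r)"

lemma part_equivp_L2_rel: "part_equivp L2_rel"
proof (rule part_equivpI)
  show "\<exists>f. L2_rel f f"
    by (rule exI[of _ "\<lambda>_. 0"]) (simp add: L2_rel_def square_integrable_zero)
  show "symp L2_rel"
    by (rule sympI) (auto simp: L2_rel_def)
  show "transp L2_rel"
    by (rule transpI) (auto simp: L2_rel_def)
qed

quotient_type (overloaded) 'k L2 = "real \<Rightarrow> 'k::banach" / partial: L2_rel
  morphisms rep_L2 to_L2
  by (rule part_equivp_L2_rel)


lemma L2_rel_refl: "square_integrable haar f \<Longrightarrow> L2_rel f f"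
  by (simp add: L2_rel_def)

lemma integral_cong_L2_rel:
  assumes "L2_rel f f'" shows "(\<integral>r. (norm (f r))\<^sup>2 \<partial>haar) = (\<integral>r. (norm (f' r))\<^sup>2 \<partial>haar)"
  by (rule integral_cong_AE) (use assms in \<open>auto simp: L2_rel_def square_integrable_def\<close>)

lemma norm_zero_iff_L2_rel:
  assumes "L2_rel f f"
  shows "sqrt (\<integral>r. (norm (f r))\<^sup>2 \<partial>haar) = 0 \<longleftrightarrow> L2_rel f (\<lambda>_. 0)"
proof -
  have "integrable haar (\<lambda>r. (norm (f r))\<^sup>2)"
    using assms by (simp add: L2_rel_def square_integrable_def)
  from integral_nonneg_eq_0_iff_AE[OF this] show ?thesis
    using assms by (simp add: L2_rel_def square_integrable_zero)
qed

instantiation L2 :: (banach) real_normed_vector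
begin

lift_definition zero_L2 :: "'a L2" is "\<lambda>_. 0"
  by (simp add: L2_rel_def square_integrable_zero)

lift_definition plus_L2 :: "'a L2 \<Rightarrow> 'a L2 \<Rightarrow> 'a L2" is "\<lambda>f g r. f r + g r"
  by (auto simp: L2_rel_def square_integrable_add)

lift_definition minus_L2 :: "'a L2 \<Rightarrow> 'a L2 \<Rightarrow> 'a L2" is "\<lambda>f g r. f r - g r"
  by (auto simp: L2_rel_def square_integrable_diff)

lift_definition uminus_L2 :: "'a L2 \<Rightarrow> 'a L2" is "\<lambda>f r. - f r"
  by (auto simp: L2_rel_def square_integrable_minus)

lift_definition scaleR_L2 :: "real \<Rightarrow> 'a L2 \<Rightarrow> 'a L2" is "\<lambda>c f r. c *\<^sub>R f r"
  by (auto simp: L2_rel_def square_integrable_scaleR)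

lift_definition norm_L2 :: "'a L2 \<Rightarrow> real" is "\<lambda>f. sqrt (\<integral>r. (norm (f r))\<^sup>2 \<partial>haar)"
  by (simp add: integral_cong_L2_rel)

definition dist_L2 :: "'a L2 \<Rightarrow> 'a L2 \<Rightarrow> real" where
  "dist_L2 F G = norm (F - G)"

definition sgn_L2 :: "'a L2 \<Rightarrow> 'a L2" where
  "sgn_L2 F = inverse (norm F) *\<^sub>R F"

definition uniformity_L2 :: "('a L2 \<times> 'a L2) filter" where
  "uniformity_L2 = (INF e\<in>{0<..}. principal {(F, G). dist F G < e})"

definition open_L2 :: "'a L2 set \<Rightarrow> bool" where
  "open_L2 U \<longleftrightarrow> (\<forall>F\<in>U. eventually (\<lambda>(F', G). F' = F \<longrightarrow> G \<in> U) uniformity)"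

instance
proof
  fix F G H :: "'a L2" and a b :: real
  show "F + G + H = F + (G + H)"
    by transfer (auto simp: L2_rel_def add.assoc intro!: square_integrable_add)
  show "F + G = G + F"
    by transfer (auto simp: L2_rel_def add.commute intro!: square_integrable_add)
  show "0 + F = F"
    by transfer (auto simp: L2_rel_def)
  show "- F + F = 0"
    by transfer (auto simp: L2_rel_def square_integrable_zero)
  show "F - G = F + - G"
    by transfer (auto simp: L2_rel_def intro!: square_integrable_diff)
  show "a *\<^sub>R (F + G) = a *\<^sub>R F + a *\<^sub>R G"
    by transfer (auto simp: L2_rel_def scaleR_add_right intro!: square_integrable_add square_integrable_scaleR)
  show "(a + b) *\<^sub>R F = a *\<^sub>R F + b *\<^sub>R F"
    by transfer (auto simp: L2_rel_def scaleR_add_left intro!: square_integrable_add square_integrable_scaleR)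
  show "a *\<^sub>R b *\<^sub>R F = (a * b) *\<^sub>R F"
    by transfer (auto simp: L2_rel_def intro!: square_integrable_scaleR)
  show "1 *\<^sub>R F = F"
    by transfer (auto simp: L2_rel_def)
  show "norm F = 0 \<longleftrightarrow> F = 0"
    by transfer (rule norm_zero_iff_L2_rel)
  show "norm (F + G) \<le> norm F + norm G"
    by transfer (simp add: L2_rel_def L2_triangle)
  show "norm (a *\<^sub>R F) = \<bar>a\<bar> * norm F"
    by transfer (simp add: power_mult_distrib real_sqrt_mult)
  show "dist F G = norm (F - G)"
    by (rule dist_L2_def)
  show "sgn F = inverse (norm F) *\<^sub>R F"
    by (rule sgn_L2_def)
  show "uniformity = (INF e\<in>{0<..}. principal {(F, G :: 'a L2). dist F G < e})"
    by (rule uniformity_L2_def)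
  show "open U \<longleftrightarrow> (\<forall>F\<in>U. eventually (\<lambda>(F', G). F' = F \<longrightarrow> G \<in> U) uniformity)" for U :: "'a L2 set"
    by (rule open_L2_def)
qed

end

lemma norm_to_L2_diff:
  assumes "square_integrable haar f" "square_integrable haar g"
  shows "norm (to_L2 f - to_L2 g) = sqrt (\<integral>r. (norm (f r - g r))\<^sup>2 \<partial>haar)"
  using assms by (simp add: minus_L2.abs_eq norm_L2.abs_eq L2_rel_refl square_integrable_diff)

lemma ex_to_L2: "\<exists>f. square_integrable haar f \<and> F = to_L2 f"
  by (rule exI[of _ "rep_L2 F"])
    (use Quotient3_rep_reflp[OF Quotient3_L2, of F] in \<open>simp add: L2_rel_def Quotient3_abs_rep[OF Quotient3_L2]\<close>)

instance L2 :: (banach) banach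
proof
  fix X :: "nat \<Rightarrow> 'a L2"
  assume X: "Cauchy X"
  have "\<exists>N. \<forall>m\<ge>N. \<forall>n\<ge>N. dist (X m) (X n) < (1/2) ^ k" for k :: nat
    using X unfolding Cauchy_def by simp
  then obtain N where N: "\<And>k m n. m \<ge> N k \<Longrightarrow> n \<ge> N k \<Longrightarrow> dist (X m) (X n) < (1/2) ^ k"
    by metis
  define s where "s = rec_nat (N 0) (\<lambda>k i. max (N (Suc k)) (Suc i))"
  have s: "s 0 = N 0" "s (Suc k) = max (N (Suc k)) (Suc (s k))" for k
    by (simp_all add: s_def)
  have mono: "strict_mono s"
    by (rule strict_mono_Suc_iff[THEN iffD2]) (simp add: s max_def)
  have sN: "s k \<ge> N k" for k
    by (cases k) (simp_all add: s)
  define f where "f n = (SOME f. square_integrable haar f \<and> X n = to_L2 f)" for n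
  have f: "square_integrable haar (f n)" "X n = to_L2 (f n)" for n
    using someI_ex[OF ex_to_L2[of "X n"]] unfolding f_def by auto
  have d: "(\<integral>r. (norm (f n r - f m r))\<^sup>2 \<partial>haar) = (dist (X n) (X m))\<^sup>2" for m n
    by (simp add: dist_norm f norm_to_L2_diff)
  have "(\<integral>r. (norm (f (s n) r - f (s m) r))\<^sup>2 \<partial>haar) \<le> (1/4) ^ m" if "m \<le> n" for m n
  proof -
    have "s m \<le> s n"
      using mono that by (simp add: strict_mono_less_eq)
    then have "dist (X (s n)) (X (s m)) < (1/2) ^ m"
      using sN[of m] by (intro N) auto
    then have "(dist (X (s n)) (X (s m)))\<^sup>2 \<le> ((1/2) ^ m)\<^sup>2"
      by (intro power_mono) auto
    also have "((1/2) ^ m)\<^sup>2 = (1/4 :: real) ^ m"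
      by (simp add: power_mult_distrib[symmetric] power2_eq_square)
    finally show ?thesis
      by (simp add: d)
  qed
  note step = this
  have "\<exists>g. square_integrable haar g \<and> (\<forall>m. (\<integral>r. (norm (g r - f (s m) r))\<^sup>2 \<partial>haar) \<le> (1/4) ^ m)"
    by (rule square_integrable_complete[of haar "\<lambda>n. f (s n)", OF f(1) step]) (assumption, blast)
  then obtain g where g: "square_integrable haar g"
    "\<And>m. (\<integral>r. (norm (g r - f (s m) r))\<^sup>2 \<partial>haar) \<le> (1/4) ^ m"
    by blast
  have "dist (X (s m)) (to_L2 g) \<le> (1/2) ^ m" for m
  proof -
    have "dist (X (s m)) (to_L2 g) = sqrt (\<integral>r. (norm (g r - f (s m) r))\<^sup>2 \<partial>haar)"
      by (subst dist_commute) (simp add: dist_norm f g norm_to_L2_diff)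
    also have "\<dots> \<le> sqrt ((1/4) ^ m)"
      using g(2) by (rule real_sqrt_le_mono)
    also have "\<dots> = (1/2) ^ m"
      by (simp add: real_sqrt_power real_sqrt_divide)
    finally show ?thesis .
  qed
  note le = this
  have "(\<lambda>m. (1/2 :: real) ^ m) \<longlonglongrightarrow> 0"
    by (rule LIMSEQ_power_zero) simp
  then have "(\<lambda>m. dist (X (s m)) (to_L2 g)) \<longlonglongrightarrow> 0"
    by (rule Lim_null_comparison[rotated]) (simp add: le)
  then have "(X \<circ> s) \<longlonglongrightarrow> to_L2 g"
    unfolding comp_def by (rule tendsto_dist_iff[THEN iffD2])
  then have "X \<longlonglongrightarrow> to_L2 g"
    by (rule Cauchy_converges_subseq[OF X mono])
  then show "convergent X"
    by (auto simp: convergent_def)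
qed

instantiation L2 :: (complex_hilbert) complex_hilbert
begin

lift_definition scaleC_L2 :: "complex \<Rightarrow> 'a L2 \<Rightarrow> 'a L2" is "\<lambda>c f r. scaleC c (f r)"
  by (auto simp: L2_rel_def square_integrable_scaleC)

lift_definition cinner_L2 :: "'a L2 \<Rightarrow> 'a L2 \<Rightarrow> complex" is "\<lambda>f g. \<integral>r. cinner (f r) (g r) \<partial>haar"
proof -
  fix f f' g g' :: "real \<Rightarrow> 'a"
  assume "L2_rel f f'" "L2_rel g g'"
  then show "(\<integral>r. cinner (f r) (g r) \<partial>haar) = (\<integral>r. cinner (f' r) (g' r) \<partial>haar)"
    by (intro integral_cong_AE) (auto simp: L2_rel_def square_integrable_def intro!: borel_measurable_cinner)
qed

instance
proof
  fix F G H :: "'a L2" and c d :: complex and a :: real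
  show "scaleC c (F + G) = scaleC c F + scaleC c G"
    by transfer (auto simp: L2_rel_def scaleC_add_right intro!: square_integrable_add square_integrable_scaleC)
  show "scaleC (c + d) F = scaleC c F + scaleC d F"
    by transfer (auto simp: L2_rel_def scaleC_add_left intro!: square_integrable_add square_integrable_scaleC)
  show "scaleC c (scaleC d F) = scaleC (c * d) F"
    by transfer (auto simp: L2_rel_def scaleC_scaleC intro!: square_integrable_scaleC)
  show "scaleC (complex_of_real a) F = a *\<^sub>R F"
    by transfer (auto simp: L2_rel_def scaleC_of_real intro!: square_integrable_scaleR)
  show "cinner F G = cnj (cinner G F)"
  proof transfer
    fix f g :: "real \<Rightarrow> 'a"
    have "(\<integral>r. cinner (f r) (g r) \<partial>haar) = (\<integral>r. cnj (cinner (g r) (f r)) \<partial>haar)"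
      by (simp only: cinner_commute[symmetric])
    then show "(\<integral>r. cinner (f r) (g r) \<partial>haar) = cnj (\<integral>r. cinner (g r) (f r) \<partial>haar)"
      by simp
  qed
  show "cinner (F + G) H = cinner F H + cinner G H"
    by transfer (simp add: L2_rel_def cinner_add_left integrable_cinner)
  show "cinner (scaleC c F) G = c * cinner F G"
    by transfer (simp add: cinner_scaleC_left)
  show "cinner F F = complex_of_real ((norm F)\<^sup>2)"
    by transfer (simp add: cinner_self del: of_real_power)
qed

end

section \<open>Unitary representations and cocycles\<close>

definition unitary_op :: "('h::complex_hilbert \<Rightarrow> 'h) \<Rightarrow> bool" where
  "unitary_op U \<longleftrightarrow>
     (\<forall>x y. U (x + y) = U x + U y) \<and> (\<forall>c x. U (scaleC c x) = scaleC c (U x)) \<and>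
     surj U \<and> (\<forall>x y. cinner (U x) (U y) = cinner x y)"

text \<open>As usual, unitary representations are strongly continuous.\<close>

definition unitary_representation ::
  "('g, 'm) monoid_scheme \<Rightarrow> 'g topology \<Rightarrow> ('g \<Rightarrow> 'h::complex_hilbert \<Rightarrow> 'h) \<Rightarrow> bool" where
  "unitary_representation G X S \<longleftrightarrow>
     (\<forall>g\<in>carrier G. unitary_op (S g)) \<and>
     (\<forall>g\<in>carrier G. \<forall>h\<in>carrier G. S (g \<otimes>\<^bsub>G\<^esub> h) = S g \<circ> S h) \<and>
     (\<forall>x. continuous_map X euclidean (\<lambda>g. S g x))"

definition cocycle ::
  "('g, 'm) monoid_scheme \<Rightarrow> 'g topology \<Rightarrow> ('g \<Rightarrow> 'h::complex_hilbert \<Rightarrow> 'h) \<Rightarrow> ('g \<Rightarrow> 'h) \<Rightarrow> bool" where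
  "cocycle G X S b \<longleftrightarrow>
     continuous_map X euclidean b \<and>
     (\<forall>g\<in>carrier G. \<forall>h\<in>carrier G. b (g \<otimes>\<^bsub>G\<^esub> h) = S g (b h) + b g)"

definition nontrivial_cocycle ::
  "('g, 'm) monoid_scheme \<Rightarrow> 'g topology \<Rightarrow> ('g \<Rightarrow> 'h::complex_hilbert \<Rightarrow> 'h) \<Rightarrow> ('g \<Rightarrow> 'h) \<Rightarrow> bool" where
  "nontrivial_cocycle G X S b \<longleftrightarrow>
     cocycle G X S b \<and> \<not> (\<exists>v. \<forall>g\<in>carrier G. b g = S g v - v)"

definition special_representation ::
  "('g, 'm) monoid_scheme \<Rightarrow> 'g topology \<Rightarrow> ('g \<Rightarrow> 'h::complex_hilbert \<Rightarrow> 'h) \<Rightarrow> bool" where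
  "special_representation G X S \<longleftrightarrow> (\<exists>b. nontrivial_cocycle G X S b)"

section \<open>Semidirect products with the multiplicative group of positive reals\<close>

definition locally_compact_group :: "('g, 'm) monoid_scheme \<Rightarrow> 'g topology \<Rightarrow> bool" where
  "locally_compact_group G X \<longleftrightarrow>
     group G \<and> topspace X = carrier G \<and>
     continuous_map (prod_topology X X) X (\<lambda>(x, y). x \<otimes>\<^bsub>G\<^esub> y) \<and>
     continuous_map X X (\<lambda>x. inv\<^bsub>G\<^esub> x) \<and>
     locally_compact_space X \<and> Hausdorff_space X"

text \<open>\<open>act r g\<close> stands for $g^r$.\<close>

definition positive_real_action ::
  "('g, 'm) monoid_scheme \<Rightarrow> 'g topology \<Rightarrow> (real \<Rightarrow> 'g \<Rightarrow> 'g) \<Rightarrow> bool" where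
  "positive_real_action G X act \<longleftrightarrow>
     (\<forall>r>0. act r \<in> iso G G) \<and>
     (\<forall>r>0. \<forall>s>0. \<forall>g\<in>carrier G. act s (act r g) = act (r * s) g) \<and>
     continuous_map (prod_topology (top_of_set {0<..}) X) X (\<lambda>(r, g). act r g)"

definition semidirect :: "('g, 'm) monoid_scheme \<Rightarrow> (real \<Rightarrow> 'g \<Rightarrow> 'g) \<Rightarrow> (real \<times> 'g) monoid" where
  "semidirect G act =
     \<lparr>carrier = {0<..} \<times> carrier G,
      mult = (\<lambda>(r1, g1) (r2, g2). (r1 * r2, act (inverse r2) g1 \<otimes>\<^bsub>G\<^esub> g2)),
      one = (1, \<one>\<^bsub>G\<^esub>)\<rparr>"

definition semidirect_topology :: "'g topology \<Rightarrow> (real \<times> 'g) topology" where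
  "semidirect_topology X = prod_topology (top_of_set {0<..}) X"

section \<open>Summable representations\<close>

text \<open>On the closed half-line the derivatives at the end point are one-sided.\<close>

definition smooth_on_half_line :: "(real \<Rightarrow> real) \<Rightarrow> bool" where
  "smooth_on_half_line u \<longleftrightarrow>
     (\<exists>D. D 0 = u \<and> (\<forall>n::nat. \<forall>r\<ge>0. (D n has_real_derivative D (Suc n) r) (at r within {0..})))"

definition admissible_weight :: "(real \<Rightarrow> real) \<Rightarrow> bool" where
  "admissible_weight u \<longleftrightarrow>
     smooth_on_half_line u \<and> (\<forall>r>0. u r > 0) \<and>
     (\<forall>\<epsilon>>0. (\<integral>\<^sup>+r\<in>{\<epsilon>..}. ennreal (exp (- u r / 2)) \<partial>haar) < \<infinity>)"

definition almost_invariant ::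
  "('g, 'm) monoid_scheme \<Rightarrow> (real \<Rightarrow> 'g \<Rightarrow> 'g) \<Rightarrow> (real \<Rightarrow> real) \<Rightarrow>
   ('g \<Rightarrow> 'k::complex_hilbert \<Rightarrow> 'k) \<Rightarrow> 'k \<Rightarrow> bool" where
  "almost_invariant G act u T h \<longleftrightarrow>
     h \<noteq> 0 \<and>
     (\<forall>g\<in>carrier G. (\<integral>\<^sup>+r. ennreal (norm (T (act r g) h - h) * exp (- u r / 2)) \<partial>haar) < \<infinity>)"

definition summable_representation ::
  "('g, 'm) monoid_scheme \<Rightarrow> (real \<Rightarrow> 'g \<Rightarrow> 'g) \<Rightarrow> (real \<Rightarrow> real) \<Rightarrow>
   ('g \<Rightarrow> 'k::complex_hilbert \<Rightarrow> 'k) \<Rightarrow> bool" where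
  "summable_representation G act u T \<longleftrightarrow>
     (\<forall>x. (\<forall>g\<in>carrier G. T g x = x) \<longrightarrow> x = 0) \<and> (\<exists>h. almost_invariant G act u T h)"

section \<open>Operators on functions and on the space of square integrable functions\<close>

definition fibre_op ::
  "('g \<Rightarrow> 'k \<Rightarrow> 'k) \<Rightarrow> (real \<Rightarrow> 'g \<Rightarrow> 'g) \<Rightarrow> 'g \<Rightarrow> (real \<Rightarrow> 'k) \<Rightarrow> real \<Rightarrow> 'k" where
  "fibre_op T act g f = (\<lambda>r. T (act r g) (f r))"

definition dilation :: "real \<Rightarrow> (real \<Rightarrow> 'k) \<Rightarrow> real \<Rightarrow> 'k" where
  "dilation r0 f = (\<lambda>r. f (r * r0))"

text \<open>The formula for a general group element uses $(r_0, g) = (r_0, e)(1, g)$.\<close>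

definition semidirect_op ::
  "('g \<Rightarrow> 'k \<Rightarrow> 'k) \<Rightarrow> (real \<Rightarrow> 'g \<Rightarrow> 'g) \<Rightarrow> real \<times> 'g \<Rightarrow> (real \<Rightarrow> 'k) \<Rightarrow> real \<Rightarrow> 'k" where
  "semidirect_op T act = (\<lambda>(r0, g) f. dilation r0 (fibre_op T act g f))"

text \<open>\<open>to_L2\<close> is meaningful on square integrable functions only, so that an operator being
  given by a formula on functions includes that the formula preserves square integrability.\<close>

definition given_by :: "('k L2 \<Rightarrow> 'k L2) \<Rightarrow> ((real \<Rightarrow> 'k::banach) \<Rightarrow> real \<Rightarrow> 'k) \<Rightarrow> bool" where
  "given_by A \<Phi> \<longleftrightarrow>
     (\<forall>f. square_integrable haar f \<longrightarrow>
        square_integrable haar (\<Phi> f) \<and> A (to_L2 f) = to_L2 (\<Phi> f))"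

text \<open>\<open>rep_L2\<close> picks a representative; that the choice is immaterial is expressed by \<open>given_by\<close>.\<close>

definition fibre_representation ::
  "('g \<Rightarrow> 'k \<Rightarrow> 'k) \<Rightarrow> (real \<Rightarrow> 'g \<Rightarrow> 'g) \<Rightarrow> 'g \<Rightarrow> 'k::banach L2 \<Rightarrow> 'k L2" where
  "fibre_representation T act g F = to_L2 (fibre_op T act g (rep_L2 F))"

definition weight_vector :: "(real \<Rightarrow> real) \<Rightarrow> 'k::real_vector \<Rightarrow> real \<Rightarrow> 'k" where
  "weight_vector u h = (\<lambda>r. exp (- u r / 2) *\<^sub>R h)"

definition cocycle_function ::
  "('g \<Rightarrow> 'k \<Rightarrow> 'k) \<Rightarrow> (real \<Rightarrow> 'g \<Rightarrow> 'g) \<Rightarrow> (real \<Rightarrow> real) \<Rightarrow> 'k::real_vector \<Rightarrow>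
   real \<times> 'g \<Rightarrow> real \<Rightarrow> 'k" where
  "cocycle_function T act u h x =
     (\<lambda>r. semidirect_op T act x (weight_vector u h) r - weight_vector u h r)"

end

theory Submission
  imports Defs
begin

text \<open>The operators \<open>f(r) \<mapsto> T(g\<^sup>s\<^sup>r) f(rs)\<close> define the extension; strong continuity is checked on step
  functions, which are total, using compactness of intervals for the fibre group.

  The cocycle splits as \<open>\<beta>(s, g) = S(s) b(g) + c(s)\<close>. Almost invariance makes \<open>b(g)\<close> square integrable,
  and \<open>b\<close> is a pointwise limit of continuous coboundaries \<open>S(g) f\<^sub>n - f\<^sub>n\<close>, with \<open>f\<^sub>n\<close> the truncations of
  \<open>f\<close>; Baire's theorem on the locally compact group then yields a point near which \<open>b\<close> oscillates little,
  and the cocycle identity transports this to every point. The term \<open>c\<close> is a coboundary up to the indicator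
  of an interval, because \<open>exp (-u/2)\<close> is Lipschitz near \<open>0\<close>.

  If \<open>b(g) = S(g) v - v\<close> for all \<open>g\<close>, then \<open>w = f - v\<close> satisfies \<open>T(g\<^sup>r) w(r) = w(r)\<close> for almost every \<open>r\<close>,
  with an exceptional set depending on \<open>g\<close>. At an essential value \<open>(r\<^sub>0, p)\<close> of \<open>r \<mapsto> (r, w(r))\<close> with
  \<open>p \<noteq> 0\<close> continuity forces \<open>p\<close> to be invariant. Hence \<open>w = 0\<close> almost everywhere and \<open>f\<close> would be
  square integrable, which fails near \<open>0\<close>.\<close>

section \<open>Haar measure and strong measurability\<close>

lemma space_haar [simp]: "space haar = {0<..}"
  by (simp add: haar_def space_restrict_space)

lemma sets_haar: "sets haar = sets (restrict_space borel {0<..})"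
  unfolding haar_def by (simp add: sets_density sets_restrict_space)

lemma borel_measurable_haar_id: "(\<lambda>r::real. r) \<in> borel_measurable haar"
  unfolding haar_def by (simp add: measurable_restrict_space1)

lemma measurable_haarI:
  assumes "f \<in> borel_measurable borel" shows "f \<in> borel_measurable haar"
  using measurable_compose[OF borel_measurable_haar_id assms] .

lemma sets_haarI:
  assumes "A \<in> sets borel" "A \<subseteq> {0<..}" shows "A \<in> sets haar"
  unfolding sets_haar using assms by (auto simp: sets_restrict_space)

lemma nn_integral_haar:
  assumes "f \<in> borel_measurable borel"
  shows "(\<integral>\<^sup>+r. f r \<partial>haar) = (\<integral>\<^sup>+r. ennreal (1 / r) * f r * indicator {0<..} r \<partial>lborel)"
proof -
  have "(\<lambda>r::real. ennreal (1/r)) \<in> borel_measurable borel"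
    by measurable
  then show ?thesis
    unfolding haar_def using assms
    by (subst nn_integral_density)
      (auto simp: measurable_restrict_space1 nn_integral_restrict_space mult.commute)
qed

text \<open>The density 1/r is at most 1/a on the interval. This linear majorant of ln (b/a) gives
  finiteness and tends to 0 when the end points merge, which is how \<open>norm_step_L2\<close> uses
  it.\<close>

lemma emeasure_haar_Ioc:
  assumes "0 < a" "a \<le> b"
  shows "emeasure haar {a<..b} \<le> ennreal ((b - a) / a)"
proof -
  have "emeasure haar {a<..b} = (\<integral>\<^sup>+r. indicator {a<..b} r \<partial>haar)"
    using assms by (subst nn_integral_indicator) (auto intro: sets_haarI)
  also have "\<dots> = (\<integral>\<^sup>+r. ennreal (1 / r) * indicator {a<..b} r * indicator {0<..} r \<partial>lborel)"
    by (rule nn_integral_haar) measurable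
  also have "\<dots> \<le> (\<integral>\<^sup>+r. ennreal (1 / a) * indicator {a<..b} r \<partial>lborel)"
    using assms by (intro nn_integral_mono) (auto simp: indicator_def frac_le intro!: ennreal_leI)
  also have "\<dots> = ennreal ((b - a) / a)"
    using assms by (subst nn_integral_cmult) (auto simp: ennreal_mult[symmetric])
  finally show ?thesis .
qed

lemma measurable_dilation:
  assumes "0 < c" shows "(\<lambda>r. r * c) \<in> measurable haar haar"
proof -
  have "(\<lambda>r. r * c) \<in> measurable haar (restrict_space borel {0<..})"
    using assms by (intro measurable_restrict_space2 measurable_haarI) auto
  then show ?thesis
    by (simp cong: measurable_cong_sets add: sets_haar)
qed

text \<open>The substitution r -> c r scales Lebesgue measure, and the density 1/r compensates for
  the factor.\<close>

lemma distr_dilation_haar: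
  assumes c: "0 < c" shows "distr haar haar (\<lambda>r. r * c) = haar"
proof (rule measure_eqI)
  fix A assume "A \<in> sets (distr haar haar (\<lambda>r. r * c))"
  then have A: "A \<in> sets haar"
    by simp
  then obtain B where B: "B \<in> sets borel" "A = B \<inter> {0<..}"
    by (auto simp: sets_haar sets_restrict_space)
  then have AB [measurable]: "A \<in> sets borel"
    by auto
  have vim: "(\<lambda>r. r * c) -` A \<inter> space haar \<in> sets haar"
    using measurable_dilation[OF c] A by (rule measurable_sets)
  have "emeasure (distr haar haar (\<lambda>r. r * c)) A = (\<integral>\<^sup>+r. indicator A (r * c) \<partial>haar)"
    unfolding emeasure_distr[OF measurable_dilation[OF c] A] nn_integral_indicator[OF vim, symmetric]
    by (rule nn_integral_cong) (simp add: indicator_def)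
  also have "\<dots> = (\<integral>\<^sup>+r. ennreal (1 / r) * indicator A (r * c) * indicator {0<..} r \<partial>lborel)"
    by (rule nn_integral_haar) measurable
  \<comment> \<open>The summand 0 and the extracted factor c give the integrand the shape of
    \<open>nn_integral_real_affine\<close>; the factor comes from 1/r = c / (c r).\<close>
  also have "\<dots> = (\<integral>\<^sup>+r. ennreal c * (ennreal (1 / (0 + c * r)) * indicator A (0 + c * r) * indicator {0<..} (0 + c * r)) \<partial>lborel)"
    using c by (intro nn_integral_cong)
      (auto simp: indicator_def mult.commute zero_less_mult_iff ennreal_mult[symmetric])
  also have "\<dots> = ennreal \<bar>c\<bar> * (\<integral>\<^sup>+r. ennreal (1 / (0 + c * r)) * indicator A (0 + c * r) * indicator {0<..} (0 + c * r) \<partial>lborel)"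
    using c by (subst nn_integral_cmult) auto
  also have "\<dots> = (\<integral>\<^sup>+r. ennreal (1 / r) * indicator A r * indicator {0<..} r \<partial>lborel)"
    using c by (intro nn_integral_real_affine[symmetric]) auto
  also have "\<dots> = (\<integral>\<^sup>+r. indicator A r \<partial>haar)"
    by (rule nn_integral_haar[symmetric]) measurable
  also have "\<dots> = emeasure haar A"
    using A by simp
  finally show "emeasure (distr haar haar (\<lambda>r. r * c)) A = emeasure haar A" .
qed simp

lemma AE_dilation:
  assumes "0 < c" "AE r in haar. P r" shows "AE r in haar. P (r * c)"
  by (rule AE_distrD[OF measurable_dilation[OF assms(1)]])
    (subst distr_dilation_haar[OF assms(1)], rule assms(2))

lemma integral_dilation:
  fixes f :: "real \<Rightarrow> 'b::{banach, second_countable_topology}"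
  assumes "0 < c" "f \<in> borel_measurable haar"
  shows "(\<integral>r. f (r * c) \<partial>haar) = (\<integral>r. f r \<partial>haar)"
  using integral_distr[OF measurable_dilation[OF assms(1)] assms(2)]
  by (simp add: distr_dilation_haar[OF assms(1)])

lemma integrable_dilation:
  fixes f :: "real \<Rightarrow> 'b::{banach, second_countable_topology}"
  assumes "0 < c" "integrable haar f"
  shows "integrable haar (\<lambda>r. f (r * c))"
  using assms(2) integrable_distr[OF measurable_dilation[OF assms(1)], of f]
  by (simp add: distr_dilation_haar[OF assms(1)])

section \<open>Strong measurability under composition and continuous maps\<close>

lemma strongly_measurable_compose:
  assumes f: "strongly_measurable M f" and h: "h \<in> measurable N M"
  shows "strongly_measurable N (\<lambda>x. f (h x))"
proof -
  obtain s where s: "\<And>i::nat. simple_function M (s i)" "\<And>x. x \<in> space M \<Longrightarrow> (\<lambda>i. s i x) \<longlonglongrightarrow> f x"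
    using f unfolding strongly_measurable_def by blast
  have "simple_function N (\<lambda>x. s i (h x))" for i
    unfolding simple_function_def
  proof
    have "(\<lambda>x. s i (h x)) ` space N \<subseteq> s i ` space M"
      using measurable_space[OF h] by auto
    then show "finite ((\<lambda>x. s i (h x)) ` space N)"
      using simple_functionD(1)[OF s(1)] by (rule finite_subset)
    have "(\<lambda>x. s i (h x)) -` {y} \<inter> space N \<in> sets N" for y
    proof -
      have "(\<lambda>x. s i (h x)) -` {y} \<inter> space N = h -` (s i -` {y} \<inter> space M) \<inter> space N"
        using measurable_space[OF h] by auto
      also have "\<dots> \<in> sets N"
        using h simple_functionD(2)[OF s(1)] by (rule measurable_sets)
      finally show ?thesis .
    qed
    then show "\<forall>y\<in>(\<lambda>x. s i (h x)) ` space N. (\<lambda>x. s i (h x)) -` {y} \<inter> space N \<in> sets N"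
      by blast
  qed
  then show ?thesis
    unfolding strongly_measurable_def
    by (intro exI[of _ "\<lambda>i x. s i (h x)"]) (use s(2) measurable_space[OF h] in auto)
qed

lemma strongly_measurable_cong:
  assumes "\<And>x. x \<in> space M \<Longrightarrow> f x = g x"
  shows "strongly_measurable M f \<longleftrightarrow> strongly_measurable M g"
  unfolding strongly_measurable_def by (simp add: assms)

lemma square_integrable_cong:
  assumes "\<And>x. x \<in> space M \<Longrightarrow> f x = g x"
  shows "square_integrable M f \<longleftrightarrow> square_integrable M g"
  unfolding square_integrable_def
  by (intro arg_cong2[where f = conj] strongly_measurable_cong Bochner_Integration.integrable_cong)
    (simp_all add: assms)

lemma strongly_measurable_real:
  fixes f :: "'a \<Rightarrow> real"
  assumes "f \<in> borel_measurable M" shows "strongly_measurable M f"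
proof -
  have D: "countable (\<rat> :: real set)" "(\<rat> :: real set) \<noteq> {}"
    using countable_rat Rats_0 by auto
  show ?thesis
    using assms by (rule strongly_measurableI[where d = "from_nat_into \<rat>"])
      (simp add: range_from_nat_into[OF D(2,1)] Rats_closure_real)
qed

lemma strongly_measurable_scaleR_fun:
  fixes f :: "'a \<Rightarrow> real" and g :: "'a \<Rightarrow> 'b::real_normed_vector"
  assumes "f \<in> borel_measurable M" "strongly_measurable M g"
  shows "strongly_measurable M (\<lambda>x. f x *\<^sub>R g x)"
  by (rule strongly_measurable_comp2[OF strongly_measurable_real[OF assms(1)] assms(2), where h = scaleR])
    (rule tendsto_scaleR)

text \<open>The approximating simple functions take countably many values altogether. This supplies
  the separability that the target space itself need not have.\<close>

lemma strongly_measurable_countable_range: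
  fixes f :: "'a \<Rightarrow> 'b::real_normed_vector"
  assumes "strongly_measurable M f"
  obtains d :: "nat \<Rightarrow> 'b" where "\<And>x. x \<in> space M \<Longrightarrow> f x \<in> closure (range d)"
proof -
  obtain s where s: "\<And>i::nat. simple_function M (s i)" "\<And>x. x \<in> space M \<Longrightarrow> (\<lambda>i. s i x) \<longlonglongrightarrow> f x"
    using assms unfolding strongly_measurable_def by blast
  \<comment> \<open>Inserting 0 keeps the set nonempty even over an empty space, as its enumeration
    by \<open>from_nat_into\<close> requires.\<close>
  define D where "D = insert 0 (\<Union>i. s i ` space M)"
  have "countable (s i ` space M)" for i
    by (rule countable_finite, rule simple_functionD(1)[OF s(1)])
  then have D: "countable D" "D \<noteq> {}"
    unfolding D_def by auto
  show ?thesis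
  proof
    fix x assume x: "x \<in> space M"
    show "f x \<in> closure (range (from_nat_into D))"
      unfolding range_from_nat_into[OF D(2,1)] closure_sequential
      by (rule exI[of _ "\<lambda>j. s j x"]) (use s(2)[OF x] x in \<open>auto simp: D_def\<close>)
  qed
qed

text \<open>Simple approximations of r and of \<open>f\<close> are fed into \<Psi> together, and
  continuity carries the limit. Applied to (r, x) -> T (act r g) x, it shows that the fibre
  operators preserve strong measurability.\<close>

lemma strongly_measurable_haar_continuous2:
  fixes f :: "real \<Rightarrow> 'b::real_normed_vector" and \<Psi> :: "real \<times> 'b \<Rightarrow> 'c::real_normed_vector"
  assumes f: "strongly_measurable haar f" and \<Psi>: "continuous_on ({0<..} \<times> UNIV) \<Psi>"
  shows "strongly_measurable haar (\<lambda>r. \<Psi> (r, f r))"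
proof -
  obtain s where s: "\<And>i::nat. simple_function haar (s i)" "\<And>x. x \<in> space haar \<Longrightarrow> (\<lambda>i. s i x) \<longlonglongrightarrow> f x"
    using f unfolding strongly_measurable_def by blast
  obtain t where t: "\<And>i::nat. simple_function haar (t i)" "\<And>x. x \<in> space haar \<Longrightarrow> (\<lambda>i. t i x) \<longlonglongrightarrow> x"
    using strongly_measurable_real[OF borel_measurable_haar_id] unfolding strongly_measurable_def by blast
  \<comment> \<open>The approximants of r may leave the half-line, where \<Psi> need not be
    continuous; there they are replaced by 1. For fixed x > 0 this happens only finitely
    often.\<close>
  define t' where "t' i x = (if t i x > 0 then t i x else 1)" for i x
  have t': "simple_function haar (t' i)" for i
    unfolding t'_def using t(1) by (rule simple_function_compose1)
  have t'_pos: "t' i x > 0" for i x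
    by (simp add: t'_def)
  have t'_lim: "(\<lambda>i. t' i x) \<longlonglongrightarrow> x" if "x > 0" for x
  proof (rule Lim_transform_eventually)
    show "(\<lambda>i. t i x) \<longlonglongrightarrow> x"
      using t(2) that by simp
    from order_tendstoD(1)[OF this that] show "\<forall>\<^sub>F i in sequentially. t i x = t' i x"
      by eventually_elim (simp add: t'_def)
  qed
  have "simple_function haar (\<lambda>r. \<Psi> (t' i r, s i r))" for i
    using t' s(1) by (rule simple_function_compose2)
  moreover have "(\<lambda>i. \<Psi> (t' i x, s i x)) \<longlonglongrightarrow> \<Psi> (x, f x)" if "x \<in> space haar" for x
    using that t'_pos
    by (intro continuous_on_tendsto_compose[OF \<Psi>] tendsto_Pair t'_lim s(2)) auto
  ultimately show ?thesis
    unfolding strongly_measurable_def by (intro exI[of _ "\<lambda>i r. \<Psi> (t' i r, s i r)"]) auto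
qed

section \<open>Square integrable functions\<close>

lemma to_L2_eq_iff:
  fixes f g :: "real \<Rightarrow> 'k::banach"
  assumes "square_integrable haar f" "square_integrable haar g"
  shows "to_L2 f = to_L2 g \<longleftrightarrow> (AE r in haar. f r = g r)"
  using Quotient3_rel[OF Quotient3_L2, of f g] assms by (auto simp: L2_rel_def)

lemma to_L2_cong:
  assumes "square_integrable haar f" "\<And>r. r > 0 \<Longrightarrow> f r = g r"
  shows "to_L2 f = to_L2 (g :: real \<Rightarrow> 'k::banach)"
proof -
  have "square_integrable haar g"
    using assms square_integrable_cong[of haar f g] by simp
  then show ?thesis
    using assms by (subst to_L2_eq_iff) auto
qed

lemma square_integrable_rep_L2: "square_integrable haar (rep_L2 F)"
  using Quotient3_rep_reflp[OF Quotient3_L2, of F] by (simp add: L2_rel_def)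

lemma to_L2_rep_L2 [simp]: "to_L2 (rep_L2 F) = F"
  by (rule Quotient3_abs_rep[OF Quotient3_L2])

lemma AE_rep_L2_to_L2:
  fixes f :: "real \<Rightarrow> 'k::banach"
  assumes "square_integrable haar f" shows "AE r in haar. rep_L2 (to_L2 f) r = f r"
  using to_L2_eq_iff[OF square_integrable_rep_L2 assms, of "to_L2 f"] by simp

lemma to_L2_add:
  fixes f g :: "real \<Rightarrow> 'k::banach"
  assumes "square_integrable haar f" "square_integrable haar g"
  shows "to_L2 f + to_L2 g = to_L2 (\<lambda>r. f r + g r)"
  using assms by (simp add: plus_L2.abs_eq L2_rel_refl)

lemma to_L2_diff:
  fixes f g :: "real \<Rightarrow> 'k::banach"
  assumes "square_integrable haar f" "square_integrable haar g"
  shows "to_L2 f - to_L2 g = to_L2 (\<lambda>r. f r - g r)"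
  using assms by (simp add: minus_L2.abs_eq L2_rel_refl)

lemma norm_to_L2:
  fixes f :: "real \<Rightarrow> 'k::banach"
  assumes "square_integrable haar f"
  shows "norm (to_L2 f) = sqrt (\<integral>r. (norm (f r))\<^sup>2 \<partial>haar)"
  using assms by (simp add: norm_L2.abs_eq L2_rel_refl)

text \<open>Dominated convergence for the squared distance. The limit inherits the bound
  \<open>w\<close>, so \<open>norm_add_sq_le\<close> gives the majorant 2 w + 2 w.\<close>

lemma to_L2_tendsto:
  fixes f :: "nat \<Rightarrow> real \<Rightarrow> 'k::banach"
  assumes f: "\<And>n. strongly_measurable haar (f n)" and g: "strongly_measurable haar g"
    and w: "integrable haar w" and le: "\<And>n r. r > 0 \<Longrightarrow> (norm (f n r))\<^sup>2 \<le> w r"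
    and lim: "\<And>r. r > 0 \<Longrightarrow> (\<lambda>n. f n r) \<longlonglongrightarrow> g r"
  shows "(\<lambda>n. to_L2 (f n)) \<longlonglongrightarrow> to_L2 g"
proof -
  have le': "(norm (g r))\<^sup>2 \<le> w r" if "r > 0" for r
    by (rule LIMSEQ_le_const2[of "\<lambda>n. (norm (f n r))\<^sup>2"]) (auto intro!: tendsto_intros lim le that)
  have sf: "square_integrable haar (f n)" for n
    using f w le by (rule square_integrableI) auto
  have sg: "square_integrable haar g"
    using g w le' by (rule square_integrableI) auto
  have "(\<lambda>n. \<integral>r. (norm (f n r - g r))\<^sup>2 \<partial>haar) \<longlonglongrightarrow> (\<integral>r. 0 \<partial>haar)"
  proof (rule integral_dominated_convergence[where w = "\<lambda>r. 4 * w r"])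
    show "(\<lambda>r. (norm (f n r - g r))\<^sup>2) \<in> borel_measurable haar" for n
      using square_integrable_diff[OF sf sg] by (auto simp: square_integrable_def)
    show "AE r in haar. (\<lambda>n. (norm (f n r - g r))\<^sup>2) \<longlonglongrightarrow> 0"
    proof (rule AE_I2)
      fix r :: real assume "r \<in> space haar"
      then have "(\<lambda>n. (norm (f n r - g r))\<^sup>2) \<longlonglongrightarrow> (norm (g r - g r))\<^sup>2"
        by (intro tendsto_intros lim) simp
      then show "(\<lambda>n. (norm (f n r - g r))\<^sup>2) \<longlonglongrightarrow> 0"
        by simp
    qed
    show "AE r in haar. norm ((norm (f n r - g r))\<^sup>2) \<le> 4 * w r" for n
    proof (rule AE_I2)
      fix r :: real assume "r \<in> space haar"
      then show "norm ((norm (f n r - g r))\<^sup>2) \<le> 4 * w r"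
        using le[of r n] le'[of r] norm_add_sq_le[of "f n r" "- g r"] by simp
    qed
  qed (use w in auto)
  then have "(\<lambda>n. sqrt (\<integral>r. (norm (f n r - g r))\<^sup>2 \<partial>haar)) \<longlonglongrightarrow> sqrt 0"
    by (intro tendsto_real_sqrt) simp
  then show ?thesis
    by - (rule tendsto_dist_iff[THEN iffD2], simp add: dist_norm norm_to_L2_diff sf sg)
qed

section \<open>Totality of the interval step functions\<close>

lemma integrable_indicator_haar:
  assumes "A \<in> sets borel" "A \<subseteq> {a<..b}" "0 < a"
  shows "integrable haar (indicat_real A)"
proof (cases "a \<le> b")
  case True
  have A: "A \<in> sets haar"
    using assms by (intro sets_haarI) auto
  have "emeasure haar A \<le> emeasure haar {a<..b}"
    using assms by (intro emeasure_mono sets_haarI) auto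
  also have "\<dots> < \<infinity>"
    using emeasure_haar_Ioc[OF assms(3) True] by (simp add: le_less_trans)
  finally have "emeasure haar A < \<infinity>" .
  moreover have "A \<inter> space haar = A"
    using assms by auto
  ultimately show ?thesis
    using A by (simp add: integrable_indicator_iff del: space_haar)
next
  case False
  then have "A = {}"
    using assms by auto
  then show ?thesis
    by simp
qed

lemma strongly_measurable_indicator:
  assumes "A \<in> sets borel"
  shows "strongly_measurable haar (\<lambda>r. indicat_real A r *\<^sub>R x)"
  using assms by (intro strongly_measurable_scaleR_fun strongly_measurable_const measurable_haarI) simp

lemma square_integrable_indicator:
  assumes "A \<in> sets borel" "A \<subseteq> {a<..b}" "0 < a"
  shows "square_integrable haar (\<lambda>r. indicat_real A r *\<^sub>R x)"
proof (rule square_integrableI)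
  show "integrable haar (\<lambda>r. (norm x)\<^sup>2 * indicat_real A r)"
    using integrable_indicator_haar[OF assms] by simp
  show "strongly_measurable haar (\<lambda>r. indicat_real A r *\<^sub>R x)"
    using assms(1) by (rule strongly_measurable_indicator)
qed (simp add: indicator_def)

text \<open>A Dynkin class argument: half-open intervals are stable under intersection and generate
  the Borel sets. Everything is cut down to \<open>{a<..b}\<close>, which has finite measure, so
  that all functions involved stay square integrable.\<close>

lemma L2_induct_indicator:
  fixes P :: "'k::banach L2 \<Rightarrow> bool"
  assumes interval: "\<And>a b x. 0 < a \<Longrightarrow> a \<le> b \<Longrightarrow> P (to_L2 (\<lambda>r. indicat_real {a<..b} r *\<^sub>R x))"
    and add: "\<And>F G. P F \<Longrightarrow> P G \<Longrightarrow> P (F + G)"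
    and limit: "\<And>Fs F. (\<And>n. P (Fs n)) \<Longrightarrow> Fs \<longlonglongrightarrow> F \<Longrightarrow> P F"
    and A: "A \<in> sets borel" and ab: "0 < a" "a \<le> b"
  shows "P (to_L2 (\<lambda>r. indicat_real (A \<inter> {a<..b}) r *\<^sub>R x))"
proof -
  define G where "G = range (\<lambda>(a, b). {a<..b::real})"
  have borel: "sets borel = sigma_sets UNIV G"
    unfolding G_def borel_sigma_sets_Ioc by simp
  have si: "square_integrable haar (\<lambda>r. indicat_real (B \<inter> {a<..b}) r *\<^sub>R x)" if "B \<in> sets borel" for B x
    using that ab(1) by (intro square_integrable_indicator[of _ a b]) auto
  have int: "Int_stable G"
  proof (rule Int_stableI)
    fix A B assume "A \<in> G" "B \<in> G"
    then obtain p q r s where "A = {p<..q}" "B = {r<..s}"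
      unfolding G_def by auto
    then have "A \<inter> B = (\<lambda>(a, b). {a<..b}) (max p r, min q s)"
      by auto
    then show "A \<inter> B \<in> G"
      unfolding G_def by blast
  qed
  have "G \<subseteq> Pow UNIV" "A \<in> sigma_sets UNIV G"
    using A by (simp_all add: borel)
  from int this
  \<comment> \<open>The vector x is quantified inside because the complement case uses the induction
    hypothesis at -x.\<close>
  have "\<forall>x. P (to_L2 (\<lambda>r. indicat_real (A \<inter> {a<..b}) r *\<^sub>R x))"
  proof (induction rule: sigma_sets_induct_disjoint)
    case (basic A)
    then obtain p q where "A = {p<..q}"
      unfolding G_def by auto
    then have Aab: "A \<inter> {a<..b} = {max p a<..min q b}"
      by auto
    show ?case
    proof (cases "max p a \<le> min q b")
      case True
      then show ?thesis
        unfolding Aab using ab by (auto intro!: interval)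
    next
      case False
      \<comment> \<open>The degenerate interval \<open>{a<..a}\<close> stands for the empty set, so
        that the hypothesis \<open>interval\<close> also covers the zero function.\<close>
      then have "A \<inter> {a<..b} = {a<..a}"
        unfolding Aab by auto
      then show ?thesis
        using interval[OF ab(1) order_refl] by simp
    qed
  next
    case empty
    have "{} \<inter> {a<..b} = {a<..a}"
      by auto
    then show ?case
      using interval[OF ab(1) order_refl] by simp
  next
    case (compl A)
    show ?case
    proof
      fix x
      have "P (to_L2 (\<lambda>r. indicat_real {a<..b} r *\<^sub>R x) +
          to_L2 (\<lambda>r. indicat_real (A \<inter> {a<..b}) r *\<^sub>R (- x)))"
        by (rule add[OF interval[OF ab] spec[OF compl.IH]])
      also have "to_L2 (\<lambda>r. indicat_real {a<..b} r *\<^sub>R x) +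
          to_L2 (\<lambda>r. indicat_real (A \<inter> {a<..b}) r *\<^sub>R (- x)) =
          to_L2 (\<lambda>r. indicat_real {a<..b} r *\<^sub>R x + indicat_real (A \<inter> {a<..b}) r *\<^sub>R (- x))"
        using compl.hyps ab(1)
        by (intro to_L2_add si square_integrable_indicator[of _ a b]) (simp_all add: borel[symmetric])
      also have "(\<lambda>r. indicat_real {a<..b} r *\<^sub>R x + indicat_real (A \<inter> {a<..b}) r *\<^sub>R (- x)) =
          (\<lambda>r. indicat_real ((UNIV - A) \<inter> {a<..b}) r *\<^sub>R x)"
        by (auto simp: indicator_def fun_eq_iff)
      finally show "P (to_L2 (\<lambda>r. indicat_real ((UNIV - A) \<inter> {a<..b}) r *\<^sub>R x))" .
    qed
  next
    case (union A)
    have A: "A i \<in> sets borel" for i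
      using union.hyps(2) by (auto simp: borel)
    \<comment> \<open>The partial unions are reached one set at a time by \<open>add\<close>;
      dominated convergence and \<open>limit\<close> then give the full union.\<close>
    define B where "B n = (\<Union>i<n. A i)" for n
    have B: "B n \<in> sets borel" for n
      unfolding B_def using A by auto
    show ?case
    proof
      fix x
      have "P (to_L2 (\<lambda>r. indicat_real (B n \<inter> {a<..b}) r *\<^sub>R x))" for n
      proof (induction n)
        case 0
        have "B 0 \<inter> {a<..b} = {a<..a}"
          by (auto simp: B_def)
        then show ?case
          using interval[OF ab(1) order_refl] by simp
      next
        case (Suc n)
        have "A n \<inter> A i = {}" if "i < n" for i
          using disjoint_family_onD[OF union.hyps(1), of n i] that by simp
        then have disj: "A n \<inter> B n = {}"
          unfolding B_def by blast
        have "P (to_L2 (\<lambda>r. indicat_real (B n \<inter> {a<..b}) r *\<^sub>R x) +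
            to_L2 (\<lambda>r. indicat_real (A n \<inter> {a<..b}) r *\<^sub>R x))"
          by (rule add[OF Suc.IH spec[OF union.IH]])
        also have "to_L2 (\<lambda>r. indicat_real (B n \<inter> {a<..b}) r *\<^sub>R x) +
            to_L2 (\<lambda>r. indicat_real (A n \<inter> {a<..b}) r *\<^sub>R x) =
            to_L2 (\<lambda>r. indicat_real (B n \<inter> {a<..b}) r *\<^sub>R x + indicat_real (A n \<inter> {a<..b}) r *\<^sub>R x)"
          by (intro to_L2_add si A B)
        also have "(\<lambda>r. indicat_real (B n \<inter> {a<..b}) r *\<^sub>R x + indicat_real (A n \<inter> {a<..b}) r *\<^sub>R x) =
            (\<lambda>r. indicat_real (B (Suc n) \<inter> {a<..b}) r *\<^sub>R x)"
          using disj by (auto simp: B_def lessThan_Suc indicator_def fun_eq_iff)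
        finally show ?case .
      qed
      moreover have "(\<lambda>n. to_L2 (\<lambda>r. indicat_real (B n \<inter> {a<..b}) r *\<^sub>R x)) \<longlonglongrightarrow>
          to_L2 (\<lambda>r. indicat_real ((\<Union>i. A i) \<inter> {a<..b}) r *\<^sub>R x)"
      proof (rule to_L2_tendsto)
        show "strongly_measurable haar (\<lambda>r. indicat_real (B n \<inter> {a<..b}) r *\<^sub>R x)" for n
          using B by (intro strongly_measurable_indicator) auto
        show "strongly_measurable haar (\<lambda>r. indicat_real ((\<Union>i. A i) \<inter> {a<..b}) r *\<^sub>R x)"
          using A by (intro strongly_measurable_indicator) auto
        show "integrable haar (\<lambda>r. (norm x)\<^sup>2 * indicat_real {a<..b} r)"
          using integrable_indicator_haar[of "{a<..b}" a b] ab by simp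
        fix r :: real
        have "(\<lambda>n. indicat_real (B n) r) \<longlonglongrightarrow> indicat_real (\<Union>i. A i) r"
          unfolding B_def by (rule LIMSEQ_indicator_UN)
        then have "(\<lambda>n. (indicat_real (B n) r * indicat_real {a<..b} r) *\<^sub>R x)
            \<longlonglongrightarrow> (indicat_real (\<Union>i. A i) r * indicat_real {a<..b} r) *\<^sub>R x"
          by (intro tendsto_intros)
        then show "(\<lambda>n. indicat_real (B n \<inter> {a<..b}) r *\<^sub>R x)
            \<longlonglongrightarrow> indicat_real ((\<Union>i. A i) \<inter> {a<..b}) r *\<^sub>R x"
          by (simp add: indicator_inter_arith)
      qed (auto simp: indicator_def)
      ultimately show "P (to_L2 (\<lambda>r. indicat_real ((\<Union>i. A i) \<inter> {a<..b}) r *\<^sub>R x))"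
        by (rule limit)
    qed
  qed
  then show ?thesis
    by blast
qed

text \<open>Indicators of Borel sets give the simple functions supported in some
  \<open>{a<..b}\<close> with a > 0, and these approximate every element. Strong continuity is
  thereby reduced to functions that are constant on one interval.\<close>

lemma L2_induct [case_names interval add limit]:
  fixes P :: "'k::banach L2 \<Rightarrow> bool"
  assumes interval: "\<And>a b x. 0 < a \<Longrightarrow> a \<le> b \<Longrightarrow> P (to_L2 (\<lambda>r. indicat_real {a<..b} r *\<^sub>R x))"
    and add: "\<And>F G. P F \<Longrightarrow> P G \<Longrightarrow> P (F + G)"
    and limit: "\<And>Fs F. (\<And>n. P (Fs n)) \<Longrightarrow> Fs \<longlonglongrightarrow> F \<Longrightarrow> P F"
  shows "P F"
proof -
  have simple: "P (to_L2 s)"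
    if s: "simple_function haar s" and supp: "\<And>r. r > 0 \<Longrightarrow> s r \<noteq> 0 \<Longrightarrow> r \<in> {a<..b}"
      and ab: "0 < a" "a \<le> b" for s :: "real \<Rightarrow> 'k" and a b
  proof -
    define A where "A y = s -` {y} \<inter> {0<..}" for y
    have A: "A y \<in> sets borel" for y
      using simple_functionD(2)[OF s, of "{y}"] by (auto simp: A_def sets_haar sets_restrict_space)
    have si: "square_integrable haar (\<lambda>r. indicat_real (A y \<inter> {a<..b}) r *\<^sub>R x)" for y x
      using A ab(1) by (intro square_integrable_indicator[of _ a b]) auto
    have "square_integrable haar (\<lambda>r. \<Sum>y\<in>Y. indicat_real (A y \<inter> {a<..b}) r *\<^sub>R y) \<and>
        P (to_L2 (\<lambda>r. \<Sum>y\<in>Y. indicat_real (A y \<inter> {a<..b}) r *\<^sub>R y))" if "finite Y" for Y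
      using that
    proof (induction Y)
      case empty
      show ?case
        using interval[OF ab(1) order_refl, of 0] by (simp add: square_integrable_zero)
    next
      case (insert y Y)
      have "P (to_L2 (\<lambda>r. indicat_real (A y \<inter> {a<..b}) r *\<^sub>R y) +
          to_L2 (\<lambda>r. \<Sum>y\<in>Y. indicat_real (A y \<inter> {a<..b}) r *\<^sub>R y))"
        using insert.IH by (intro add[OF L2_induct_indicator[OF interval add limit A ab]]) auto
      moreover have "(\<lambda>r. \<Sum>y\<in>insert y Y. indicat_real (A y \<inter> {a<..b}) r *\<^sub>R y) =
          (\<lambda>r. indicat_real (A y \<inter> {a<..b}) r *\<^sub>R y + (\<Sum>y\<in>Y. indicat_real (A y \<inter> {a<..b}) r *\<^sub>R y))"
        by (simp only: sum.insert[OF insert.hyps])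
      ultimately show ?case
        using insert.IH si[of y y] by (simp only: to_L2_add square_integrable_add simp_thms)
    qed
    then have "square_integrable haar (\<lambda>r. \<Sum>y\<in>s ` {0<..}. indicat_real (A y \<inter> {a<..b}) r *\<^sub>R y)"
      "P (to_L2 (\<lambda>r. \<Sum>y\<in>s ` {0<..}. indicat_real (A y \<inter> {a<..b}) r *\<^sub>R y))"
      using simple_functionD(1)[OF s] by auto
    moreover have "(\<Sum>y\<in>s ` {0<..}. indicat_real (A y \<inter> {a<..b}) r *\<^sub>R y) = s r" if "r > 0" for r
    proof -
      have "(\<Sum>y\<in>s ` {0<..}. indicat_real (A y \<inter> {a<..b}) r *\<^sub>R y) = (\<Sum>y\<in>{s r}. indicat_real (A y \<inter> {a<..b}) r *\<^sub>R y)"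
        using simple_functionD(1)[OF s] that by (intro sum.mono_neutral_right) (auto simp: A_def)
      also have "\<dots> = s r"
        using that supp[OF that] by (auto simp: A_def indicator_def)
      finally show ?thesis .
    qed
    ultimately show ?thesis
      using to_L2_cong[of "\<lambda>r. \<Sum>y\<in>s ` {0<..}. indicat_real (A y \<inter> {a<..b}) r *\<^sub>R y" s] by simp
  qed
  obtain f where f: "square_integrable haar f" "F = to_L2 f"
    using ex_to_L2 by blast
  then have sm: "strongly_measurable haar f"
    by (simp add: square_integrable_def)
  then obtain s where s: "\<And>i::nat. simple_function haar (s i)" "\<And>x. x > 0 \<Longrightarrow> (\<lambda>i. s i x) \<longlonglongrightarrow> f x"
    unfolding strongly_measurable_def by auto
  define J where "J i = {1 / real (Suc i)<..real (Suc i)}" for i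
  \<comment> \<open>Two truncations: support in \<open>J i\<close> gives finite measure, and
    discarding values above \<open>2 * norm (f r)\<close> gives an integrable majorant. The factor 2
    ensures that the approximants are eventually kept wherever \<open>f r \<noteq> 0\<close>; where
    \<open>f r = 0\<close> the truncation is 0 in any case.\<close>
  define t where "t i r = (if r \<in> J i \<and> norm (s i r) \<le> 2 * norm (f r) then s i r else 0)" for i r
  have t: "simple_function haar (t i)" for i
    unfolding t_def
  proof (rule simple_function_If)
    have [measurable]: "(\<lambda>r. norm (f r)) \<in> borel_measurable haar"
      using sm by (rule strongly_measurable_borel_measurable_norm)
    have [measurable]: "s i \<in> borel_measurable haar"
      using s(1) by (rule borel_measurable_simple_function)
    have [measurable]: "J i \<in> sets haar"
      unfolding J_def by (intro sets_haarI) (auto intro: less_trans[of 0 "1 / (1 + real i)"])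
    show "{r \<in> space haar. r \<in> J i \<and> norm (s i r) \<le> 2 * norm (f r)} \<in> sets haar"
      by measurable
  qed (use s in auto)
  have "P (to_L2 (t i))" for i
    by (rule simple[OF t, of _ "1 / real (Suc i)" "real (Suc i)"])
      (auto simp: t_def J_def field_simps split: if_splits)
  moreover have "(\<lambda>i. to_L2 (t i)) \<longlonglongrightarrow> to_L2 f"
  proof (rule to_L2_tendsto)
    show "strongly_measurable haar (t i)" for i
      unfolding strongly_measurable_def using t by (intro exI[of _ "\<lambda>_. t i"]) auto
    show "integrable haar (\<lambda>r. 4 * (norm (f r))\<^sup>2)"
      using f by (simp add: square_integrable_def)
    fix r :: real assume r: "r > 0"
    show "(norm (t i r))\<^sup>2 \<le> 4 * (norm (f r))\<^sup>2" for i
    proof -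
      have "norm (t i r) \<le> 2 * norm (f r)"
        by (simp add: t_def)
      then have "(norm (t i r))\<^sup>2 \<le> (2 * norm (f r))\<^sup>2"
        by (intro power_mono) auto
      then show ?thesis
        by (simp add: power_mult_distrib)
    qed
    show "(\<lambda>i. t i r) \<longlonglongrightarrow> f r"
    proof (cases "f r = 0")
      case True
      then show ?thesis
        by (simp add: t_def cong: if_cong)
    next
      case False
      have "(\<lambda>i. norm (s i r)) \<longlonglongrightarrow> norm (f r)"
        by (intro tendsto_intros s r)
      from order_tendstoD(2)[OF this, of "2 * norm (f r)"]
      have "\<forall>\<^sub>F i in sequentially. norm (s i r) < 2 * norm (f r)"
        using False by simp
      moreover have "\<forall>\<^sub>F i in sequentially. 1 / real (Suc i) < r"
        using order_tendstoD(2)[OF LIMSEQ_inverse_real_of_nat r] by (simp add: field_simps)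
      moreover have "\<forall>\<^sub>F i in sequentially. r \<le> real (Suc i)"
        using eventually_ge_at_top[of "nat \<lceil>r\<rceil>"] by eventually_elim linarith
      ultimately have "\<forall>\<^sub>F i in sequentially. s i r = t i r"
        by eventually_elim (simp add: t_def J_def)
      then show ?thesis
        by (rule Lim_transform_eventually[OF s(2)[OF r]])
    qed
  qed (rule sm)
  ultimately show ?thesis
    unfolding f(2) by (rule limit)
qed

section \<open>Continuity of maps into metric spaces\<close>

lemma continuous_map_metric_iff:
  fixes f :: "'a \<Rightarrow> 'b::metric_space"
  shows "continuous_map X euclidean f \<longleftrightarrow>
    (\<forall>x\<in>topspace X. \<forall>e>0. \<exists>U. openin X U \<and> x \<in> U \<and> (\<forall>y\<in>U. dist (f y) (f x) < e))"
  using Met_TC.continuous_map_to_metric[of X f] by (simp add: dist_commute)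

text \<open>An e/3 argument: the contraction bound is uniform in g, so orbit maps of approximating
  vectors converge uniformly. This is the \<open>limit\<close> case whenever
  \<open>L2_induct\<close> is used for strong continuity.\<close>

lemma continuous_map_contraction_limit:
  fixes S :: "'a \<Rightarrow> 'b::metric_space \<Rightarrow> 'c::metric_space"
  assumes cont: "\<And>n. continuous_map X euclidean (\<lambda>g. S g (Fs n))" and lim: "Fs \<longlonglongrightarrow> F"
    and S: "\<And>g x y. g \<in> topspace X \<Longrightarrow> dist (S g x) (S g y) \<le> dist x y"
  shows "continuous_map X euclidean (\<lambda>g. S g F)"
  unfolding continuous_map_metric_iff
proof (intro ballI allI impI)
  fix g and e :: real assume g: "g \<in> topspace X" and e: "e > 0"
  then obtain n where n: "dist (Fs n) F < e / 3"
    using metric_LIMSEQ_D[OF lim, of "e / 3"] by auto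
  obtain U where U: "openin X U" "g \<in> U" "\<forall>k\<in>U. dist (S k (Fs n)) (S g (Fs n)) < e / 3"
    using cont[of n] g e unfolding continuous_map_metric_iff by (metis zero_less_divide_iff zero_less_numeral)
  have "dist (S k F) (S g F) < e" if "k \<in> U" for k
  proof -
    have "k \<in> topspace X"
      using U(1) that openin_subset by blast
    then have "dist (S k F) (S k (Fs n)) < e / 3" "dist (S g (Fs n)) (S g F) < e / 3"
      using S[of k F "Fs n"] S[OF g, of "Fs n" F] n by (auto simp: dist_commute)
    moreover have "dist (S k (Fs n)) (S g (Fs n)) < e / 3"
      using U(3) that by blast
    ultimately show ?thesis
      using dist_triangle[of "S k F" "S g F" "S k (Fs n)"] dist_triangle[of "S k (Fs n)" "S g F" "S g (Fs n)"]
      by linarith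
  qed
  then show "\<exists>U. openin X U \<and> g \<in> U \<and> (\<forall>y\<in>U. dist (S y F) (S g F) < e)"
    using U by blast
qed

section \<open>Step functions\<close>

text \<open>The indicator of an oriented interval, with reversed sign for b < a. It is additive in
  the end points whatever their order, which is what moving both end points requires.\<close>

definition step_L2 :: "real \<Rightarrow> real \<Rightarrow> 'k::banach \<Rightarrow> 'k L2" where
  "step_L2 a b x = to_L2 (\<lambda>r. (indicator {0<..b} r - indicator {0<..a} r) *\<^sub>R x)"

lemma step_fun_cases:
  fixes a b r :: real and x :: "'k::real_vector"
  assumes "0 < a" "0 < b"
  shows "(indicator {0<..b} r - indicator {0<..a} r) *\<^sub>R x =
    (if a \<le> b then indicat_real {a<..b} r *\<^sub>R x else indicat_real {b<..a} r *\<^sub>R (- x))"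
  using assms by (auto simp: indicator_def)

lemma square_integrable_step:
  assumes "0 < a" "0 < b"
  shows "square_integrable haar (\<lambda>r. (indicator {0<..b} r - indicator {0<..a} r) *\<^sub>R x)"
  using square_integrable_indicator[of "{a<..b}" a b x] square_integrable_indicator[of "{b<..a}" b a "- x"] assms
  unfolding step_fun_cases[OF assms] by (cases "a \<le> b") auto

lemma step_L2_eq_indicator:
  assumes "0 < a" "a \<le> b"
  shows "step_L2 a b x = to_L2 (\<lambda>r. indicat_real {a<..b} r *\<^sub>R x)"
  unfolding step_L2_def using assms by (subst step_fun_cases) auto

lemma step_L2_add:
  assumes "0 < a" "0 < b" "0 < c"
  shows "step_L2 a b x + step_L2 b c x = step_L2 a c x"
  unfolding step_L2_def
  unfolding to_L2_add[OF square_integrable_step[OF assms(1,2)] square_integrable_step[OF assms(2,3)]]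
  by (simp add: algebra_simps)

lemma norm_step_L2:
  assumes a: "0 < a" and b: "0 < b"
  shows "norm (step_L2 a b x) \<le> sqrt (\<bar>b - a\<bar> / min a b) * norm x"
proof -
  define p q where "p = min a b" and "q = max a b"
  have pq: "0 < p" "p \<le> q" "q - p = \<bar>b - a\<bar>"
    using assms by (auto simp: p_def q_def)
  have "(norm ((indicator {0<..b} r - indicator {0<..a} r) *\<^sub>R x))\<^sup>2 = indicat_real {p<..q} r * (norm x)\<^sup>2" for r
    unfolding step_fun_cases[OF assms] by (auto simp: p_def q_def indicator_def)
  moreover have "{p<..q} \<inter> space haar = {p<..q}"
    using pq(1) by auto
  ultimately have "norm (step_L2 a b x) = sqrt (measure haar {p<..q} * (norm x)\<^sup>2)"
    unfolding step_L2_def norm_to_L2[OF square_integrable_step[OF assms]]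
    by (simp del: space_haar)
  also have "\<dots> = sqrt (measure haar {p<..q}) * norm x"
    by (simp add: real_sqrt_mult)
  also have "\<dots> \<le> sqrt ((q - p) / p) * norm x"
    unfolding measure_def using emeasure_haar_Ioc[OF pq(1,2)] pq
    by (intro mult_right_mono real_sqrt_le_mono enn2real_leI) auto
  finally show ?thesis
    unfolding pq(3) by (simp add: p_def)
qed

lemma tendsto_step_L2:
  assumes f: "(f \<longlongrightarrow> a) F" "\<forall>\<^sub>F s in F. 0 < f s" and g: "(g \<longlongrightarrow> b) F" "\<forall>\<^sub>F s in F. 0 < g s"
    and ab: "0 < a" "0 < b"
  shows "((\<lambda>s. step_L2 (f s) (g s) x) \<longlongrightarrow> step_L2 a b x) F"
proof -
  \<comment> \<open>One moving end point is enough: by \<open>step_L2_add\<close> the general vector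
    is \<open>step_L2 a b x\<close> corrected by two short steps, one at a and one at b.\<close>
  have *: "((\<lambda>s. step_L2 a (f s) x) \<longlongrightarrow> 0) F"
    if "(f \<longlongrightarrow> a) F" "\<forall>\<^sub>F s in F. 0 < f s" "0 < a" for f a
  proof (rule Lim_null_comparison)
    show "\<forall>\<^sub>F s in F. norm (step_L2 a (f s) x) \<le> sqrt (\<bar>f s - a\<bar> / min a (f s)) * norm x"
      using that(2) by eventually_elim (rule norm_step_L2[OF that(3)])
    have "((\<lambda>s. sqrt (\<bar>f s - a\<bar> / min a (f s)) * norm x) \<longlongrightarrow> sqrt (\<bar>a - a\<bar> / min a a) * norm x) F"
      using that by (intro tendsto_intros) auto
    then show "((\<lambda>s. sqrt (\<bar>f s - a\<bar> / min a (f s)) * norm x) \<longlongrightarrow> 0) F"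
      by simp
  qed
  have "((\<lambda>s. step_L2 a b x - step_L2 a (f s) x + step_L2 b (g s) x) \<longlongrightarrow> step_L2 a b x - 0 + 0) F"
    by (intro tendsto_intros * f g ab)
  moreover have "\<forall>\<^sub>F s in F. step_L2 a b x - step_L2 a (f s) x + step_L2 b (g s) x = step_L2 (f s) (g s) x"
    using f(2) g(2)
  proof eventually_elim
    case (elim s)
    show ?case
      using step_L2_add[OF ab elim(2), of x] step_L2_add[OF ab(1) elim, of x]
      by (simp add: algebra_simps)
  qed
  ultimately show ?thesis
    using Lim_transform_eventually by fastforce
qed

section \<open>The extended representation\<close>

definition semidirect_representation ::
  "('g \<Rightarrow> 'k \<Rightarrow> 'k) \<Rightarrow> (real \<Rightarrow> 'g \<Rightarrow> 'g) \<Rightarrow> real \<times> 'g \<Rightarrow> 'k::banach L2 \<Rightarrow> 'k L2" where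
  "semidirect_representation T act x F = to_L2 (semidirect_op T act x (rep_L2 F))"

lemma fibre_representation_eq:
  "fibre_representation T act g = semidirect_representation T act (1, g)"
  by (simp add: fun_eq_iff fibre_representation_def semidirect_representation_def semidirect_op_def dilation_def)

locale real_action_representation =
  fixes G0 :: "('g, 'm) monoid_scheme" and X :: "'g topology" and act :: "real \<Rightarrow> 'g \<Rightarrow> 'g"
    and T :: "'g \<Rightarrow> 'k::complex_hilbert \<Rightarrow> 'k"
  assumes lcg: "locally_compact_group G0 X"
    and action: "positive_real_action G0 X act"
    and rep: "unitary_representation G0 X T"
begin

section \<open>Elementary rules for the action and the unitary operators\<close>

lemma group_G0: "group G0"
  using lcg by (simp add: locally_compact_group_def)

sublocale G0: group G0
  by (rule group_G0)

lemma topspace_X: "topspace X = carrier G0"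
  using lcg by (simp add: locally_compact_group_def)

lemma act_closed: "r > 0 \<Longrightarrow> g \<in> carrier G0 \<Longrightarrow> act r g \<in> carrier G0"
  using action by (auto simp: positive_real_action_def iso_def hom_def)

lemma act_mult: "r > 0 \<Longrightarrow> g \<in> carrier G0 \<Longrightarrow> h \<in> carrier G0 \<Longrightarrow>
    act r (g \<otimes>\<^bsub>G0\<^esub> h) = act r g \<otimes>\<^bsub>G0\<^esub> act r h"
  using action by (auto simp: positive_real_action_def iso_def hom_def)

lemma act_act: "r > 0 \<Longrightarrow> s > 0 \<Longrightarrow> g \<in> carrier G0 \<Longrightarrow> act s (act r g) = act (r * s) g"
  using action by (auto simp: positive_real_action_def)

text \<open>The action law makes \<open>act 1\<close> idempotent, and an injective idempotent map is
  the identity.\<close>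

lemma act_1: "g \<in> carrier G0 \<Longrightarrow> act 1 g = g"
proof -
  assume g: "g \<in> carrier G0"
  have "inj_on (act 1) (carrier G0)"
    using action by (auto simp: positive_real_action_def iso_def bij_betw_def)
  moreover have "act 1 (act 1 g) = act 1 g"
    using act_act[of 1 1 g] g by simp
  ultimately show ?thesis
    using g act_closed[of 1 g] by (auto dest: inj_onD)
qed

lemma act_one: "r > 0 \<Longrightarrow> act r \<one>\<^bsub>G0\<^esub> = \<one>\<^bsub>G0\<^esub>"
  using act_mult[of r "\<one>\<^bsub>G0\<^esub>" "\<one>\<^bsub>G0\<^esub>"] act_closed[of r "\<one>\<^bsub>G0\<^esub>"] by (simp add: G0.l_cancel_one')

lemma continuous_act: "continuous_map (prod_topology (top_of_set {0<..}) X) X (\<lambda>(r, g). act r g)"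
  using action by (simp add: positive_real_action_def)

lemma T_unitary: "g \<in> carrier G0 \<Longrightarrow> unitary_op (T g)"
  using rep by (simp add: unitary_representation_def)

lemma T_add: "g \<in> carrier G0 \<Longrightarrow> T g (x + y) = T g x + T g y"
  and T_scaleC: "g \<in> carrier G0 \<Longrightarrow> T g (scaleC c x) = scaleC c (T g x)"
  and T_cinner: "g \<in> carrier G0 \<Longrightarrow> cinner (T g x) (T g y) = cinner x y"
  using T_unitary by (simp_all add: unitary_op_def)

lemma T_scaleR: "g \<in> carrier G0 \<Longrightarrow> T g (a *\<^sub>R x) = a *\<^sub>R T g x"
  by (simp add: scaleR_eq_scaleC T_scaleC)

lemma T_diff: "g \<in> carrier G0 \<Longrightarrow> T g (x - y) = T g x - T g y"
  using T_add[of g "x - y" y] by (simp add: algebra_simps)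

lemma T_norm: "g \<in> carrier G0 \<Longrightarrow> norm (T g x) = norm x"
proof -
  assume g: "g \<in> carrier G0"
  have "complex_of_real ((norm (T g x))\<^sup>2) = complex_of_real ((norm x)\<^sup>2)"
    unfolding cinner_self[symmetric] by (rule T_cinner[OF g])
  then show ?thesis
    by (simp only: of_real_eq_iff) simp
qed

lemma T_mult: "g \<in> carrier G0 \<Longrightarrow> h \<in> carrier G0 \<Longrightarrow> T (g \<otimes>\<^bsub>G0\<^esub> h) x = T g (T h x)"
  using rep by (simp add: unitary_representation_def)

text \<open>The operator at the unit is idempotent, and a surjective idempotent map is the
  identity.\<close>

lemma T_one: "T \<one>\<^bsub>G0\<^esub> x = x"
proof -
  have "surj (T \<one>\<^bsub>G0\<^esub>)"
    using T_unitary[of "\<one>\<^bsub>G0\<^esub>"] by (simp add: unitary_op_def)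
  then obtain y where "x = T \<one>\<^bsub>G0\<^esub> y"
    by (auto elim: surjE)
  then show ?thesis
    using T_mult[of "\<one>\<^bsub>G0\<^esub>" "\<one>\<^bsub>G0\<^esub>" y] by simp
qed

section \<open>Joint continuity of the orbit maps\<close>

lemma continuous_orbit:
  "continuous_map (prod_topology (top_of_set {0<..}) X) euclidean (\<lambda>(r, g). T (act r g) x)"
proof -
  have "continuous_map X euclidean (\<lambda>g. T g x)"
    using rep by (simp add: unitary_representation_def)
  from continuous_map_compose[OF continuous_act this] show ?thesis
    by (simp add: comp_def case_prod_unfold)
qed

lemma continuous_orbit_dilation:
  assumes "g \<in> carrier G0" shows "continuous_on {0<..} (\<lambda>r. T (act r g) x)"
proof -
  have "continuous_map (top_of_set {0<..}) (prod_topology (top_of_set {0<..}) X) (\<lambda>r::real. (r, g))"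
    using assms by (intro continuous_map_pairedI) (auto simp: topspace_X)
  from continuous_map_compose[OF this continuous_orbit[of x]] show ?thesis
    by (simp add: comp_def)
qed

text \<open>The value at a nearby vector y is split as T (act r g) x plus T (act r g) (y - x). The
  first term is continuous in r for fixed x; the second has norm |y - x| because the operators are
  isometric.\<close>

lemma continuous_orbit_joint:
  assumes g: "g \<in> carrier G0" shows "continuous_on ({0<..} \<times> UNIV) (\<lambda>(r, x). T (act r g) x)"
proof -
  have "((\<lambda>p. T (act (fst p) g) (snd p)) \<longlongrightarrow> T (act r g) x) (at (r, x) within {0<..} \<times> UNIV)"
    if r: "r > 0" for r x
  proof -
    let ?F = "at (r, x) within ({0<..} \<times> UNIV)"
    have snd: "(snd \<longlongrightarrow> x) ?F" and fst: "(fst \<longlongrightarrow> r) ?F"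
      using tendsto_fst[OF tendsto_ident_at, of "(r, x)" "{0<..} \<times> UNIV"]
        tendsto_snd[OF tendsto_ident_at, of "(r, x)" "{0<..} \<times> UNIV"] by simp_all
    have ev: "\<forall>\<^sub>F p in ?F. p \<in> {0<..} \<times> UNIV"
      by (simp add: eventually_at_filter)
    have 1: "((\<lambda>p. T (act (fst p) g) x) \<longlongrightarrow> T (act r g) x) ?F"
      using ev by (intro continuous_on_tendsto_compose[OF continuous_orbit_dilation[OF g] fst])
        (auto simp: r elim: eventually_mono)
    have "((\<lambda>p. norm (snd p - x)) \<longlongrightarrow> norm (x - x)) ?F"
      by (intro tendsto_intros snd)
    then have "((\<lambda>p. norm (snd p - x)) \<longlongrightarrow> 0) ?F"
      by simp
    moreover have "\<forall>\<^sub>F p in ?F. norm (T (act (fst p) g) (snd p - x)) \<le> norm (snd p - x)"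
      using ev by eventually_elim (auto simp: T_norm act_closed g)
    ultimately have 2: "((\<lambda>p. T (act (fst p) g) (snd p - x)) \<longlongrightarrow> 0) ?F"
      by (rule Lim_null_comparison[rotated])
    have "\<forall>\<^sub>F p in ?F. T (act (fst p) g) x + T (act (fst p) g) (snd p - x) = T (act (fst p) g) (snd p)"
      using ev by eventually_elim (auto simp: T_diff act_closed g)
    then show ?thesis
      using tendsto_add[OF 1 2] by (auto elim: Lim_transform_eventually[rotated])
  qed
  then show ?thesis
    by (auto simp: continuous_on_def case_prod_unfold)
qed

section \<open>The operators of the semidirect product on functions and on their classes\<close>

abbreviation "G \<equiv> semidirect G0 act"
abbreviation "S \<equiv> semidirect_representation T act"
abbreviation "\<Phi> \<equiv> semidirect_op T act"

lemma carrier_G: "carrier G = {0<..} \<times> carrier G0"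
  by (simp add: semidirect_def)

lemma mult_G: "(r, g) \<otimes>\<^bsub>G\<^esub> (s, h) = (r * s, act (inverse s) g \<otimes>\<^bsub>G0\<^esub> h)"
  by (simp add: semidirect_def)

lemma op_apply: "\<Phi> (s, g) f r = T (act (r * s) g) (f (r * s))"
  by (simp add: semidirect_op_def dilation_def fibre_op_def)

lemma strongly_measurable_op:
  assumes "s > 0" "g \<in> carrier G0" "strongly_measurable haar f"
  shows "strongly_measurable haar (\<Phi> (s, g) f)"
proof -
  have "strongly_measurable haar (\<lambda>r. T (act r g) (f r))"
    using strongly_measurable_haar_continuous2[OF assms(3) continuous_orbit_joint[OF assms(2)]] by simp
  from strongly_measurable_compose[OF this measurable_dilation[OF assms(1)]] show ?thesis
    unfolding op_apply .
qed

lemma square_integrable_op: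
  assumes x: "x \<in> carrier G" and f: "square_integrable haar f"
  shows "square_integrable haar (\<Phi> x f)"
proof -
  obtain s g where x: "x = (s, g)" "s > 0" "g \<in> carrier G0"
    using x by (auto simp: carrier_G)
  have "strongly_measurable haar (\<Phi> (s, g) f)"
    using f x by (intro strongly_measurable_op) (auto simp: square_integrable_def)
  moreover have "integrable haar (\<lambda>r. (norm (f (r * s)))\<^sup>2)"
    using f x integrable_dilation[of s "\<lambda>r. (norm (f r))\<^sup>2"] by (auto simp: square_integrable_def)
  ultimately show ?thesis
    unfolding x(1) by (rule square_integrableI) (simp add: op_apply T_norm act_closed x)
qed

text \<open>Two representatives differ on a null set, and dilations preserve null sets; so the
  choice made by \<open>rep_L2\<close> does not affect the result.\<close>

lemma representation_to_L2:
  assumes x: "x \<in> carrier G" and f: "square_integrable haar f"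
  shows "S x (to_L2 f) = to_L2 (\<Phi> x f)"
proof -
  obtain s g where x': "x = (s, g)" "s > 0" "g \<in> carrier G0"
    using x by (auto simp: carrier_G)
  have "AE r in haar. rep_L2 (to_L2 f) (r * s) = f (r * s)"
    using x'(2) AE_rep_L2_to_L2[OF f] by (rule AE_dilation)
  then show ?thesis
    unfolding semidirect_representation_def
    by (subst to_L2_eq_iff[OF square_integrable_op[OF x square_integrable_rep_L2] square_integrable_op[OF x f]])
      (auto simp: x' op_apply)
qed

lemma op_mult:
  assumes "x \<in> carrier G" "y \<in> carrier G" "r > 0"
  shows "\<Phi> (x \<otimes>\<^bsub>G\<^esub> y) f r = \<Phi> x (\<Phi> y f) r"
proof -
  obtain s g t h where xy: "x = (s, g)" "s > 0" "g \<in> carrier G0" "y = (t, h)" "t > 0" "h \<in> carrier G0"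
    using assms by (auto simp: carrier_G)
  have "\<Phi> (x \<otimes>\<^bsub>G\<^esub> y) f r = T (act (r * (s * t)) (act (inverse t) g \<otimes>\<^bsub>G0\<^esub> h)) (f (r * (s * t)))"
    by (simp add: xy mult_G op_apply)
  also have "act (r * (s * t)) (act (inverse t) g \<otimes>\<^bsub>G0\<^esub> h) = act (r * s) g \<otimes>\<^bsub>G0\<^esub> act (r * s * t) h"
  proof -
    \<comment> \<open>The twist \<open>inverse t\<close> in the multiplication of G cancels the
      factor t contributed by the dilation by s t.\<close>
    have "inverse t * (r * (s * t)) = r * s"
      using xy by simp
    then have "act (inverse t * (r * (s * t))) g = act (r * s) g"
      by (rule arg_cong)
    then show ?thesis
      using xy assms(3) by (simp add: act_mult act_closed act_act mult.assoc)
  qed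
  also have "T \<dots> (f (r * (s * t))) = \<Phi> x (\<Phi> y f) r"
    using xy assms(3) by (simp add: T_mult act_closed op_apply mult.assoc)
  finally show ?thesis .
qed

lemma mult_G_closed:
  assumes "x \<in> carrier G" "y \<in> carrier G" shows "x \<otimes>\<^bsub>G\<^esub> y \<in> carrier G"
  using assms by (auto simp: carrier_G mult_G act_closed)

lemma representation_mult:
  assumes x: "x \<in> carrier G" and y: "y \<in> carrier G"
  shows "S (x \<otimes>\<^bsub>G\<^esub> y) F = S x (S y F)"
proof -
  obtain f where f: "square_integrable haar f" "F = to_L2 f"
    using ex_to_L2 by blast
  have "S (x \<otimes>\<^bsub>G\<^esub> y) F = to_L2 (\<Phi> (x \<otimes>\<^bsub>G\<^esub> y) f)"
    by (simp add: f representation_to_L2 mult_G_closed x y)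
  also have "\<dots> = to_L2 (\<Phi> x (\<Phi> y f))"
    by (rule to_L2_cong) (auto simp: square_integrable_op mult_G_closed x y f op_mult)
  also have "\<dots> = S x (S y F)"
    by (simp add: f representation_to_L2 square_integrable_op x y)
  finally show ?thesis .
qed

lemma representation_dilation:
  assumes s: "s > 0" and f: "square_integrable haar f"
  shows "square_integrable haar (dilation s f)" "S (s, \<one>\<^bsub>G0\<^esub>) (to_L2 f) = to_L2 (dilation s f)"
proof -
  have x: "(s, \<one>\<^bsub>G0\<^esub>) \<in> carrier G"
    using s by (simp add: carrier_G)
  have eq: "\<Phi> (s, \<one>\<^bsub>G0\<^esub>) f r = dilation s f r" if "r > 0" for r
    using that s by (simp add: op_apply dilation_def act_one T_one)
  show "square_integrable haar (dilation s f)"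
    using square_integrable_op[OF x f] square_integrable_cong[of haar "\<Phi> (s, \<one>\<^bsub>G0\<^esub>) f" "dilation s f"] eq
    by simp
  show "S (s, \<one>\<^bsub>G0\<^esub>) (to_L2 f) = to_L2 (dilation s f)"
    unfolding representation_to_L2[OF x f] by (rule to_L2_cong[OF square_integrable_op[OF x f] eq])
qed

lemma representation_one: "S (1, \<one>\<^bsub>G0\<^esub>) F = F"
proof -
  obtain f where "square_integrable haar f" "F = to_L2 f"
    using ex_to_L2 by blast
  then show ?thesis
    using representation_dilation(2)[of 1 f] by (simp add: dilation_def)
qed

text \<open>Solving (s, g) (t, k) = (s t, g^(1/t) k) = (1, e) gives t = 1/s and k as the inverse of
  g^s. The right inverse yields surjectivity of the operators.\<close>

lemma right_inverse_G:
  assumes "x \<in> carrier G" obtains y where "y \<in> carrier G" "x \<otimes>\<^bsub>G\<^esub> y = (1, \<one>\<^bsub>G0\<^esub>)"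
proof -
  obtain s g where x: "x = (s, g)" "s > 0" "g \<in> carrier G0"
    using assms by (auto simp: carrier_G)
  show ?thesis
    by (rule that[of "(inverse s, inv\<^bsub>G0\<^esub> (act s g))"]) (use x in \<open>simp_all add: carrier_G mult_G act_closed\<close>)
qed

lemma representation_add: "x \<in> carrier G \<Longrightarrow> S x (F1 + F2) = S x F1 + S x F2"
proof -
  assume x: "x \<in> carrier G"
  obtain f1 f2 where f: "square_integrable haar f1" "F1 = to_L2 f1" "square_integrable haar f2" "F2 = to_L2 f2"
    using ex_to_L2 by metis
  obtain s g where x': "x = (s, g)" "s > 0" "g \<in> carrier G0"
    using x by (auto simp: carrier_G)
  have "S x (F1 + F2) = to_L2 (\<Phi> x (\<lambda>r. f1 r + f2 r))"
    by (simp add: f to_L2_add representation_to_L2 x square_integrable_add)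
  also have "\<dots> = to_L2 (\<lambda>r. \<Phi> x f1 r + \<Phi> x f2 r)"
    by (rule to_L2_cong) (simp_all add: square_integrable_op square_integrable_add f x, simp add: x' op_apply T_add act_closed)
  also have "\<dots> = S x F1 + S x F2"
    by (simp add: f to_L2_add representation_to_L2 x square_integrable_op)
  finally show ?thesis .
qed

lemma representation_scaleC: "x \<in> carrier G \<Longrightarrow> S x (scaleC c F) = scaleC c (S x F)"
proof -
  assume x: "x \<in> carrier G"
  obtain f where f: "square_integrable haar f" "F = to_L2 f"
    using ex_to_L2 by metis
  obtain s g where x': "x = (s, g)" "s > 0" "g \<in> carrier G0"
    using x by (auto simp: carrier_G)
  have "S x (scaleC c F) = to_L2 (\<Phi> x (\<lambda>r. scaleC c (f r)))"
    by (simp add: f scaleC_L2.abs_eq L2_rel_refl representation_to_L2 x square_integrable_scaleC)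
  also have "\<dots> = to_L2 (\<lambda>r. scaleC c (\<Phi> x f r))"
    by (rule to_L2_cong) (simp_all add: square_integrable_op square_integrable_scaleC f x, simp add: x' op_apply T_scaleC act_closed)
  also have "\<dots> = scaleC c (S x F)"
    by (simp add: f scaleC_L2.abs_eq L2_rel_refl representation_to_L2 x square_integrable_op)
  finally show ?thesis .
qed

lemma representation_cinner: "x \<in> carrier G \<Longrightarrow> cinner (S x F1) (S x F2) = cinner F1 F2"
proof -
  assume x: "x \<in> carrier G"
  obtain f1 f2 where f: "square_integrable haar f1" "F1 = to_L2 f1" "square_integrable haar f2" "F2 = to_L2 f2"
    using ex_to_L2 by metis
  obtain s g where x': "x = (s, g)" "s > 0" "g \<in> carrier G0"
    using x by (auto simp: carrier_G)
  have "cinner (S x F1) (S x F2) = (\<integral>r. cinner (\<Phi> x f1 r) (\<Phi> x f2 r) \<partial>haar)"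
    by (simp add: f representation_to_L2 x cinner_L2.abs_eq L2_rel_refl square_integrable_op)
  also have "\<dots> = (\<integral>r. cinner (f1 (r * s)) (f2 (r * s)) \<partial>haar)"
    by (rule Bochner_Integration.integral_cong) (simp_all add: x' op_apply T_cinner act_closed)
  also have "\<dots> = (\<integral>r. cinner (f1 r) (f2 r) \<partial>haar)"
    using f x'(2) by (intro integral_dilation borel_measurable_cinner) (auto simp: square_integrable_def)
  also have "\<dots> = cinner F1 F2"
    by (simp add: f cinner_L2.abs_eq L2_rel_refl)
  finally show ?thesis .
qed

lemma representation_unitary:
  assumes x: "x \<in> carrier G" shows "unitary_op (S x)"
  unfolding unitary_op_def
proof (intro conjI allI)
  obtain y where y: "y \<in> carrier G" "x \<otimes>\<^bsub>G\<^esub> y = (1, \<one>\<^bsub>G0\<^esub>)"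
    using right_inverse_G[OF x] .
  show "surj (S x)"
    using representation_mult[OF x y(1)] by (intro surjI[where f = "S y"]) (simp add: y(2) representation_one)
qed (simp_all add: x representation_add representation_scaleC representation_cinner)

lemma representation_diff: "x \<in> carrier G \<Longrightarrow> S x (F1 - F2) = S x F1 - S x F2"
  using representation_add[of x "F1 - F2" F2] by (simp add: algebra_simps)

lemma representation_norm: "x \<in> carrier G \<Longrightarrow> norm (S x F) = norm F"
proof -
  assume x: "x \<in> carrier G"
  have "complex_of_real ((norm (S x F))\<^sup>2) = complex_of_real ((norm F)\<^sup>2)"
    unfolding cinner_self[symmetric] by (rule representation_cinner[OF x])
  then show ?thesis
    by (simp only: of_real_eq_iff) simp
qed

lemma representation_dist: "x \<in> carrier G \<Longrightarrow> dist (S x F1) (S x F2) = dist F1 F2"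
  by (simp add: dist_norm representation_norm flip: representation_diff)

end

section \<open>Strong continuity of the extended representation\<close>

context real_action_representation
begin

text \<open>For an interval function the squared distance of two orbit points is an integral over
  \<open>{a<..b}\<close>. So T (act r k) x has to be close to T (act r g) x uniformly for r in a
  compact interval, which joint continuity and the tube lemma provide.\<close>

lemma continuous_fibre_representation: "continuous_map X euclidean (\<lambda>g. S (1, g) F)"
proof (induction F rule: L2_induct)
  case (interval a b x)
  define f where "f = (\<lambda>r. indicat_real {a<..b} r *\<^sub>R x)"
  define \<mu> where "\<mu> = measure haar {a<..b}"
  have f: "square_integrable haar f"
    unfolding f_def using interval by (intro square_integrable_indicator[of _ a b]) auto
  have S: "S (1, g) (to_L2 f) = to_L2 (\<Phi> (1, g) f)" "square_integrable haar (\<Phi> (1, g) f)"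
    if "g \<in> carrier G0" for g
    using that f by (auto intro!: representation_to_L2 square_integrable_op simp: carrier_G)
  show ?case
    unfolding continuous_map_metric_iff f_def[symmetric]
  proof (intro ballI allI impI)
    fix g and e :: real assume "g \<in> topspace X" and e: "e > 0"
    then have g: "g \<in> carrier G0"
      by (simp add: topspace_X)
    \<comment> \<open>Adding 1 keeps the denominator positive when \<mu> = 0 and makes d^2 \<mu>
      strictly smaller than e^2.\<close>
    define d where "d = e / sqrt (\<mu> + 1)"
    have \<mu>: "\<mu> \<ge> 0"
      by (simp add: \<mu>_def)
    have d: "d > 0" "d\<^sup>2 * \<mu> < e\<^sup>2"
      using e \<mu> by (auto simp: d_def power_divide field_simps intro!: mult_strict_left_mono)
    \<comment> \<open>The pairs (r, k) at which the orbits of k and g differ by less than d. This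
      open set contains \<open>{a..b} \<times> {g}\<close>, hence a product neighbourhood of
      it.\<close>
    define W where "W = {p \<in> topspace (prod_topology (top_of_set {0<..}) X).
        (\<lambda>(r, k). T (act r k) x - T (act r g) x) p \<in> ball 0 d}"
    have "continuous_map (prod_topology (top_of_set {0<..}) X) (top_of_set {0<..}) fst"
      by (rule continuous_map_fst)
    from continuous_map_compose[OF this, of euclidean "\<lambda>r. T (act r g) x"] continuous_orbit_dilation[OF g, of x]
    have "continuous_map (prod_topology (top_of_set {0<..}) X) euclidean (\<lambda>(r, k). T (act r g) x)"
      by (simp add: comp_def case_prod_unfold)
    from continuous_map_diff[OF continuous_orbit[of x] this]
    have "continuous_map (prod_topology (top_of_set {0<..}) X) euclidean (\<lambda>(r, k). T (act r k) x - T (act r g) x)"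
      by (simp add: case_prod_unfold)
    then have "openin (prod_topology (top_of_set {0<..}) X) W"
      unfolding W_def by (rule openin_continuous_map_preimage) (simp flip: open_openin)
    moreover have "compactin (top_of_set {0<..}) {a..b}"
      using interval by (auto simp: compactin_subtopology)
    moreover have "{a..b} \<times> {g} \<subseteq> W"
      using interval g d(1) by (auto simp: W_def topspace_X)
    ultimately obtain U V where UV: "openin X V" "{a..b} \<subseteq> U" "g \<in> V" "U \<times> V \<subseteq> W"
      using tube_lemma_left[of "top_of_set {0<..}" X W "{a..b}" g] \<open>g \<in> topspace X\<close> by blast
    have "dist (S (1, k) (to_L2 f)) (S (1, g) (to_L2 f)) < e" if k: "k \<in> V" for k
    proof -
      have k': "k \<in> carrier G0"
        using openin_subset[OF UV(1)] k by (auto simp: topspace_X)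
      have le: "(norm (\<Phi> (1, k) f r - \<Phi> (1, g) f r))\<^sup>2 \<le> d\<^sup>2 * indicat_real {a<..b} r" if "r > 0" for r
      proof (cases "r \<in> {a<..b}")
        case True
        have "(r, k) \<in> W"
          using subsetD[OF UV(4), of "(r, k)"] subsetD[OF UV(2), of r] k True by simp
        then have "norm (T (act r k) x - T (act r g) x) \<le> d"
          by (simp add: W_def dist_norm norm_minus_commute)
        then show ?thesis
          using True by (simp add: op_apply f_def power_mono)
      next
        case False
        then show ?thesis
          using T_scaleR[OF act_closed[OF that k'], of 0 0] T_scaleR[OF act_closed[OF that g], of 0 0]
          by (simp add: op_apply f_def)
      qed
      have "(dist (S (1, k) (to_L2 f)) (S (1, g) (to_L2 f)))\<^sup>2 = (\<integral>r. (norm (\<Phi> (1, k) f r - \<Phi> (1, g) f r))\<^sup>2 \<partial>haar)"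
        by (simp add: dist_norm S k' g norm_to_L2_diff)
      also have "\<dots> \<le> (\<integral>r. d\<^sup>2 * indicat_real {a<..b} r \<partial>haar)"
        using le integrable_indicator_haar[of "{a<..b}" a b] interval by (intro integral_mono') auto
      also have "\<dots> = d\<^sup>2 * \<mu>"
      proof -
        have "{a<..b} \<inter> space haar = {a<..b}"
          using interval by auto
        then show ?thesis
          by (simp add: \<mu>_def del: space_haar)
      qed
      also have "\<dots> < e\<^sup>2"
        by (rule d)
      finally show ?thesis
        by (rule power2_less_imp_less) (use e in simp)
    qed
    then show "\<exists>U. openin X U \<and> g \<in> U \<and> (\<forall>y\<in>U. dist (S (1, y) (to_L2 f)) (S (1, g) (to_L2 f)) < e)"
      using UV by blast
  qed
next
  case (add F1 F2)
  have "continuous_map X euclidean (\<lambda>g. S (1, g) F1 + S (1, g) F2)"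
    using add by (rule continuous_map_add)
  then show ?case
    by (rule continuous_map_eq) (simp add: representation_add carrier_G topspace_X)
next
  case (limit Fs F)
  then show ?case
    by (rule continuous_map_contraction_limit) (simp add: representation_dist carrier_G topspace_X)
qed

text \<open>Continuity in the dilation parameter thereby becomes continuity of step vectors in their
  end points.\<close>

lemma representation_step:
  assumes "s > 0" "a > 0" "b > 0"
  shows "S (s, \<one>\<^bsub>G0\<^esub>) (step_L2 a b x) = step_L2 (a / s) (b / s) x"
  unfolding step_L2_def representation_dilation(2)[OF assms(1) square_integrable_step[OF assms(2,3)]]
  using assms by (intro arg_cong[where f = to_L2])
    (auto simp: fun_eq_iff dilation_def indicator_def field_simps zero_less_mult_iff)

lemma continuous_dilation_representation: "continuous_on {0<..} (\<lambda>s. S (s, \<one>\<^bsub>G0\<^esub>) F)"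
  unfolding continuous_map_iff_continuous[symmetric]
proof (induction F rule: L2_induct)
  case (interval a b x)
  have "continuous_on {0<..} (\<lambda>s. step_L2 (a / s) (b / s) x)"
    unfolding continuous_on_def
  proof
    fix s :: real assume s: "s \<in> {0<..}"
    have ev: "\<forall>\<^sub>F t in at s within {0<..}. 0 < t"
      by (simp add: eventually_at_filter)
    show "((\<lambda>s. step_L2 (a / s) (b / s) x) \<longlongrightarrow> step_L2 (a / s) (b / s) x) (at s within {0<..})"
      using s interval
      by (intro tendsto_step_L2 tendsto_intros eventually_mono[OF ev]) auto
  qed
  then have "continuous_map (top_of_set {0<..}) euclidean (\<lambda>s. step_L2 (a / s) (b / s) x)"
    by simp
  then show ?case
    by (rule continuous_map_eq)
      (use interval in \<open>simp add: representation_step flip: step_L2_eq_indicator\<close>)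
next
  case (add F1 F2)
  have "continuous_map (top_of_set {0<..}) euclidean (\<lambda>s. S (s, \<one>\<^bsub>G0\<^esub>) F1 + S (s, \<one>\<^bsub>G0\<^esub>) F2)"
    using add by (rule continuous_map_add)
  then show ?case
    by (rule continuous_map_eq) (simp add: representation_add carrier_G)
next
  case (limit Fs F)
  then show ?case
    by (rule continuous_map_contraction_limit) (simp add: representation_dist carrier_G)
qed

lemma topspace_G: "topspace (semidirect_topology X) = carrier G"
  by (simp add: semidirect_topology_def carrier_G topspace_X)

text \<open>Continuity in each variable suffices because dilations are isometric: the difference
  S(t) b(k) - S(s) b(g) splits into a term of norm |b(k) - b(g)| and an orbit increment of the fixed
  vector b(g). This serves both the representation and its cocycle.\<close>

lemma continuous_dilation_comp:
  assumes b: "continuous_map X euclidean b"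
  shows "continuous_map (semidirect_topology X) euclidean (\<lambda>(s, g). S (s, \<one>\<^bsub>G0\<^esub>) (b g))"
  unfolding continuous_map_metric_iff
proof (intro ballI allI impI)
  fix p and e :: real assume "p \<in> topspace (semidirect_topology X)" and e: "e > 0"
  then obtain s g where p: "p = (s, g)" "s > 0" "g \<in> topspace X"
    by (auto simp: semidirect_topology_def)
  obtain V where V: "openin X V" "g \<in> V" "\<forall>k\<in>V. dist (b k) (b g) < e / 2"
    using b p(3) e unfolding continuous_map_metric_iff by (metis half_gt_zero)
  have "continuous_map (top_of_set {0<..}) euclidean (\<lambda>s. S (s, \<one>\<^bsub>G0\<^esub>) (b g))"
    using continuous_dilation_representation by simp
  then obtain A where A: "openin (top_of_set {0<..}) A" "s \<in> A"
    "\<forall>t\<in>A. dist (S (t, \<one>\<^bsub>G0\<^esub>) (b g)) (S (s, \<one>\<^bsub>G0\<^esub>) (b g)) < e / 2"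
    using p(2) e unfolding continuous_map_metric_iff topspace_euclidean_subtopology
    by (metis half_gt_zero greaterThan_iff)
  have "dist (S (t, \<one>\<^bsub>G0\<^esub>) (b k)) (S (s, \<one>\<^bsub>G0\<^esub>) (b g)) < e" if "t \<in> A" "k \<in> V" for t k
  proof -
    have "t > 0"
      using openin_subset[OF A(1)] that(1) by auto
    then have "dist (S (t, \<one>\<^bsub>G0\<^esub>) (b k)) (S (t, \<one>\<^bsub>G0\<^esub>) (b g)) = dist (b k) (b g)"
      by (intro representation_dist) (simp add: carrier_G)
    moreover have "dist (b k) (b g) < e / 2"
      using V that by blast
    moreover have "dist (S (t, \<one>\<^bsub>G0\<^esub>) (b g)) (S (s, \<one>\<^bsub>G0\<^esub>) (b g)) < e / 2"
      using A that by blast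
    ultimately show ?thesis
      using dist_triangle[of "S (t, \<one>\<^bsub>G0\<^esub>) (b k)" "S (s, \<one>\<^bsub>G0\<^esub>) (b g)" "S (t, \<one>\<^bsub>G0\<^esub>) (b g)"] by linarith
  qed
  then show "\<exists>U. openin (semidirect_topology X) U \<and> p \<in> U \<and>
      (\<forall>y\<in>U. dist ((\<lambda>(s, g). S (s, \<one>\<^bsub>G0\<^esub>) (b g)) y) ((\<lambda>(s, g). S (s, \<one>\<^bsub>G0\<^esub>) (b g)) p) < e)"
    using A V by (intro exI[of _ "A \<times> V"])
      (auto simp: p(1) semidirect_topology_def openin_prod_Times_iff)
qed

lemma representation_decompose:
  assumes "s > 0" "g \<in> carrier G0"
  shows "S (s, g) F = S (s, \<one>\<^bsub>G0\<^esub>) (S (1, g) F)"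
proof -
  have "(s, \<one>\<^bsub>G0\<^esub>) \<otimes>\<^bsub>G\<^esub> (1, g) = (s, g)"
    using assms by (simp add: mult_G act_1)
  then show ?thesis
    using representation_mult[of "(s, \<one>\<^bsub>G0\<^esub>)" "(1, g)" F] assms by (simp add: carrier_G)
qed

lemma unitary_representation_semidirect:
  "unitary_representation G (semidirect_topology X) S"
  unfolding unitary_representation_def
proof (intro conjI ballI allI)
  show "continuous_map (semidirect_topology X) euclidean (\<lambda>x. S x F)" for F
    by (rule continuous_map_eq[OF continuous_dilation_comp[OF continuous_fibre_representation[of F]]])
      (clarsimp simp: topspace_G carrier_G, rule representation_decompose[symmetric])
qed (auto simp: representation_unitary representation_mult fun_eq_iff)

lemma mult_embedded:
  assumes "g \<in> carrier G0" "h \<in> carrier G0"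
  shows "(1, g \<otimes>\<^bsub>G0\<^esub> h) = (1, g) \<otimes>\<^bsub>G\<^esub> (1, h)"
  using assms by (simp add: mult_G act_1)

lemma unitary_representation_fibre:
  "unitary_representation G0 X (fibre_representation T act)"
  unfolding unitary_representation_def fibre_representation_eq
  by (auto simp: representation_unitary carrier_G continuous_fibre_representation mult_embedded
      representation_mult fun_eq_iff)

lemma given_by_fibre:
  "g \<in> carrier G0 \<Longrightarrow> given_by (fibre_representation T act g) (fibre_op T act g)"
  unfolding given_by_def
proof (intro allI impI)
  fix f :: "real \<Rightarrow> 'k" assume "g \<in> carrier G0" "square_integrable haar f"
  then show "square_integrable haar (fibre_op T act g f) \<and>
      fibre_representation T act g (to_L2 f) = to_L2 (fibre_op T act g f)"
    using square_integrable_op[of "(1, g)" f] representation_to_L2[of "(1, g)" f]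
    by (simp add: carrier_G fibre_representation_eq semidirect_op_def dilation_def)
qed

lemma given_by_dilation: "s > 0 \<Longrightarrow> given_by (S (s, \<one>\<^bsub>G0\<^esub>)) (dilation s)"
  by (simp add: given_by_def representation_dilation)

end

section \<open>Continuity of cocycles\<close>

text \<open>A locally compact Hausdorff space is a Baire space, which for each e gives one point k0
  near which \<open>b\<close> varies by less than e. Since |b(g k) - b(g)| = |b(k)| for every g, the
  same estimate holds near every point.\<close>

lemma continuous_cocycle_Baire:
  fixes b :: "'g \<Rightarrow> 'h::real_normed_vector" and \<beta> :: "nat \<Rightarrow> 'g \<Rightarrow> 'h"
  assumes lcg: "locally_compact_group G X"
    and S: "\<And>g v. g \<in> carrier G \<Longrightarrow> norm (S g v) = norm v"
    and b: "\<And>g h. g \<in> carrier G \<Longrightarrow> h \<in> carrier G \<Longrightarrow> b (g \<otimes>\<^bsub>G\<^esub> h) = S g (b h) + b g"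
    and \<beta>: "\<And>n. continuous_map X euclidean (\<beta> n)"
    and lim: "\<And>g. g \<in> carrier G \<Longrightarrow> (\<lambda>n. \<beta> n g) \<longlonglongrightarrow> b g"
  shows "continuous_map X euclidean b"
  unfolding continuous_map_metric_iff
proof (intro ballI allI impI)
  fix g and e :: real assume "g \<in> topspace X" and e: "e > 0"
  interpret group G
    using lcg by (simp add: locally_compact_group_def)
  have X: "topspace X = carrier G" "locally_compact_space X" "Hausdorff_space X"
    using lcg by (auto simp: locally_compact_group_def)
  have g: "g \<in> carrier G"
    using \<open>g \<in> topspace X\<close> X by simp
  \<comment> \<open>From index n on the sequence varies by at most e/4 on \<open>A n\<close>. The
    estimate near k0 adds three errors of this size, which leaves a strict inequality.\<close>
  define A where "A n = {k \<in> topspace X. \<forall>i\<ge>n. \<forall>j\<ge>n. norm (\<beta> i k - \<beta> j k) \<le> e / 4}" for n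
  have closed: "closedin X (A n)" for n
  proof -
    have "closedin X {k \<in> topspace X. norm (\<beta> i k - \<beta> j k) \<in> {..e / 4}}" for i j
      by (rule closedin_continuous_map_preimage[of _ euclidean])
        (auto intro!: continuous_map_norm continuous_map_diff \<beta> simp flip: closed_closedin)
    then have "closedin X (\<Inter>i\<in>{n..}. \<Inter>j\<in>{n..}. {k \<in> topspace X. norm (\<beta> i k - \<beta> j k) \<in> {..e / 4}})"
      by (intro closedin_Inter) (auto intro!: closedin_Inter)
    also have "(\<Inter>i\<in>{n..}. \<Inter>j\<in>{n..}. {k \<in> topspace X. norm (\<beta> i k - \<beta> j k) \<in> {..e / 4}}) = A n"
      by (auto simp: A_def)
    finally show ?thesis .
  qed
  have cover: "(\<Union>n. A n) = topspace X"
  proof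
    show "topspace X \<subseteq> (\<Union>n. A n)"
    proof
      fix k assume k: "k \<in> topspace X"
      then have "Cauchy (\<lambda>n. \<beta> n k)"
        using lim X(1) by (intro LIMSEQ_imp_Cauchy) auto
      from CauchyD[OF this, of "e / 4"] obtain n where "\<forall>i\<ge>n. \<forall>j\<ge>n. norm (\<beta> i k - \<beta> j k) < e / 4"
        using e by auto
      then show "k \<in> (\<Union>n. A n)"
        using k by (auto simp: A_def intro!: less_imp_le)
    qed
  qed (auto simp: A_def)
  obtain n where n: "X interior_of A n \<noteq> {}"
  proof (rule ccontr)
    assume "\<not> thesis"
    then have empty: "X interior_of A n = {}" for n
      using that by blast
    \<comment> \<open>If all these closed sets had empty interior, so would their union, which is
      the whole space and contains g.\<close>
    have "X interior_of \<Union>(range A) = {}"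
      by (rule Baire_category_alt)
        (use X closed empty in \<open>auto simp: locally_compact_Hausdorff_imp_regular_space\<close>)
    then show False
      using cover \<open>g \<in> topspace X\<close> by simp
  qed
  then obtain k0 where k0: "k0 \<in> X interior_of A n"
    by blast
  then have k0': "k0 \<in> A n" "k0 \<in> carrier G"
    using interior_of_subset[of X "A n"] X(1) by (auto simp: A_def)
  obtain V where V: "openin X V" "k0 \<in> V" "\<forall>y\<in>V. dist (\<beta> n y) (\<beta> n k0) < e / 4"
    using \<beta>[of n] k0'(2) e unfolding continuous_map_metric_iff X(1) by (metis zero_less_divide_iff zero_less_numeral)
  define W where "W = V \<inter> X interior_of A n"
  have tail: "norm (b y - \<beta> n y) \<le> e / 4" if "y \<in> A n" for y
  proof (rule LIMSEQ_le_const2)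
    show "(\<lambda>i. norm (\<beta> i y - \<beta> n y)) \<longlonglongrightarrow> norm (b y - \<beta> n y)"
      using that X(1) by (intro tendsto_intros lim) (auto simp: A_def)
    show "\<exists>N. \<forall>i\<ge>N. norm (\<beta> i y - \<beta> n y) \<le> e / 4"
      using that by (intro exI[of _ n]) (auto simp: A_def)
  qed
  have W: "norm (b y - b k0) < e" if "y \<in> W" for y
  proof -
    have "y \<in> A n" "norm (\<beta> n y - \<beta> n k0) < e / 4"
      using that V(3) interior_of_subset[of X "A n"] by (auto simp: W_def dist_norm)
    moreover have "norm (b y - b k0) \<le> norm (b y - \<beta> n y) + norm (\<beta> n y - \<beta> n k0) + norm (b k0 - \<beta> n k0)"
      using norm_triangle_ineq4[of "b y - \<beta> n y + (\<beta> n y - \<beta> n k0)" "b k0 - \<beta> n k0"]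
        norm_triangle_ineq[of "b y - \<beta> n y" "\<beta> n y - \<beta> n k0"] by simp
    ultimately show ?thesis
      using tail[of y] tail[OF k0'(1)] e by simp
  qed
  \<comment> \<open>The translate of \<open>W\<close> that carries k0 to g: for y = g k the
    condition says that k0 k lies in \<open>W\<close>.\<close>
  define U where "U = {y \<in> topspace X. k0 \<otimes>\<^bsub>G\<^esub> (inv\<^bsub>G\<^esub> g \<otimes>\<^bsub>G\<^esub> y) \<in> W}"
  have mult: "continuous_map X X (\<lambda>y. p \<otimes>\<^bsub>G\<^esub> f y)" if "p \<in> carrier G" "continuous_map X X f" for p f
  proof -
    have "continuous_map X (prod_topology X X) (\<lambda>y. (p, f y))"
      using that X(1) by (intro continuous_map_pairedI) auto
    then show ?thesis
      using continuous_map_compose[of X "prod_topology X X" "\<lambda>y. (p, f y)" X "\<lambda>(x, y). x \<otimes>\<^bsub>G\<^esub> y"] lcg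
      by (simp add: locally_compact_group_def comp_def)
  qed
  have "openin X U"
    unfolding U_def
  proof (rule openin_continuous_map_preimage)
    show "continuous_map X X (\<lambda>y. k0 \<otimes>\<^bsub>G\<^esub> (inv\<^bsub>G\<^esub> g \<otimes>\<^bsub>G\<^esub> y))"
      using g k0' by (intro mult) auto
    show "openin X W"
      using V by (auto simp: W_def)
  qed
  moreover have "g \<in> U"
    using g k0 k0' V(2) X(1) by (simp add: U_def W_def)
  moreover have "dist (b y) (b g) < e" if y: "y \<in> U" for y
  proof -
    define k where "k = inv\<^bsub>G\<^esub> g \<otimes>\<^bsub>G\<^esub> y"
    have y': "y \<in> carrier G" "k \<in> carrier G" "k0 \<otimes>\<^bsub>G\<^esub> k \<in> W"
      using y g X(1) by (auto simp: U_def k_def)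
    have "g \<otimes>\<^bsub>G\<^esub> k = y"
      using g y'(1) by (simp add: k_def flip: m_assoc)
    then have "norm (b y - b g) = norm (b k)"
      using b[OF g y'(2)] S[OF g] by simp
    also have "\<dots> = norm (b (k0 \<otimes>\<^bsub>G\<^esub> k) - b k0)"
      using b[OF k0'(2) y'(2)] S[OF k0'(2)] by simp
    also have "\<dots> < e"
      using y'(3) by (rule W)
    finally show ?thesis
      by (simp add: dist_norm)
  qed
  ultimately show "\<exists>U. openin X U \<and> g \<in> U \<and> (\<forall>y\<in>U. dist (b y) (b g) < e)"
    by blast
qed

section \<open>Invariant functions\<close>

text \<open>Otherwise every (r0, p) with p nonzero has a ball that the graph of \<open>w\<close>
  avoids almost everywhere. The graph lies in a separable set, so countably many such balls cover
  its part outside the zero vector, and \<open>w\<close> would vanish almost everywhere.\<close>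

lemma essential_value:
  fixes w :: "real \<Rightarrow> 'k::real_normed_vector"
  assumes w: "strongly_measurable haar w" and nz: "\<not> (AE r in haar. w r = 0)"
  obtains r0 p where "r0 > 0" "p \<noteq> 0"
    "\<And>e. e > 0 \<Longrightarrow> \<not> (AE r in haar. (r, w r) \<notin> ball (r0, p) e)"
proof (rule ccontr)
  note main = that
  assume no: "\<not> thesis"
  have ex: "\<exists>e>0. AE r in haar. (r, w r) \<notin> ball (r0, p) e" if "r0 > 0" "p \<noteq> 0" for r0 p
    using no main[OF that] by blast
  have "strongly_measurable haar (\<lambda>r. (r, w r))"
    by (rule strongly_measurable_comp2[OF strongly_measurable_real[OF borel_measurable_haar_id] w, where h = Pair])
      (rule tendsto_Pair)
  then obtain d where d: "\<And>r. r > 0 \<Longrightarrow> (r, w r) \<in> closure (range (d :: nat \<Rightarrow> real \<times> 'k))"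
    by (rule strongly_measurable_countable_range) auto
  \<comment> \<open>The countable family of balls: centres from the dense sequence, radii 1/(n+1),
    retained when the graph avoids the ball almost everywhere.\<close>
  define N where "N = {(i, n). AE r in haar. (r, w r) \<notin> ball (d i) (1 / real (Suc n))}"
  have "AE r in haar. \<forall>q\<in>N. (r, w r) \<notin> ball (d (fst q)) (1 / real (Suc (snd q)))"
    by (subst AE_ball_countable) (auto simp: N_def)
  then have "AE r in haar. w r = 0"
    using AE_space
  proof eventually_elim
    case (elim r)
    show ?case
    proof (rule ccontr)
      assume "w r \<noteq> 0"
      moreover have r: "r > 0"
        using elim by simp
      ultimately obtain e where e: "e > 0" "AE s in haar. (s, w s) \<notin> ball (r, w r) e"
        using ex by blast
      \<comment> \<open>A ball of radius below e/2 that contains (r, w r) lies in the ball of radius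
        e around that point, so it belongs to the family.\<close>
      obtain n where n: "1 / real (Suc n) < e / 2"
        using e(1) by (metis half_gt_zero nat_approx_posE)
      obtain i where i: "dist (d i) (r, w r) < 1 / real (Suc n)"
        using d[OF r] unfolding closure_approachable
        by (elim allE[of _ "1 / real (Suc n)"]) auto
      have sub: "ball (d i) (1 / real (Suc n)) \<subseteq> ball (r, w r) e"
      proof
        fix q assume "q \<in> ball (d i) (1 / real (Suc n))"
        then show "q \<in> ball (r, w r) e"
          using i n dist_triangle[of "(r, w r)" q "d i"] by (simp add: dist_commute)
      qed
      have "AE s in haar. (s, w s) \<notin> ball (d i) (1 / real (Suc n))"
        using e(2) by eventually_elim (use sub in blast)
      then have "(i, n) \<in> N"
        by (simp only: N_def mem_Collect_eq prod.case)
      then show False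
        using elim(1) i by (auto simp: dist_commute)
    qed
  qed
  with nz show False ..
qed

context real_action_representation
begin

text \<open>The null set in \<open>inv\<close> depends on g and the group may be uncountable, so no
  single fibre can be chosen on which invariance holds for all g at once. An essential value of the
  graph replaces such a fibre.\<close>

lemma AE_invariant_imp_zero:
  assumes w: "strongly_measurable haar w"
    and inv: "\<And>g. g \<in> carrier G0 \<Longrightarrow> AE r in haar. T (act r g) (w r) = w r"
    and triv: "\<And>x. (\<forall>g\<in>carrier G0. T g x = x) \<Longrightarrow> x = 0"
  shows "AE r in haar. w r = 0"
proof (rule ccontr)
  assume nz: "\<not> (AE r in haar. w r = 0)"
  obtain r0 p where p: "r0 > 0" "p \<noteq> 0"
    "\<And>e. e > 0 \<Longrightarrow> \<not> (AE r in haar. (r, w r) \<notin> ball (r0, p) e)"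
    using essential_value[OF w nz] by blast
  have fix_p: "T (act r0 g) p = p" if g: "g \<in> carrier G0" for g
  proof (rule ccontr)
    assume ne: "T (act r0 g) p \<noteq> p"
    \<comment> \<open>This map vanishes at (r, w r) for almost every r. By continuity it is nonzero
      near (r0, p), so the graph would avoid a ball around that point almost everywhere.\<close>
    define \<psi> where "\<psi> = (\<lambda>(r, x). T (act r g) x - x)"
    have "continuous_on ({0<..} \<times> UNIV) (\<lambda>q. (\<lambda>(r, x). T (act r g) x) q - snd q)"
      by (intro continuous_intros continuous_orbit_joint g)
    then have cont: "continuous_on ({0<..} \<times> UNIV) \<psi>"
      by (simp add: \<psi>_def case_prod_unfold)
    have "(r0, p) \<in> {0<..} \<times> UNIV" "norm (\<psi> (r0, p)) > 0"
      using p(1) ne by (auto simp: \<psi>_def)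
    then obtain e where e: "e > 0" "\<And>q. q \<in> {0<..} \<times> UNIV \<Longrightarrow> dist q (r0, p) < e \<Longrightarrow>
        dist (\<psi> q) (\<psi> (r0, p)) < norm (\<psi> (r0, p))"
      using bspec[OF cont[unfolded continuous_on_iff], of "(r0, p)"] by blast
    have "AE r in haar. (r, w r) \<notin> ball (r0, p) e"
      using inv[OF g] AE_space
    proof eventually_elim
      case (elim r)
      then show ?case
        using e(2)[of "(r, w r)"] by (auto simp: \<psi>_def dist_commute norm_minus_commute)
    qed
    with p(3)[OF e(1)] show False ..
  qed
  have "T k p = p" if k: "k \<in> carrier G0" for k
  proof -
    \<comment> \<open>As \<open>act r0\<close> maps onto the group, the vector p is fixed by all
      operators of T.\<close>
    have "act r0 (act (inverse r0) k) = k"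
      using act_act[of "inverse r0" r0 k] p(1) k by (simp add: act_1)
    then show ?thesis
      using fix_p[of "act (inverse r0) k"] act_closed[of "inverse r0" k] p(1) k by simp
  qed
  with triv p(2) show False
    by blast
qed

end

section \<open>Haar integrals near the origin\<close>

lemma measurable_haar_continuous:
  assumes "continuous_on {0<..} f" shows "f \<in> borel_measurable haar"
proof -
  have "f \<in> borel_measurable (restrict_space borel {0<..})"
    using assms by (rule borel_measurable_continuous_on_restrict)
  then show ?thesis
    by (simp cong: measurable_cong_sets add: sets_haar)
qed

text \<open>By dilation invariance (0, 1] and (0, 1/2] would have the same finite measure, so (1/2,
  1] would be a null set; but the density is at least 1 there.\<close>

lemma not_integrable_haar: "\<not> integrable haar (indicat_real {0<..1})"
proof
  assume int: "integrable haar (indicat_real {0<..1})"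
  have half: "integrable haar (indicat_real {1/2<..1})"
    by (rule integrable_indicator_haar[of _ "1/2" 1]) auto
  have eq: "indicat_real {1/2<..1} r = indicat_real {0<..1} r - indicat_real {0<..1} (r * 2)" for r :: real
    by (auto simp: indicator_def)
  have "(\<integral>r. indicat_real {1/2<..1} r \<partial>haar) =
      (\<integral>r. indicat_real {0<..1} r \<partial>haar) - (\<integral>r. indicat_real {0<..1} (r * 2) \<partial>haar)"
    unfolding eq using int by (intro Bochner_Integration.integral_diff integrable_dilation) auto
  also have "\<dots> = 0"
    using int by (subst integral_dilation) auto
  finally have "ennreal 0 = (\<integral>\<^sup>+r. ennreal (indicat_real {1/2<..1} r) \<partial>haar)"
    using half by (subst nn_integral_eq_integral) auto
  also have "\<dots> = (\<integral>\<^sup>+r. ennreal (1 / r) * ennreal (indicat_real {1/2<..1} r) * indicator {0<..} r \<partial>lborel)"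
    by (rule nn_integral_haar) measurable
  also have "\<dots> \<ge> (\<integral>\<^sup>+r. indicator {1/2<..1::real} r \<partial>lborel)"
  proof (rule nn_integral_mono)
    fix r :: real
    show "indicator {1/2<..1} r \<le> ennreal (1 / r) * ennreal (indicat_real {1/2<..1} r) * indicator {0<..} r"
      using ennreal_leI[of 1 "1 / r"] by (auto simp: indicator_def)
  qed
  finally show False
    by simp
qed

text \<open>The factor r cancels the density 1/r, leaving the Lebesgue measure of (0, 1].\<close>

lemma integrable_haar_id: "integrable haar (\<lambda>r. r * indicat_real {0<..1} r)"
proof (rule integrableI_bounded)
  show "(\<lambda>r. r * indicat_real {0<..1} r) \<in> borel_measurable haar"
    by (intro measurable_haarI) measurable
  have "(\<integral>\<^sup>+r. ennreal (norm (r * indicat_real {0<..1} r)) \<partial>haar) =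
      (\<integral>\<^sup>+r. ennreal (1 / r) * ennreal (norm (r * indicat_real {0<..1} r)) * indicator {0<..} r \<partial>lborel)"
    by (rule nn_integral_haar) measurable
  also have "\<dots> = (\<integral>\<^sup>+r. indicator {0<..1::real} r \<partial>lborel)"
    by (rule nn_integral_cong) (auto simp: indicator_def ennreal_mult[symmetric])
  finally show "(\<integral>\<^sup>+r. ennreal (norm (r * indicat_real {0<..1} r)) \<partial>haar) < \<infinity>"
    by simp
qed

section \<open>The weight exp (-u/2) and its behaviour at the origin\<close>

locale almost_invariant_vector = real_action_representation G0 X act T
  for G0 :: "('g, 'm) monoid_scheme" and X act and T :: "'g \<Rightarrow> 'k::complex_hilbert \<Rightarrow> 'k" +
  fixes u :: "real \<Rightarrow> real" and h :: 'k
  assumes u: "admissible_weight u"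
    and h: "almost_invariant G0 act u T h"
begin

definition \<phi> :: "real \<Rightarrow> real" where "\<phi> r = exp (- u r / 2)"

lemma \<phi>_pos: "\<phi> r > 0"
  by (simp add: \<phi>_def)

lemma \<phi>_le_1: "r > 0 \<Longrightarrow> \<phi> r \<le> 1"
  using u by (auto simp: \<phi>_def admissible_weight_def less_imp_le)

lemma \<phi>_has_derivative:
  obtains D where "\<And>r. r \<ge> 0 \<Longrightarrow> (\<phi> has_real_derivative D r) (at r within {0..})"
proof -
  obtain D where D: "D 0 = u" "\<And>n r. r \<ge> 0 \<Longrightarrow> (D n has_real_derivative D (Suc n) r) (at r within {0..})"
    using u unfolding admissible_weight_def smooth_on_half_line_def by blast
  have "(\<phi> has_real_derivative \<phi> r * (- D 1 r / 2)) (at r within {0..})" if "r \<ge> 0" for r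
    using D(2)[OF that, of 0] unfolding \<phi>_def by (auto intro!: derivative_eq_intros simp: D(1))
  then show ?thesis
    by (rule that)
qed

lemma continuous_\<phi>: "continuous_on {0..} \<phi>"
  by (rule \<phi>_has_derivative) (auto intro: DERIV_continuous_on)

lemma measurable_\<phi>: "\<phi> \<in> borel_measurable haar"
  by (rule measurable_haar_continuous) (rule continuous_on_subset[OF continuous_\<phi>], auto)

text \<open>One-sided differentiability at 0 bounds the difference quotient on some (0, d); on the
  rest of (0, 1] boundedness of \<phi> is enough.\<close>

lemma \<phi>_near_0:
  obtains L where "L \<ge> 0" "\<And>r. 0 < r \<Longrightarrow> r \<le> 1 \<Longrightarrow> \<bar>\<phi> r - \<phi> 0\<bar> \<le> L * r"
proof -
  obtain D where D: "\<And>r. r \<ge> 0 \<Longrightarrow> (\<phi> has_real_derivative D r) (at r within {0..})"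
    using \<phi>_has_derivative by blast
  have "((\<lambda>r. (\<phi> r - \<phi> 0) / r) \<longlongrightarrow> D 0) (at 0 within {0..})"
    using D[of 0] by (simp add: has_field_derivative_iff)
  then have "\<forall>\<^sub>F r in at 0 within {0..}. \<bar>(\<phi> r - \<phi> 0) / r - D 0\<bar> < 1"
    using tendstoD[of _ "D 0" _ 1] by (simp add: dist_real_def)
  then obtain d where d: "d > 0" "\<And>r. r > 0 \<Longrightarrow> r < d \<Longrightarrow> \<bar>(\<phi> r - \<phi> 0) / r - D 0\<bar> < 1"
    unfolding eventually_at by (auto simp: dist_real_def)
  \<comment> \<open>The first entry serves r < d. The second serves r \<ge> d, where 1 + \<phi> 0
    bounds the difference and r / d is at least 1.\<close>
  define L where "L = max (\<bar>D 0\<bar> + 1) ((1 + \<phi> 0) / d)"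
  have "\<bar>\<phi> r - \<phi> 0\<bar> \<le> L * r" if r: "0 < r" "r \<le> 1" for r
  proof (cases "r < d")
    case True
    have "\<bar>(\<phi> r - \<phi> 0) / r\<bar> \<le> \<bar>D 0\<bar> + 1"
      using d(2)[OF r(1) True] by linarith
    also have "\<dots> \<le> L"
      by (simp add: L_def)
    finally show ?thesis
      using r by (simp add: abs_divide field_simps)
  next
    case False
    have "\<bar>\<phi> r - \<phi> 0\<bar> \<le> 1 + \<phi> 0"
      using \<phi>_pos[of r] \<phi>_pos[of 0] \<phi>_le_1[OF r(1)] by linarith
    also have "\<dots> = (1 + \<phi> 0) / d * d"
      using d by simp
    also have "\<dots> \<le> L * r"
      using False d(1) by (intro mult_mono) (auto simp: L_def le_max_iff_disj)
    finally show ?thesis .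
  qed
  moreover have "L \<ge> 0"
    by (simp add: L_def le_max_iff_disj)
  ultimately show ?thesis
    using that by blast
qed

lemma integrable_\<phi>_tail: "integrable haar (\<lambda>r. \<phi> r * indicat_real {1..} r)"
proof (rule integrableI_bounded)
  show "(\<lambda>r. \<phi> r * indicat_real {1..} r) \<in> borel_measurable haar"
    by (intro borel_measurable_times measurable_\<phi> measurable_haarI) auto
  have "(\<integral>\<^sup>+r. ennreal (norm (\<phi> r * indicat_real {1..} r)) \<partial>haar) = (\<integral>\<^sup>+r\<in>{1..}. ennreal (\<phi> r) \<partial>haar)"
    using \<phi>_pos by (intro nn_integral_cong) (auto simp: indicator_def abs_mult less_imp_le)
  also have "\<dots> < \<infinity>"
    using u by (simp add: admissible_weight_def \<phi>_def)
  finally show "(\<integral>\<^sup>+r. ennreal (norm (\<phi> r * indicat_real {1..} r)) \<partial>haar) < \<infinity>" .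
qed

lemma weight_vector_eq: "weight_vector u h r = \<phi> r *\<^sub>R h"
  by (simp add: weight_vector_def \<phi>_def)

text \<open>Continuity up to the end point 0 gives \<phi> a positive minimum on [0, 1]. The squared
  norm then dominates a multiple of the indicator of (0, 1], whose Haar integral diverges.\<close>

lemma weight_vector_not_L2: "\<not> square_integrable haar (weight_vector u h)"
proof
  assume "square_integrable haar (weight_vector u h)"
  then have int: "integrable haar (\<lambda>r. (norm (\<phi> r *\<^sub>R h))\<^sup>2)"
    by (simp add: square_integrable_def weight_vector_eq)
  have "h \<noteq> 0"
    using h by (simp add: almost_invariant_def)
  have "continuous_on {0..1} \<phi>"
    by (rule continuous_on_subset[OF continuous_\<phi>]) auto
  then obtain r0 where r0: "\<And>r. r \<in> {0..1} \<Longrightarrow> \<phi> r0 \<le> \<phi> r"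
    using continuous_attains_inf[of "{0..1}" \<phi>] by fastforce
  define c where "c = (norm (\<phi> r0 *\<^sub>R h))\<^sup>2"
  have c: "c > 0"
    using \<phi>_pos[of r0] \<open>h \<noteq> 0\<close> by (simp add: c_def)
  have "integrable haar (indicat_real {0<..1})"
  proof (rule Bochner_Integration.integrable_bound)
    show "integrable haar (\<lambda>r. (norm (\<phi> r *\<^sub>R h))\<^sup>2 / c)"
      using int by simp
    show "indicat_real {0<..1} \<in> borel_measurable haar"
      by (intro measurable_haarI) auto
    show "AE r in haar. norm (indicat_real {0<..1} r) \<le> norm ((norm (\<phi> r *\<^sub>R h))\<^sup>2 / c)"
    proof (rule AE_I2)
      fix r :: real
      have "c \<le> (norm (\<phi> r *\<^sub>R h))\<^sup>2" if "r \<in> {0<..1}"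
        unfolding c_def using r0[of r] that \<phi>_pos[of r0]
        by (intro power_mono) (auto simp: mult_right_mono)
      then show "norm (indicat_real {0<..1} r) \<le> norm ((norm (\<phi> r *\<^sub>R h))\<^sup>2 / c)"
        using c by (auto simp: indicator_def)
    qed
  qed
  with not_integrable_haar show False ..
qed

section \<open>The coboundary of the weight under dilations\<close>

text \<open>The weight with its limit at 0 removed on (0, 1]. The removed multiple of an indicator
  carries the whole divergence at the origin.\<close>

definition \<phi>' :: "real \<Rightarrow> real" where "\<phi>' r = \<phi> r - \<phi> 0 * indicator {0<..1} r"

text \<open>On (0, 1] the Lipschitz bound gives (L r)^2 \<le> L^2 r, which is integrable because r
  cancels the density; beyond 1 the function is \<phi> itself and \<phi>^2 \<le> \<phi>. At r = 1
  both terms of the majorant are present, which only enlarges it.\<close>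

lemma square_integrable_\<phi>': "square_integrable haar (\<lambda>r. \<phi>' r *\<^sub>R h)"
proof -
  obtain L where L: "L \<ge> 0" "\<And>r. 0 < r \<Longrightarrow> r \<le> 1 \<Longrightarrow> \<bar>\<phi> r - \<phi> 0\<bar> \<le> L * r"
    using \<phi>_near_0 by blast
  show ?thesis
  proof (rule square_integrableI)
    have "indicat_real {0<..1} \<in> borel_measurable haar"
      by (rule measurable_haarI) simp
    then have "\<phi>' \<in> borel_measurable haar"
      unfolding \<phi>'_def using measurable_\<phi> by simp
    then show "strongly_measurable haar (\<lambda>r. \<phi>' r *\<^sub>R h)"
      by (intro strongly_measurable_scaleR_fun strongly_measurable_const)
    show "integrable haar (\<lambda>r. (L\<^sup>2 * (r * indicat_real {0<..1} r) + \<phi> r * indicat_real {1..} r) * (norm h)\<^sup>2)"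
      using integrable_haar_id integrable_\<phi>_tail by auto
    fix r :: real assume "r \<in> space haar"
    then have r: "r > 0"
      by simp
    have "(\<phi>' r)\<^sup>2 \<le> L\<^sup>2 * (r * indicat_real {0<..1} r) + \<phi> r * indicat_real {1..} r"
    proof (cases "r \<le> 1")
      case True
      have "(\<phi>' r)\<^sup>2 = \<bar>\<phi> r - \<phi> 0\<bar>\<^sup>2"
        using True r by (simp add: \<phi>'_def)
      also have "\<dots> \<le> (L * r)\<^sup>2"
        using L(2)[OF r True] by (intro power_mono) auto
      also have "\<dots> = L\<^sup>2 * (r * r)"
        by (simp add: power2_eq_square)
      also have "\<dots> \<le> L\<^sup>2 * r"
        using r True by (intro mult_left_mono) (auto simp: mult_left_le)
      finally show ?thesis
        using True r \<phi>_pos[of r] by (auto simp: indicator_def)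
    next
      case False
      then show ?thesis
        using \<phi>_pos[of r] \<phi>_le_1[OF r] by (simp add: \<phi>'_def power2_eq_square mult_left_le)
    qed
    then show "(norm (\<phi>' r *\<^sub>R h))\<^sup>2 \<le>
        (L\<^sup>2 * (r * indicat_real {0<..1} r) + \<phi> r * indicat_real {1..} r) * (norm h)\<^sup>2"
      by (simp add: power_mult_distrib mult_right_mono)
  qed
qed

text \<open>The value of the cocycle at (s, e), written so that continuity in s is visible: the
  coboundary of the square integrable part of the weight, plus that of \<phi> 0 times the indicator
  of (0, 1], which is an oriented step from 1 to 1/s.\<close>

definition dilation_part :: "real \<Rightarrow> 'k L2" where
  "dilation_part s = S (s, \<one>\<^bsub>G0\<^esub>) (to_L2 (\<lambda>r. \<phi>' r *\<^sub>R h)) - to_L2 (\<lambda>r. \<phi>' r *\<^sub>R h)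
     + step_L2 1 (1 / s) (\<phi> 0 *\<^sub>R h)"

lemma dilation_part:
  assumes s: "s > 0"
  shows "square_integrable haar (\<lambda>r. (\<phi> (r * s) - \<phi> r) *\<^sub>R h)"
    and "dilation_part s = to_L2 (\<lambda>r. (\<phi> (r * s) - \<phi> r) *\<^sub>R h)"
proof -
  let ?f = "\<lambda>r. \<phi>' r *\<^sub>R h"
  let ?st = "\<lambda>r. (indicator {0<..1 / s} r - indicator {0<..1} r) *\<^sub>R (\<phi> 0 *\<^sub>R h)"
  have eq: "dilation s ?f r - ?f r + ?st r = (\<phi> (r * s) - \<phi> r) *\<^sub>R h" if "r > 0" for r
  proof -
    have "indicat_real {0<..1} (r * s) = indicat_real {0<..1 / s} r"
      using that s by (auto simp: indicator_def field_simps)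
    then show ?thesis
      by (simp add: dilation_def \<phi>'_def algebra_simps)
  qed
  have st: "square_integrable haar ?st"
    using s by (intro square_integrable_step) auto
  note si = representation_dilation(1)[OF s square_integrable_\<phi>'] square_integrable_\<phi>'
  have sum: "square_integrable haar (\<lambda>r. dilation s ?f r - ?f r + ?st r)"
    by (intro square_integrable_add square_integrable_diff si st)
  then show "square_integrable haar (\<lambda>r. (\<phi> (r * s) - \<phi> r) *\<^sub>R h)"
    using square_integrable_cong[of haar "\<lambda>r. dilation s ?f r - ?f r + ?st r"] eq by simp
  have "dilation_part s = to_L2 (\<lambda>r. dilation s ?f r - ?f r + ?st r)"
    unfolding dilation_part_def step_L2_def representation_dilation(2)[OF s square_integrable_\<phi>']
    by (simp only: to_L2_diff[OF si] to_L2_add[OF square_integrable_diff[OF si] st])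
  also have "\<dots> = to_L2 (\<lambda>r. (\<phi> (r * s) - \<phi> r) *\<^sub>R h)"
    using sum eq by (rule to_L2_cong)
  finally show "dilation_part s = to_L2 (\<lambda>r. (\<phi> (r * s) - \<phi> r) *\<^sub>R h)" .
qed

lemma continuous_dilation_part: "continuous_on {0<..} dilation_part"
proof -
  have "continuous_on {0<..} (\<lambda>s. step_L2 1 (1 / s) (\<phi> 0 *\<^sub>R h))"
    unfolding continuous_on_def
  proof
    fix s :: real assume s: "s \<in> {0<..}"
    have ev: "\<forall>\<^sub>F t in at s within {0<..}. 0 < t"
      by (simp add: eventually_at_filter)
    show "((\<lambda>s. step_L2 1 (1 / s) (\<phi> 0 *\<^sub>R h)) \<longlongrightarrow> step_L2 1 (1 / s) (\<phi> 0 *\<^sub>R h)) (at s within {0<..})"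
      using s by (intro tendsto_step_L2 tendsto_intros eventually_mono[OF ev]) auto
  qed
  then show ?thesis
    unfolding dilation_part_def
    by (intro continuous_intros continuous_dilation_representation)
qed

section \<open>The cocycle\<close>

abbreviation "\<beta> \<equiv> cocycle_function T act u h"

lemma cocycle_function_apply:
  "\<beta> (s, g) r = T (act (r * s) g) (\<phi> (r * s) *\<^sub>R h) - \<phi> r *\<^sub>R h"
  by (simp add: cocycle_function_def op_apply weight_vector_eq)

lemma fibre_cocycle_apply:
  assumes "g \<in> carrier G0" "r > 0"
  shows "\<beta> (1, g) r = \<phi> r *\<^sub>R (T (act r g) h - h)"
  using assms by (simp add: cocycle_function_apply T_scaleR act_closed algebra_simps)

lemma strongly_measurable_weight_vector: "strongly_measurable haar (weight_vector u h)"
  unfolding weight_vector_eq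
  by (intro strongly_measurable_scaleR_fun measurable_\<phi> strongly_measurable_const)

lemma strongly_measurable_cocycle:
  assumes "s > 0" "g \<in> carrier G0" shows "strongly_measurable haar (\<beta> (s, g))"
  unfolding cocycle_function_def
  by (intro strongly_measurable_diff strongly_measurable_op assms strongly_measurable_weight_vector)

definition cocycle_majorant :: "'g \<Rightarrow> real \<Rightarrow> real" where
  "cocycle_majorant g r = 2 * norm h * (norm (T (act r g) h - h) * \<phi> r)"

lemma integrable_cocycle_majorant:
  assumes g: "g \<in> carrier G0" shows "integrable haar (cocycle_majorant g)"
proof -
  have "integrable haar (\<lambda>r. norm (T (act r g) h - h) * \<phi> r)"
  proof (rule integrableI_bounded)
    have "continuous_on {0<..} (\<lambda>r. norm (T (act r g) h - h))"
      by (intro continuous_intros continuous_orbit_dilation g)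
    then show "(\<lambda>r. norm (T (act r g) h - h) * \<phi> r) \<in> borel_measurable haar"
      by (intro borel_measurable_times measurable_haar_continuous measurable_\<phi>)
    show "(\<integral>\<^sup>+r. ennreal (norm (norm (T (act r g) h - h) * \<phi> r)) \<partial>haar) < \<infinity>"
      using h g by (simp add: almost_invariant_def \<phi>_def abs_mult)
  qed
  then show ?thesis
    unfolding cocycle_majorant_def by simp
qed

text \<open>Almost invariance controls the first power of N, while the square is to be integrated.
  Unitarity gives N \<le> 2 |h| and positivity of u gives \<phi> \<le> 1, so N^2 \<phi>^2 is at most
  2 |h| N \<phi>.\<close>

lemma cocycle_bound:
  assumes g: "g \<in> carrier G0" and r: "r > 0"
  shows "(norm (\<beta> (1, g) r))\<^sup>2 \<le> cocycle_majorant g r"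
proof -
  define N where "N = norm (T (act r g) h - h)"
  have "N \<le> norm (T (act r g) h) + norm h"
    unfolding N_def by (rule norm_triangle_ineq4)
  then have N: "0 \<le> N" "N \<le> 2 * norm h"
    using g r by (simp_all add: T_norm act_closed N_def)
  have "(norm (\<beta> (1, g) r))\<^sup>2 = (\<phi> r * \<phi> r) * (N * N)"
    using g r by (simp add: fibre_cocycle_apply power2_eq_square N_def)
  also have "\<dots> \<le> \<phi> r * (2 * norm h * N)"
    using N \<phi>_pos[of r] \<phi>_le_1[OF r] by (intro mult_mono) (auto simp: mult_left_le mult_right_mono)
  finally show ?thesis
    by (simp add: cocycle_majorant_def N_def mult_ac)
qed

lemma square_integrable_fibre_cocycle:
  "g \<in> carrier G0 \<Longrightarrow> square_integrable haar (\<beta> (1, g))"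
  by (rule square_integrableI[OF strongly_measurable_cocycle integrable_cocycle_majorant]) (auto simp: cocycle_bound)

lemma cocycle_decompose:
  assumes "s > 0" "g \<in> carrier G0" "r > 0"
  shows "\<beta> (s, g) r = dilation s (\<beta> (1, g)) r + (\<phi> (r * s) - \<phi> r) *\<^sub>R h"
  by (simp add: cocycle_function_apply dilation_def algebra_simps)

lemma cocycle_L2:
  assumes "s > 0" "g \<in> carrier G0"
  shows "square_integrable haar (\<beta> (s, g))"
    and "to_L2 (\<beta> (s, g)) = S (s, \<one>\<^bsub>G0\<^esub>) (to_L2 (\<beta> (1, g))) + dilation_part s"
proof -
  note d = representation_dilation[OF assms(1) square_integrable_fibre_cocycle[OF assms(2)]]
  have sum: "square_integrable haar (\<lambda>r. dilation s (\<beta> (1, g)) r + (\<phi> (r * s) - \<phi> r) *\<^sub>R h)"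
    by (intro square_integrable_add d dilation_part(1) assms)
  then show "square_integrable haar (\<beta> (s, g))"
    by (subst square_integrable_cong) (simp_all add: cocycle_decompose assms)
  have "to_L2 (\<beta> (s, g)) = to_L2 (\<lambda>r. dilation s (\<beta> (1, g)) r + (\<phi> (r * s) - \<phi> r) *\<^sub>R h)"
    by (rule to_L2_cong[OF sum, symmetric]) (simp add: cocycle_decompose assms)
  then show "to_L2 (\<beta> (s, g)) = S (s, \<one>\<^bsub>G0\<^esub>) (to_L2 (\<beta> (1, g))) + dilation_part s"
    by (simp only: d(2) dilation_part(2)[OF assms(1)] to_L2_add[OF d(1) dilation_part(1)[OF assms(1)]])
qed

text \<open>Formally \<beta> is the coboundary of the weight vector, which has no class in the
  Hilbert space. The identity is therefore checked pointwise, where \<Phi> is multiplicative on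
  arbitrary functions, and then passed to classes.\<close>

lemma cocycle_identity:
  assumes x: "x \<in> carrier G" and y: "y \<in> carrier G"
  shows "to_L2 (\<beta> (x \<otimes>\<^bsub>G\<^esub> y)) = S x (to_L2 (\<beta> y)) + to_L2 (\<beta> x)"
proof -
  have si: "square_integrable haar (\<beta> z)" if "z \<in> carrier G" for z
    using that cocycle_L2(1) by (auto simp: carrier_G)
  obtain s g where x': "x = (s, g)" "s > 0" "g \<in> carrier G0"
    using x by (auto simp: carrier_G)
  have eq: "\<beta> (x \<otimes>\<^bsub>G\<^esub> y) r = \<Phi> x (\<beta> y) r + \<beta> x r" if r: "r > 0" for r
  proof -
    have "\<Phi> x (\<beta> y) r = \<Phi> x (\<Phi> y (weight_vector u h)) r - \<Phi> x (weight_vector u h) r"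
      using r by (simp add: x' op_apply cocycle_function_def T_diff act_closed)
    then show ?thesis
      by (simp add: cocycle_function_def op_mult[OF x y r])
  qed
  have "to_L2 (\<beta> (x \<otimes>\<^bsub>G\<^esub> y)) = to_L2 (\<lambda>r. \<Phi> x (\<beta> y) r + \<beta> x r)"
    by (rule to_L2_cong[OF si[OF mult_G_closed[OF x y]] eq])
  then show ?thesis
    by (simp add: to_L2_add square_integrable_op si x y representation_to_L2)
qed

text \<open>The truncations of the weight to \<open>J n\<close> are square integrable, so their
  coboundaries are continuous in g. The operators at (1, g) act separately on each fibre, so these
  coboundaries are \<beta> cut off to \<open>J n\<close>; they converge to it under the integrable
  majorant, and the Baire argument applies.\<close>

lemma continuous_fibre_cocycle: "continuous_map X euclidean (\<lambda>g. to_L2 (\<beta> (1, g)))"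
proof -
  define J where "J n = {1 / real (Suc n)<..real (Suc n)}" for n
  define f where "f n r = (indicat_real (J n) r * \<phi> r) *\<^sub>R h" for n r
  have J: "J n \<in> sets borel" "0 < 1 / real (Suc n)" for n
    by (simp_all add: J_def)
  have f: "square_integrable haar (f n)" for n
  proof (rule square_integrableI)
    show "strongly_measurable haar (f n)"
      unfolding f_def using J
      by (intro strongly_measurable_scaleR_fun borel_measurable_times measurable_\<phi>
          measurable_haarI strongly_measurable_const) auto
    show "integrable haar (\<lambda>r. indicat_real (J n) r * (norm h)\<^sup>2)"
      using integrable_indicator_haar[OF J(1)[of n] _ J(2)[of n], of "real (Suc n)"]
      by (auto simp only: J_def subset_refl intro: integrable_mult_left)
    fix r :: real assume "r \<in> space haar"
    then have "\<phi> r ^ 2 \<le> 1"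
      using \<phi>_pos[of r] \<phi>_le_1[of r] by (simp add: power_le_one)
    then show "(norm (f n r))\<^sup>2 \<le> indicat_real (J n) r * (norm h)\<^sup>2"
      by (auto simp: f_def indicator_def power_mult_distrib mult_left_le_one_le)
  qed
  show ?thesis
  proof (rule continuous_cocycle_Baire[OF lcg])
    show "norm (S (1, g) v) = norm v" if "g \<in> carrier G0" for g v
      using that by (simp add: representation_norm carrier_G)
    show "to_L2 (\<beta> (1, g \<otimes>\<^bsub>G0\<^esub> k)) = S (1, g) (to_L2 (\<beta> (1, k))) + to_L2 (\<beta> (1, g))"
      if "g \<in> carrier G0" "k \<in> carrier G0" for g k
      using that cocycle_identity[of "(1, g)" "(1, k)"] by (simp add: mult_embedded carrier_G)
    show "continuous_map X euclidean (\<lambda>g. S (1, g) (to_L2 (f n)) - to_L2 (f n))" for n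
      by (intro continuous_map_diff continuous_fibre_representation) simp
    fix g assume g: "g \<in> carrier G0"
    then have x: "(1, g) \<in> carrier G"
      by (simp add: carrier_G)
    define t where "t n r = indicat_real (J n) r *\<^sub>R \<beta> (1, g) r" for n r
    have t: "\<Phi> (1, g) (f n) r - f n r = t n r" if "r > 0" for n r
      using that g by (simp add: op_apply f_def t_def fibre_cocycle_apply T_scaleR act_closed algebra_simps)
    have "(\<lambda>n. to_L2 (t n)) \<longlonglongrightarrow> to_L2 (\<beta> (1, g))"
    proof (rule to_L2_tendsto[OF _ _ integrable_cocycle_majorant[OF g]])
      show "strongly_measurable haar (t n)" for n
        unfolding t_def using J g
        by (intro strongly_measurable_scaleR_fun measurable_haarI strongly_measurable_cocycle) auto
      show "strongly_measurable haar (\<beta> (1, g))"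
        using g by (intro strongly_measurable_cocycle) auto
      fix r :: real assume r: "r > 0"
      show "(norm (t n r))\<^sup>2 \<le> cocycle_majorant g r" for n
        using cocycle_bound[OF g r] by (auto simp: t_def indicator_def intro: order_trans[OF zero_le_power2])
      have "\<forall>\<^sub>F i in sequentially. 1 / real (Suc i) < r"
        using order_tendstoD(2)[OF LIMSEQ_inverse_real_of_nat r] by (simp add: field_simps)
      moreover have "\<forall>\<^sub>F i in sequentially. r \<le> real (Suc i)"
        using eventually_ge_at_top[of "nat \<lceil>r\<rceil>"] by eventually_elim linarith
      ultimately have "\<forall>\<^sub>F n in sequentially. \<beta> (1, g) r = t n r"
        by eventually_elim (simp add: t_def J_def)
      then show "(\<lambda>n. t n r) \<longlonglongrightarrow> \<beta> (1, g) r"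
        by (rule Lim_transform_eventually[OF tendsto_const])
    qed
    moreover have "S (1, g) (to_L2 (f n)) - to_L2 (f n) = to_L2 (t n)" for n
      unfolding representation_to_L2[OF x f] to_L2_diff[OF square_integrable_op[OF x f] f]
      by (rule to_L2_cong[OF square_integrable_diff[OF square_integrable_op[OF x f] f] t])
    ultimately show "(\<lambda>n. S (1, g) (to_L2 (f n)) - to_L2 (f n)) \<longlonglongrightarrow> to_L2 (\<beta> (1, g))"
      by simp
  qed
qed

section \<open>The cocycle on the semidirect product and its nontriviality\<close>

lemma cocycle_semidirect: "cocycle G (semidirect_topology X) S (\<lambda>x. to_L2 (\<beta> x))"
  unfolding cocycle_def
proof (intro conjI ballI cocycle_identity)
  have "continuous_map (semidirect_topology X) euclidean (\<lambda>x. dilation_part (fst x))"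
    using continuous_map_compose[of "semidirect_topology X" "top_of_set {0<..}" fst euclidean dilation_part]
      continuous_dilation_part
    by (simp add: semidirect_topology_def comp_def continuous_map_fst)
  from continuous_map_add[OF continuous_dilation_comp[OF continuous_fibre_cocycle] this]
  show "continuous_map (semidirect_topology X) euclidean (\<lambda>x. to_L2 (\<beta> x))"
    by (rule continuous_map_eq) (clarsimp simp: topspace_G carrier_G, rule cocycle_L2(2)[symmetric])
qed

lemma cocycle_fibre: "cocycle G0 X (fibre_representation T act) (\<lambda>g. to_L2 (\<beta> (1, g)))"
  unfolding cocycle_def fibre_representation_eq
  by (auto simp: continuous_fibre_cocycle mult_embedded carrier_G intro!: cocycle_identity)

text \<open>Only elements (1, g) enter, so the argument serves both the speciality of the fibre
  representation and nontriviality on the semidirect product.\<close>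

lemma fibre_cocycle_not_coboundary:
  assumes triv: "\<And>x. (\<forall>g\<in>carrier G0. T g x = x) \<Longrightarrow> x = 0"
    and v: "\<And>g. g \<in> carrier G0 \<Longrightarrow> to_L2 (\<beta> (1, g)) = S (1, g) v - v"
  shows False
proof -
  obtain f where f: "square_integrable haar f" "v = to_L2 f"
    using ex_to_L2 by blast
  define w where "w r = weight_vector u h r - f r" for r
  have sf: "strongly_measurable haar f"
    using f by (simp add: square_integrable_def)
  have "AE r in haar. w r = 0"
  proof (rule AE_invariant_imp_zero[OF _ _ triv])
    show "strongly_measurable haar w"
      unfolding w_def by (intro strongly_measurable_diff strongly_measurable_weight_vector sf)
    fix g assume g: "g \<in> carrier G0"
    then have x: "(1, g) \<in> carrier G"
      by (simp add: carrier_G)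
    have "to_L2 (\<beta> (1, g)) = to_L2 (\<lambda>r. \<Phi> (1, g) f r - f r)"
      by (simp add: v[OF g] f representation_to_L2 x to_L2_diff square_integrable_op)
    then have "AE r in haar. \<beta> (1, g) r = \<Phi> (1, g) f r - f r"
      by (subst (asm) to_L2_eq_iff)
        (auto intro: square_integrable_fibre_cocycle square_integrable_diff square_integrable_op x f g)
    then show "AE r in haar. T (act r g) (w r) = w r"
      using AE_space
    proof eventually_elim
      case (elim r)
      then show ?case
        using g by (simp add: w_def T_diff act_closed op_apply cocycle_function_def algebra_simps)
    qed
  qed
  \<comment> \<open>The weight now agrees almost everywhere with the square integrable
    \<open>f\<close>, against its divergence at the origin.\<close>
  then have "AE r in haar. (norm (f r))\<^sup>2 = (norm (weight_vector u h r))\<^sup>2"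
    by (auto simp: w_def)
  moreover have "(\<lambda>r. (norm (weight_vector u h r))\<^sup>2) \<in> borel_measurable haar"
    using strongly_measurable_borel_measurable_norm[OF strongly_measurable_weight_vector] by measurable
  moreover have "integrable haar (\<lambda>r. (norm (f r))\<^sup>2)"
    using f(1) by (simp add: square_integrable_def)
  ultimately have "square_integrable haar (weight_vector u h)"
    unfolding square_integrable_def
    by (intro conjI strongly_measurable_weight_vector) (rule integrable_cong_AE_imp)
  then show False
    using weight_vector_not_L2 by simp
qed

end

theorem theorem3:
  fixes G0 :: "('g, 'm) monoid_scheme"
    and X :: "'g topology"
    and act :: "real \<Rightarrow> 'g \<Rightarrow> 'g"
    and u :: "real \<Rightarrow> real"
    and T :: "'g \<Rightarrow> 'k::complex_hilbert \<Rightarrow> 'k"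
  assumes "locally_compact_group G0 X"
    and "positive_real_action G0 X act"
    and "admissible_weight u"
    and "unitary_representation G0 X T"
    and "summable_representation G0 act u T"
  shows "(\<forall>g\<in>carrier G0. given_by (fibre_representation T act g) (fibre_op T act g)) \<and>
    unitary_representation G0 X (fibre_representation T act) \<and>
    special_representation G0 X (fibre_representation T act) \<and>
    (\<exists>S :: real \<times> 'g \<Rightarrow> 'k L2 \<Rightarrow> 'k L2.
       unitary_representation (semidirect G0 act) (semidirect_topology X) S \<and>
       (\<forall>g\<in>carrier G0. S (1, g) = fibre_representation T act g) \<and>
       (\<forall>r0>0. given_by (S (r0, \<one>\<^bsub>G0\<^esub>)) (dilation r0)) \<and>
       (\<forall>h. almost_invariant G0 act u T h \<longrightarrow>
          (\<forall>x\<in>carrier (semidirect G0 act). square_integrable haar (cocycle_function T act u h x)) \<and>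
          nontrivial_cocycle (semidirect G0 act) (semidirect_topology X) S
            (\<lambda>x. to_L2 (cocycle_function T act u h x))))"
proof -
  interpret real_action_representation G0 X act T
    using assms by unfold_locales
  have triv: "x = 0" if "\<forall>g\<in>carrier G0. T g x = x" for x
    using assms(5) that by (simp add: summable_representation_def)
  have special: "special_representation G0 X (fibre_representation T act)"
  proof -
    \<comment> \<open>Summability provides an almost invariant vector, and the restriction of its
      cocycle to G0 witnesses speciality.\<close>
    obtain h where "almost_invariant G0 act u T h"
      using assms(5) by (auto simp: summable_representation_def)
    then interpret almost_invariant_vector G0 X act T u h
      using assms by unfold_locales
    show ?thesis
      unfolding special_representation_def nontrivial_cocycle_def
      using cocycle_fibre fibre_cocycle_not_coboundary[OF triv] unfolding fibre_representation_eq by blast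
  qed
  have nontrivial: "(\<forall>x\<in>carrier G. square_integrable haar (cocycle_function T act u h x)) \<and>
      nontrivial_cocycle G (semidirect_topology X) S (\<lambda>x. to_L2 (cocycle_function T act u h x))"
    if "almost_invariant G0 act u T h" for h
  proof -
    interpret almost_invariant_vector G0 X act T u h
      using assms that by unfold_locales
    \<comment> \<open>A coboundary on the semidirect product would restrict along g -> (1, g) to a
      coboundary on G0.\<close>
    have "\<not> (\<exists>v. \<forall>x\<in>carrier G. to_L2 (cocycle_function T act u h x) = S x v - v)"
      using fibre_cocycle_not_coboundary[OF triv] by (fastforce simp: carrier_G)
    then show ?thesis
      using cocycle_semidirect cocycle_L2(1) by (auto simp: nontrivial_cocycle_def carrier_G)
  qed
  show ?thesis
    using given_by_fibre unitary_representation_fibre special unitary_representation_semidirect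
      given_by_dilation nontrivial fibre_representation_eq[of T act, symmetric]
    by (intro conjI exI[of _ S]) auto
qed

end
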